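(* Consider the original Bregman iteration with iterates $u_k$ and subgradients $p_k$, and the sublabel-accurate lifted Bregman iteration with iterates $\boldsymbol u_k$ and subgradients $\tilde{\boldsymbol p}_k$, as defined in the context. Assume that the minimization problems $$\min_{u}\{H(u)+J(u)-\langle p_{k-1},u\rangle\}$$ in the original Bregman iteration have unique solutions. Moreover, assume that in the lifted iteration the solutions $\boldsymbol u_k$ of $$\min_{\boldsymbol u}\{\boldsymbol H(\boldsymbol u)+\boldsymbol J(\boldsymbol u)-\langle\tilde{\boldsymbol p}_{k-1},\boldsymbol u\rangle\}$$ in each step satisfy $\boldsymbol u_k(x)\in\boldsymbol\Gamma$, i.e., are sublabel-integral. If at every point $x$ the chosen subgradients $p_{k-1}\in\partial J(u_{k-1})$ and $\tilde{\boldsymbol p}_{k-1}\in\partial\boldsymbol J(\boldsymbol u_{k-1})$ satisfy $$\tilde{\boldsymbol p}_{k-1}(x)=p_{k-1}(x)\,\tilde{\boldsymbol\gamma},\qquad \tilde{\boldsymbol\gamma}=(\gamma_2-\gamma_1,\dots,\gamma_L-\gamma_l)^\top,$$ then the lifted iterates $\boldsymbol u_k$ correspond to the iterates $u_k$ of the original Bregman iteration in the sense that $$u_k(x)=\gamma_1+\sum_{i=1}^l\boldsymbol u_k^i(x)\,(\gamma_{i+1}-\gamma_i).$$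
   Context: Setting: $\Omega\subset\mathbb{R}^d$ is open and bounded, $\gamma_1<\dots<\gamma_L$ are real labels, $l=L-1$, $\Gamma=[\gamma_1,\gamma_L]$. The data integrand $\rho:\Omega\times\Gamma\to\overline{\mathbb{R}}=\mathbb{R}\cup\{\pm\infty\}$ is proper and non-negative, $H(u)=\int_\Omega\rho(x,u(x))\,dx$, and $J=\mathrm{TV}$ is the isotropic total variation $\int_\Omega\|Du\|_2$ (or the anisotropic total variation $\int_\Omega\|Du\|_1$) for $u\in\mathrm{BV}(\Omega;\Gamma)$. Original Bregman iteration (defined for $H$ and $J$ non-negative and convex): $p_0=0$ and, for $k=1,2,\dots$, $u_k\in\arg\min_u\{H(u)+J(u)-\langle p_{k-1},u\rangle\}$, $p_k\in\partial J(u_k)$. Lifting: for $i\in\{1,\dots,l\}$, $\alpha\in[0,1]$ put $\gamma_i^\alpha=\gamma_i+\alpha(\gamma_{i+1}-\gamma_i)$ and $\boldsymbol 1_i^\alpha=\alpha\boldsymbol 1_i+(1-\alpha)\boldsymbol 1_{i-1}\in\mathbb{R}^l$, where $\boldsymbol 1_i\in\mathbb{R}^l$ is the vector of $i$ ones followed by $l-i$ zeros. The lifted label space is $\boldsymbol\Gamma=\{\boldsymbol 1_i^\alpha: i\in\{1,\dots,l\},\alpha\in[0,1]\}$. The lifted data integrand is $$\boldsymbol\rho(x,\boldsymbol w)=\inf_{i\in\{1,\dots,l\},\,\alpha\in[0,1]}\{\rho(x,\gamma_i^\alpha)+\delta_{\boldsymbol 1_i^\alpha}(\boldsymbol w)\},\quad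 \boldsymbol w\in\mathbb{R}^l,$$ with $\delta_{\boldsymbol 1_i^\alpha}(\boldsymbol w)=0$ if $\boldsymbol w=\boldsymbol 1_i^\alpha$ and $+\infty$ otherwise; $\boldsymbol\rho^{**}$ is its Legendre–Fenchel biconjugate in the second variable and $\boldsymbol H(\boldsymbol u)=\int_\Omega\boldsymbol\rho^{**}(x,\boldsymbol u(x))\,dx$. The lifted regularizer is $\boldsymbol J(\boldsymbol u)=\int_\Omega\boldsymbol\phi^{**}(D\boldsymbol u)$ with $D\boldsymbol u$ the distributional derivative (a Radon measure) and $\boldsymbol\phi^{**}(\boldsymbol g)=\sup_{\boldsymbol q\in\boldsymbol K}\langle\boldsymbol q,\boldsymbol g\rangle$, $\boldsymbol g\in\mathbb{R}^{l\times d}$, where $\boldsymbol K=\{\boldsymbol q\in\mathbb{R}^{l\times d}:\|\boldsymbol q_i\|_2\le\gamma_{i+1}-\gamma_i,\ i=1,\dots,l\}$ in the isotropic case, with $\|\cdot\|_2$ replaced by $\|\cdot\|_\infty$ in the anisotropic case ($\boldsymbol q_i\in\mathbb{R}^d$ is the $i$-th row). The lifted functions $\boldsymbol u$ range over functions of bounded variation with values in the convex hull of $\boldsymbol\Gamma$; $\boldsymbol u^i$ denotes the $i$-th component. Lifted Bregman iteration: $\tilde{\boldsymbol p}_0=0$ and, for $k=1,2,\dots$, $\boldsymbol u_k\in\arg\min_{\boldsymbol u}\{\boldsymbol H(\boldsymbol u)+\boldsymbol J(\boldsymbol u)-\langle\tilde{\boldsymbol p}_{k-1},\boldsymbol u\rangle\}$,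 $\tilde{\boldsymbol p}_k\in\partial\boldsymbol J(\boldsymbol u_k)$. Here $\partial$ is the convex subdifferential, and the subgradients are taken to be represented by functions $p_k:\Omega\to\mathbb{R}$, $\tilde{\boldsymbol p}_k:\Omega\to\mathbb{R}^l$ (square-integrable), with $\langle p,u\rangle=\int_\Omega p\,u\,dx$ and $\langle\tilde{\boldsymbol p},\boldsymbol u\rangle=\int_\Omega\langle\tilde{\boldsymbol p}(x),\boldsymbol u(x)\rangle\,dx$. Identities between functions are understood for almost every $x\in\Omega$.
   Formalization: Convexity of H is taken as convexity of ρ(x,·) on Γ for almost every x (with ρ jointly measurable); convexity of H on BV(Ω;Γ) alone would not suffice, since ρ could have dips that no BV function meets but that the biconjugate sees. *)

theory Defs
  imports "HOL-Analysis.Analysis"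
begin

text \<open>Functions on an open set \<open>\<Omega>\<close> are total functions that are only looked at through
  \<open>lebesgue_on \<Omega>\<close>, so they are identified almost everywhere.\<close>


section \<open>Distributional derivatives that are measures\<close>

fun iterated_partial :: "'d list \<Rightarrow> (real^'d::finite \<Rightarrow> real) \<Rightarrow> real^'d \<Rightarrow> real" where
  "iterated_partial [] \<phi> = \<phi>"
| "iterated_partial (j # js) \<phi> =
     (\<lambda>x. frechet_derivative (iterated_partial js \<phi>) (at x) (axis j 1))"

definition test_functions :: "(real^'d::finite) set \<Rightarrow> (real^'d \<Rightarrow> real) set" where
  "test_functions \<Omega> = {\<phi>. (\<forall>js x. iterated_partial js \<phi> differentiable (at x)) \<and>
     compact (closure {x. \<phi> x \<noteq> 0}) \<and> closure {x. \<phi> x \<noteq> 0} \<subseteq> \<Omega>}"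

text \<open>\<open>distr_gradient \<Omega> f \<mu> s\<close>: the distributional gradient of the scalar function \<open>f\<close> is the
  vector measure with density \<open>s\<close> with respect to \<open>\<mu>\<close>.\<close>

definition distr_gradient ::
    "(real^'d::finite) set \<Rightarrow> (real^'d \<Rightarrow> real) \<Rightarrow> (real^'d) measure \<Rightarrow> (real^'d \<Rightarrow> real^'d) \<Rightarrow> bool" where
  "distr_gradient \<Omega> f \<mu> s \<longleftrightarrow> (\<forall>\<phi>\<in>test_functions \<Omega>. \<forall>j.
     (\<integral>x. f x * iterated_partial [j] \<phi> x \<partial>lebesgue_on \<Omega>) = - (\<integral>x. \<phi> x * s x $ j \<partial>\<mu>))"

definition distr_jacobian ::
    "(real^'d::finite) set \<Rightarrow> (real^'d \<Rightarrow> real^'l::finite) \<Rightarrow> (real^'d) measure \<Rightarrow>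
     (real^'d \<Rightarrow> real^'d^'l) \<Rightarrow> bool" where
  "distr_jacobian \<Omega> u \<mu> \<sigma> \<longleftrightarrow> (\<forall>i. distr_gradient \<Omega> (\<lambda>x. u x $ i) \<mu> (\<lambda>x. \<sigma> x $ i))"

text \<open>A finite vector-valued Radon measure \<open>D\<close> on \<open>\<Omega>\<close> is given by its polar decomposition
  \<open>D = \<sigma> \<mu>\<close>, where \<open>\<mu> = \<bar>D\<bar>\<close> is its total variation measure and \<open>\<sigma>\<close> has unit norm
  (Euclidean, respectively Frobenius). Finite Borel measures on an open set are Radon.\<close>

definition polar_pair ::
    "(real^'d::finite) set \<Rightarrow> (real^'d) measure \<Rightarrow> (real^'d \<Rightarrow> 'c::euclidean_space) \<Rightarrow> bool" where
  "polar_pair \<Omega> \<mu> \<sigma> \<longleftrightarrow> finite_measure \<mu> \<and> sets \<mu> = sets (restrict_space borel \<Omega>) \<and>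
     \<sigma> \<in> borel_measurable \<mu> \<and> (AE x in \<mu>. norm (\<sigma> x) = 1)"

text \<open>For positively homogeneous \<open>f\<close>, the integral \<open>\<integral> f(D)\<close> is \<open>\<integral> f(\<sigma>) d\<bar>D\<bar>\<close>. The measure \<open>D\<close>
  is passed as the predicate satisfied by those \<open>(\<mu>, \<sigma>)\<close> with \<open>D = \<sigma> \<mu>\<close>; the polar
  decomposition is unique (\<open>\<sigma>\<close> up to \<open>\<mu>\<close>-null sets), so the description below is well defined
  whenever \<open>D\<close> exists.\<close>

definition measure_integral ::
    "(real^'d::finite) set \<Rightarrow> ('c::euclidean_space \<Rightarrow> real) \<Rightarrow>
     ((real^'d) measure \<Rightarrow> (real^'d \<Rightarrow> 'c) \<Rightarrow> bool) \<Rightarrow> real" where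
  "measure_integral \<Omega> f D =
     (THE c. \<exists>\<mu> \<sigma>. polar_pair \<Omega> \<mu> \<sigma> \<and> D \<mu> \<sigma> \<and> c = (\<integral>x. f (\<sigma> x) \<partial>\<mu>))"

definition BV :: "(real^'d::finite) set \<Rightarrow> real set \<Rightarrow> (real^'d \<Rightarrow> real) set" where
  "BV \<Omega> S = {u. integrable (lebesgue_on \<Omega>) u \<and> (AE x in lebesgue_on \<Omega>. u x \<in> S) \<and>
     (\<exists>\<mu> \<sigma>. polar_pair \<Omega> \<mu> \<sigma> \<and> distr_gradient \<Omega> u \<mu> \<sigma>)}"

definition BV_vec :: "(real^'d::finite) set \<Rightarrow> (real^'l::finite) set \<Rightarrow> (real^'d \<Rightarrow> real^'l) set" where
  "BV_vec \<Omega> S = {u. integrable (lebesgue_on \<Omega>) u \<and> (AE x in lebesgue_on \<Omega>. u x \<in> S) \<and>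
     (\<exists>\<mu> \<sigma>. polar_pair \<Omega> \<mu> \<sigma> \<and> distr_jacobian \<Omega> u \<mu> \<sigma>)}"


section \<open>Data term and total variation\<close>

text \<open>Truncation by \<open>e2ennreal\<close> is harmless: all integrands used here are non-negative.\<close>

definition data_term ::
    "(real^'d::finite) set \<Rightarrow> (real^'d \<Rightarrow> 'b \<Rightarrow> ereal) \<Rightarrow> (real^'d \<Rightarrow> 'b) \<Rightarrow> ereal" where
  "data_term \<Omega> \<rho> u = enn2ereal (\<integral>\<^sup>+x. e2ennreal (\<rho> x (u x)) \<partial>lebesgue_on \<Omega>)"

definition ereal_convex_on :: "real set \<Rightarrow> (real \<Rightarrow> ereal) \<Rightarrow> bool" where
  "ereal_convex_on S f \<longleftrightarrow> (\<forall>a\<in>S. \<forall>b\<in>S. \<forall>t\<in>{0..1}.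
     f ((1 - t) * a + t * b) \<le> ereal (1 - t) * f a + ereal t * f b)"

datatype tv_kind = Isotropic | Anisotropic

fun tv_norm :: "tv_kind \<Rightarrow> real^'d::finite \<Rightarrow> real" where
  "tv_norm Isotropic g = norm g"
| "tv_norm Anisotropic g = (\<Sum>j\<in>UNIV. \<bar>g $ j\<bar>)"

definition TV :: "tv_kind \<Rightarrow> (real^'d::finite) set \<Rightarrow> (real^'d \<Rightarrow> real) \<Rightarrow> real" where
  "TV \<tau> \<Omega> u = measure_integral \<Omega> (tv_norm \<tau>) (distr_gradient \<Omega> u)"


section \<open>Lifting\<close>

text \<open>The coordinates \<open>1, \<dots>, l\<close> of \<open>\<real>\<^sup>l\<close> are indexed by a finite linearly ordered type with
  \<open>l\<close> elements; \<open>pos i\<close> is the number of the coordinate \<open>i\<close>. Labels are numbered from 1,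
  \<open>\<gamma> 1 < \<dots> < \<gamma> (l + 1)\<close>.\<close>

definition pos :: "'l::{finite,linorder} \<Rightarrow> nat" where
  "pos i = card {..i}"

definition label_gap :: "(nat \<Rightarrow> real) \<Rightarrow> 'l::{finite,linorder} \<Rightarrow> real" where
  "label_gap \<gamma> i = \<gamma> (pos i + 1) - \<gamma> (pos i)"

definition label_gaps :: "(nat \<Rightarrow> real) \<Rightarrow> real^'l::{finite,linorder}" where
  "label_gaps \<gamma> = (\<chi> i. label_gap \<gamma> i)"

definition sublabel :: "(nat \<Rightarrow> real) \<Rightarrow> nat \<Rightarrow> real \<Rightarrow> real" where
  "sublabel \<gamma> i \<alpha> = \<gamma> i + \<alpha> * (\<gamma> (i + 1) - \<gamma> i)"

definition ones :: "nat \<Rightarrow> real^'l::{finite,linorder}" where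
  "ones i = (\<chi> j. if pos j \<le> i then 1 else 0)"

definition lifted_sublabel :: "nat \<Rightarrow> real \<Rightarrow> real^'l::{finite,linorder}" where
  "lifted_sublabel i \<alpha> = \<alpha> *\<^sub>R ones i + (1 - \<alpha>) *\<^sub>R ones (i - 1)"

definition lifted_labels :: "(real^'l::{finite,linorder}) set" where
  "lifted_labels = {lifted_sublabel i \<alpha> | i \<alpha>. i \<in> {1..CARD('l)} \<and> \<alpha> \<in> {0..1}}"

definition lifted_integrand ::
    "(nat \<Rightarrow> real) \<Rightarrow> (real^'d::finite \<Rightarrow> real \<Rightarrow> ereal) \<Rightarrow> real^'d \<Rightarrow> real^'l::{finite,linorder} \<Rightarrow> ereal" where
  "lifted_integrand \<gamma> \<rho> x w = (INF (i, \<alpha>) \<in> {1..CARD('l)} \<times> {0..1}.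
     \<rho> x (sublabel \<gamma> i \<alpha>) + (if w = lifted_sublabel i \<alpha> then 0 else \<infinity>))"

definition conjugate :: "('b::euclidean_space \<Rightarrow> ereal) \<Rightarrow> 'b \<Rightarrow> ereal" where
  "conjugate f v = (SUP w. ereal (v \<bullet> w) - f w)"

definition lifted_data_term ::
    "(real^'d::finite) set \<Rightarrow> (nat \<Rightarrow> real) \<Rightarrow> (real^'d \<Rightarrow> real \<Rightarrow> ereal) \<Rightarrow>
     (real^'d \<Rightarrow> real^'l::{finite,linorder}) \<Rightarrow> ereal" where
  "lifted_data_term \<Omega> \<gamma> \<rho> = data_term \<Omega> (\<lambda>x. conjugate (conjugate (lifted_integrand \<gamma> \<rho> x)))"

fun dual_tv_norm :: "tv_kind \<Rightarrow> real^'d::finite \<Rightarrow> real" where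
  "dual_tv_norm Isotropic q = norm q"
| "dual_tv_norm Anisotropic q = infnorm q"

definition dual_set :: "tv_kind \<Rightarrow> (nat \<Rightarrow> real) \<Rightarrow> (real^'d::finite^'l::{finite,linorder}) set" where
  "dual_set \<tau> \<gamma> = {q. \<forall>i. dual_tv_norm \<tau> (q $ i) \<le> label_gap \<gamma> i}"

definition lifted_tv_integrand ::
    "tv_kind \<Rightarrow> (nat \<Rightarrow> real) \<Rightarrow> real^'d::finite^'l::{finite,linorder} \<Rightarrow> real" where
  "lifted_tv_integrand \<tau> \<gamma> g = (SUP q \<in> dual_set \<tau> \<gamma>. q \<bullet> g)"

definition lifted_TV ::
    "tv_kind \<Rightarrow> (real^'d::finite) set \<Rightarrow> (nat \<Rightarrow> real) \<Rightarrow> (real^'d \<Rightarrow> real^'l::{finite,linorder}) \<Rightarrow> real" where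
  "lifted_TV \<tau> \<Omega> \<gamma> u = measure_integral \<Omega> (lifted_tv_integrand \<tau> \<gamma>) (distr_jacobian \<Omega> u)"


section \<open>Bregman iteration\<close>

definition pairing ::
    "(real^'d::finite) set \<Rightarrow> (real^'d \<Rightarrow> 'b::euclidean_space) \<Rightarrow> (real^'d \<Rightarrow> 'b) \<Rightarrow> real" where
  "pairing \<Omega> p u = (\<integral>x. p x \<bullet> u x \<partial>lebesgue_on \<Omega>)"

text \<open>The set \<open>X\<close> is the space of functions on which \<open>J\<close> is considered (it is \<open>+\<infinity>\<close> elsewhere).\<close>

definition subdifferential ::
    "(real^'d::finite) set \<Rightarrow> (real^'d \<Rightarrow> 'b::euclidean_space) set \<Rightarrow> ((real^'d \<Rightarrow> 'b) \<Rightarrow> real) \<Rightarrow>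
     (real^'d \<Rightarrow> 'b) \<Rightarrow> (real^'d \<Rightarrow> 'b) set" where
  "subdifferential \<Omega> X J u = {p. p \<in> borel_measurable (lebesgue_on \<Omega>) \<and>
     integrable (lebesgue_on \<Omega>) (\<lambda>x. (norm (p x))\<^sup>2) \<and>
     u \<in> X \<and> (\<forall>v\<in>X. J v \<ge> J u + pairing \<Omega> p (\<lambda>x. v x - u x))}"

definition bregman_solution ::
    "(real^'d::finite) set \<Rightarrow> (real^'d \<Rightarrow> 'b::euclidean_space) set \<Rightarrow> ((real^'d \<Rightarrow> 'b) \<Rightarrow> ereal) \<Rightarrow>
     ((real^'d \<Rightarrow> 'b) \<Rightarrow> real) \<Rightarrow> (real^'d \<Rightarrow> 'b) \<Rightarrow> (real^'d \<Rightarrow> 'b) \<Rightarrow> bool" where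
  "bregman_solution \<Omega> X H J p u \<longleftrightarrow>
     is_arg_min (\<lambda>v. H v + ereal (J v) - ereal (pairing \<Omega> p v)) (\<lambda>v. v \<in> X) u"

definition bregman_iteration ::
    "(real^'d::finite) set \<Rightarrow> (real^'d \<Rightarrow> 'b::euclidean_space) set \<Rightarrow> ((real^'d \<Rightarrow> 'b) \<Rightarrow> ereal) \<Rightarrow>
     ((real^'d \<Rightarrow> 'b) \<Rightarrow> real) \<Rightarrow> (nat \<Rightarrow> real^'d \<Rightarrow> 'b) \<Rightarrow> (nat \<Rightarrow> real^'d \<Rightarrow> 'b) \<Rightarrow> bool" where
  "bregman_iteration \<Omega> X H J u p \<longleftrightarrow>
     (AE x in lebesgue_on \<Omega>. p 0 x = 0) \<and>
     (\<forall>k\<ge>1. bregman_solution \<Omega> X H J (p (k - 1)) (u k) \<and>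
            p k \<in> subdifferential \<Omega> X J (u k))"

end

theory Submission
  imports Defs
begin

text \<open>Let \<open>z\<close> be the projection \<open>\<gamma> 1 + \<langle>label_gaps \<gamma>, U\<rangle>\<close> of the lifted minimiser \<open>U\<close>, and \<open>u\<close> the original
  minimiser. The coupling of the subgradients makes the two linear terms differ only by a constant.
  Projecting does not increase the total variation, by the triangle inequality, and lifting
  \<open>u\<close> does not increase it either: the components of the lifted function have derivatives
  \<open>\<theta>\<^sub>i Du\<close> with \<open>\<theta>\<^sub>i \<ge> 0\<close> and \<open>\<Sum>\<theta>\<^sub>i \<le> 1\<close>. For the data term, the biconjugate at a lifted label is
  only the lower semicontinuous envelope of \<open>\<rho>\<close>, which may be smaller than \<open>\<rho>\<close> at the boundary of
  the domain. The comparison is therefore made at the midpoint \<open>w = (u + z) / 2\<close>: where \<open>u \<noteq> z\<close> it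
  lies inside the domain, where convexity bounds \<open>\<rho>\<close> by the envelope, and where \<open>u = z\<close> nothing has
  to be shown. Hence \<open>w\<close> minimises the original energy as well, and uniqueness gives \<open>z = u\<close>.\<close>

section \<open>Smooth functions with compact support\<close>

text \<open>\<open>TV\<close> and \<open>lifted_TV\<close> are definite descriptions over polar
  decompositions. They can be evaluated once the integral of a positively homogeneous function is
  known to depend on the vector measure alone; that rests on the fundamental lemma and hence on a
  supply of test functions. The hard estimate is the one for lifting: the components of
  \<open>lift\<close> are only piecewise linear and the derivative of u is only a measure, so no
  classical chain rule applies. Both u and the ramps are smoothed, the weights produced by the
  smooth chain rule stay in a compact convex set, and \<theta> is a weak limit of them; no pointwise
  formula for \<theta> is required. Choosing the midpoint w dictates the shape of the data estimate:
  2 H(w) + H'(W) \<le> 2 H(u) + H'(U), where W is the lift of u and H' the lifted data term. Adding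
  the optimality of U against W removes the lifted terms and leaves twice the desired comparison of
  w with u.\<close>

definition flat :: "real poly \<Rightarrow> real \<Rightarrow> real" where
  "flat p t = (if t > 0 then poly p (1 / t) * exp (- (1 / t)) else 0)"

text \<open>If f(t) = p(1/t) exp(-1/t), then f'(t) = q(1/t) exp(-1/t) with q = X^2 (p - p').
  Carrying the polynomial as a parameter makes the family closed under differentiation.\<close>

definition flat_step :: "real poly \<Rightarrow> real poly" where
  "flat_step p = monom 1 2 * (p - pderiv p)"

text \<open>This is the difference quotient at 0. Under s = 1/t it becomes s p(s) exp(-s), where the
  exponential wins.\<close>

lemma flat_over_t: "((\<lambda>t. flat p t / t) \<longlongrightarrow> 0) (at_right 0)"
proof -
  have m: "((\<lambda>s::real. s ^ Suc n * exp (- s)) \<longlongrightarrow> 0) at_top" for n :: nat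
  proof -
    have "((\<lambda>s::real. s ^ Suc n / exp s) \<longlongrightarrow> 0) at_top"
      by (rule tendsto_power_div_exp_0)
    then show ?thesis by (simp only: exp_minus divide_inverse)
  qed
  have "((\<lambda>s. \<Sum>i\<le>degree p. coeff p i * (s ^ Suc i * exp (- s))) \<longlongrightarrow> (\<Sum>i\<le>degree p. coeff p i * 0)) at_top"
    by (intro tendsto_intros m)
  then have "((\<lambda>s. s * (poly p s * exp (- s))) \<longlongrightarrow> 0) at_top"
    by (simp add: poly_altdef sum_distrib_left sum_distrib_right algebra_simps)
  then have "((\<lambda>t. inverse t * (poly p (inverse t) * exp (- inverse t))) \<longlongrightarrow> 0) (at_right 0)"
    by (rule filterlim_compose) (rule filterlim_inverse_at_top_right)
  then show ?thesis
    by (rule Lim_transform_eventually)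
       (auto simp: flat_def eventually_at_right_field field_simps intro!: exI[of _ 1])
qed

lemma flat_derivative: "(flat p has_real_derivative flat (flat_step p) t) (at t)"
proof -
  consider "t > 0" | "t < 0" | "t = 0" by linarith
  then show ?thesis
  proof cases
    case 1
    have "((\<lambda>t. poly p (1 / t) * exp (- (1 / t))) has_real_derivative flat (flat_step p) t) (at t)"
      using 1 
      by (auto intro!: derivative_eq_intros DERIV_chain2[OF poly_DERIV] simp: flat_def flat_step_def poly_monom)
         (simp add: field_simps power2_eq_square)
    then show ?thesis
      by (rule DERIV_cong_ev[THEN iffD1, rotated 3])
         (use 1 in \<open>auto simp: flat_def eventually_nhds intro!: exI[of _ "{0<..}"]\<close>)
  next
    case 2
    have "((\<lambda>t. 0) has_real_derivative flat (flat_step p) t) (at t)"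
      using 2 by (simp add: flat_def)
    then show ?thesis
      by (rule DERIV_cong_ev[THEN iffD1, rotated 3])
         (use 2 in \<open>auto simp: flat_def eventually_nhds intro!: exI[of _ "{..<0}"]\<close>)
  next
    case 3
    have l: "((\<lambda>t. flat p t / t) \<longlongrightarrow> 0) (at_left 0)"
      by (rule tendsto_eventually) (auto simp: flat_def eventually_at_left_field intro!: exI[of _ "-1"])
    show ?thesis
      using 3 filterlim_split_at[OF l flat_over_t] by (simp add: DERIV_def flat_def)
  qed
qed

lemma flat_1_pos: "t > 0 \<Longrightarrow> flat 1 t > 0"
  by (simp add: flat_def)

lemma flat_1_bounds: "0 \<le> flat 1 t" "flat 1 t \<le> 1"
  by (auto simp: flat_def)

lemma flat_eq_0: "t \<le> 0 \<Longrightarrow> flat p t = 0"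
  by (simp add: flat_def)

lemma flat_1_tendsto: "(flat 1 \<longlongrightarrow> 1) at_top"
proof -
  have "((\<lambda>t::real. exp (- inverse t)) \<longlongrightarrow> exp (- 0)) at_top"
    by (intro tendsto_intros tendsto_inverse_0_at_top filterlim_ident)
  then have "((\<lambda>t::real. exp (- inverse t)) \<longlongrightarrow> 1) at_top" by simp
  then show ?thesis
    by (rule Lim_transform_eventually)
       (auto simp: flat_def eventually_at_top_dense field_simps intro!: exI[of _ 0])
qed

text \<open>The class is closed under partial derivatives, so membership alone gives
  differentiability of all iterated partials. Profiles in a single coordinate suffice as generators
  because bumps on boxes are products of them.\<close>

inductive_set flat_algebra :: "(real^'d::finite \<Rightarrow> real) set" where
  flat: "(\<lambda>x. flat p (c * x $ j + a)) \<in> flat_algebra"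
| const: "(\<lambda>x. c) \<in> flat_algebra"
| add: "f \<in> flat_algebra \<Longrightarrow> g \<in> flat_algebra \<Longrightarrow> (\<lambda>x. f x + g x) \<in> flat_algebra"
| mult: "f \<in> flat_algebra \<Longrightarrow> g \<in> flat_algebra \<Longrightarrow> (\<lambda>x. f x * g x) \<in> flat_algebra"

lemma flat_algebra_prod:
  "(\<And>i. i \<in> I \<Longrightarrow> f i \<in> flat_algebra) \<Longrightarrow> (\<lambda>x. \<Prod>i\<in>I. f i x) \<in> flat_algebra"
  by (induction I rule: infinite_finite_induct) (auto intro: flat_algebra.intros)

lemma flat_algebra_has_derivative:
  fixes f :: "real^'d::finite \<Rightarrow> real"
  assumes "f \<in> flat_algebra"
  shows "\<exists>f'. (\<forall>x. (f has_derivative (\<lambda>h. \<Sum>j\<in>UNIV. f' j x * h $ j)) (at x)) \<and> (\<forall>j. f' j \<in> flat_algebra)"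
  using assms
proof induction
  case (flat p c j a)
  let ?f' = "\<lambda>k x. (if k = j then c else 0) * flat (flat_step p) (c * (x::real^'d) $ j + a)"
  have "((\<lambda>x. flat p (c * x $ j + a)) has_derivative (\<lambda>h. \<Sum>k\<in>UNIV. ?f' k x * h $ k)) (at x)" for x :: "real^'d"
  proof -
    have "((\<lambda>x. c * x $ j + a) has_derivative (\<lambda>h. c * h $ j)) (at x)"
      by (auto intro!: derivative_eq_intros bounded_linear.has_derivative[OF bounded_linear_vec_nth])
    from DERIV_compose_FDERIV[OF flat_derivative this]
    show ?thesis
      by (rule has_derivative_eq_rhs) (auto simp: fun_eq_iff if_distrib[of "\<lambda>c. c * _"] mult.assoc sum.delta cong: if_cong)
  qed
  moreover have "?f' k \<in> flat_algebra" for k by (intro flat_algebra.intros)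
  ultimately show ?case by (intro exI[of _ ?f']) blast
next
  case (const c)
  show ?case by (intro exI[of _ "\<lambda>j x. 0"]) (auto intro: flat_algebra.intros)
next
  case (add f g)
  then obtain f' g' where *: "\<forall>x. (f has_derivative (\<lambda>h. \<Sum>j\<in>UNIV. f' j x * h $ j)) (at x)" "\<forall>j. f' j \<in> flat_algebra"
    "\<forall>x. (g has_derivative (\<lambda>h. \<Sum>j\<in>UNIV. g' j x * h $ j)) (at x)" "\<forall>j. g' j \<in> flat_algebra" by blast
  have "((\<lambda>x. f x + g x) has_derivative (\<lambda>h. \<Sum>j\<in>UNIV. (f' j x + g' j x) * h $ j)) (at x)" for x
    by (rule has_derivative_eq_rhs, rule has_derivative_add[OF *(1)[rule_format] *(3)[rule_format]])
       (simp add: algebra_simps sum.distrib)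
  with * show ?case by (intro exI[of _ "\<lambda>j x. f' j x + g' j x"]) (auto intro: flat_algebra.intros)
next
  case (mult f g)
  then obtain f' g' where *: "\<forall>x. (f has_derivative (\<lambda>h. \<Sum>j\<in>UNIV. f' j x * h $ j)) (at x)" "\<forall>j. f' j \<in> flat_algebra"
    "\<forall>x. (g has_derivative (\<lambda>h. \<Sum>j\<in>UNIV. g' j x * h $ j)) (at x)" "\<forall>j. g' j \<in> flat_algebra" by blast
  have "((\<lambda>x. f x * g x) has_derivative (\<lambda>h. \<Sum>j\<in>UNIV. (f x * g' j x + f' j x * g x) * h $ j)) (at x)" for x
    by (rule has_derivative_eq_rhs, rule has_derivative_mult[OF *(1)[rule_format] *(3)[rule_format]])
       (simp add: algebra_simps sum.distrib sum_distrib_left)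
  moreover have "(\<lambda>x. f x * g' j x + f' j x * g x) \<in> flat_algebra" for j
    using mult.hyps *(2,4) by (intro flat_algebra.intros) auto
  ultimately show ?case
    by (intro exI[of _ "\<lambda>j x. f x * g' j x + f' j x * g x"]) auto
qed

lemma flat_algebra_partial:
  assumes "f \<in> flat_algebra"
  shows "f differentiable (at x)" "(\<lambda>x. frechet_derivative f (at x) (axis j 1)) \<in> flat_algebra"
proof -
  obtain f' where f': "\<And>x. (f has_derivative (\<lambda>h. \<Sum>j\<in>UNIV. f' j x * h $ j)) (at x)" "\<And>j. f' j \<in> flat_algebra"
    using flat_algebra_has_derivative[OF assms] by blast
  show "f differentiable (at x)" using f' by (auto simp: differentiable_def)
  have "frechet_derivative f (at x) (axis j 1) = f' j x" for x
    unfolding frechet_derivative_at[OF f'(1), symmetric]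
    by (simp add: axis_def if_distrib[of "\<lambda>c. _ * c"] cong: if_cong)
  then show "(\<lambda>x. frechet_derivative f (at x) (axis j 1)) \<in> flat_algebra" using f'(2) by simp
qed

lemma flat_algebra_test_function:
  assumes f: "f \<in> flat_algebra" and 0: "\<And>x. x \<notin> K \<Longrightarrow> f x = 0" and K: "compact K" "K \<subseteq> \<Omega>"
  shows "f \<in> test_functions \<Omega>"
proof -
  have "iterated_partial js f \<in> flat_algebra" for js
    by (induction js) (auto simp: f intro: flat_algebra_partial)
  then have d: "iterated_partial js f differentiable (at x)" for js x
    by (rule flat_algebra_partial)
  have "closure {x. f x \<noteq> 0} \<subseteq> K"
    using 0 compact_imp_closed[OF K(1)] by (intro closure_minimal) auto
  then show ?thesis
    using d K compact_closure by (auto simp: test_functions_def intro: bounded_subset[OF compact_imp_bounded[OF K(1)]] closure_subset[THEN subsetD])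
qed

text \<open>\<open>c\<close> is a steepness and \<open>e\<close> a margin: the bump vanishes within
  distance \<open>e / c\<close> of the faces, so e > 0 gives compact support inside the open box.
  With e = 1 and c = n + 1 the bumps tend to the indicator of the box; with e = 0 and c = 1 one
  obtains the profile of the mollifier.\<close>

definition box_bump :: "real \<Rightarrow> real \<Rightarrow> (real^'d) \<Rightarrow> (real^'d) \<Rightarrow> real^'d::finite \<Rightarrow> real" where
  "box_bump c e a b x = (\<Prod>j\<in>UNIV. flat 1 (c * (x $ j - a $ j) - e) * flat 1 (c * (b $ j - x $ j) - e))"

lemma box_bump_flat_algebra: "box_bump c e a b \<in> flat_algebra"
proof -
  have "(\<lambda>x. flat 1 (c * x $ j + (- c * a $ j - e)) * flat 1 ((-c) * x $ j + (c * b $ j - e))) \<in> flat_algebra" for j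
    by (intro flat_algebra.intros)
  then show ?thesis
    unfolding box_bump_def[abs_def] by (intro flat_algebra_prod) (simp add: algebra_simps)
qed

lemma box_bump_nonneg: "0 \<le> box_bump c e a b x"
  by (auto simp: box_bump_def intro!: prod_nonneg mult_nonneg_nonneg flat_1_bounds)

lemma box_bump_le_1: "box_bump c e a b x \<le> 1"
  by (auto simp: box_bump_def intro!: prod_le_1 mult_nonneg_nonneg flat_1_bounds mult_le_one)

lemma box_bump_eq_0:
  assumes "c > 0" and "x \<notin> {x. \<forall>j. a $ j + e / c \<le> x $ j \<and> x $ j \<le> b $ j - e / c}"
  shows "box_bump c e a b x = 0"
proof -
  obtain j where "\<not> (a $ j + e / c \<le> x $ j \<and> x $ j \<le> b $ j - e / c)" using assms by blast
  then have "c * (x $ j - a $ j) - e \<le> 0 \<or> c * (b $ j - x $ j) - e \<le> 0"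
    using assms(1) by (auto simp: field_simps)
  then show ?thesis by (auto simp: box_bump_def flat_eq_0 intro!: exI[of _ j])
qed

lemma box_bump_test_function:
  assumes "c > 0" "e > 0" "box a b \<subseteq> \<Omega>"
  shows "box_bump c e a b \<in> test_functions \<Omega>"
proof (rule flat_algebra_test_function[OF box_bump_flat_algebra])
  let ?d = "(\<chi> j. e / c) :: real^'a"
  show "box_bump c e a b x = 0" if "x \<notin> cbox (a + ?d) (b - ?d)" for x
    using that assms by (intro box_bump_eq_0) (auto simp: mem_box_cart)
  show "cbox (a + ?d) (b - ?d) \<subseteq> \<Omega>"
  proof (rule subset_trans[OF _ assms(3)], rule subsetI)
    fix x assume "x \<in> cbox (a + ?d) (b - ?d)"
    then have "a $ j + e / c \<le> x $ j" "x $ j \<le> b $ j - e / c" for j by (auto simp: mem_box_cart)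
    moreover have "e / c > 0" using assms by simp
    ultimately show "x \<in> box a b" unfolding mem_box_cart by (smt (verit))
  qed
qed simp

text \<open>Inside the box every argument (n + 1) t - 1 with t > 0 tends to infinity, where
  \<open>flat 1\<close> tends to 1. Outside, some factor is zero for every n.\<close>

lemma box_bump_tendsto:
  "(\<lambda>n. box_bump (real (Suc n)) 1 a b x) \<longlonglongrightarrow> indicator (box a b) x"
proof (cases "x \<in> box a b")
  case True
  have lim: "(\<lambda>n. flat 1 (real (Suc n) * t - 1)) \<longlonglongrightarrow> 1" if "t > 0" for t :: real
  proof (rule filterlim_compose[OF flat_1_tendsto])
    have "filterlim (\<lambda>n. -1 + real (Suc n) * t) at_top sequentially"
      by (intro filterlim_tendsto_add_at_top[OF tendsto_const] filterlim_at_top_mult_tendsto_pos[OF tendsto_const that]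
          filterlim_compose[OF filterlim_real_sequentially filterlim_Suc])
    then show "filterlim (\<lambda>n. real (Suc n) * t - 1) at_top sequentially" by simp
  qed
  have "(\<lambda>n. box_bump (real (Suc n)) 1 a b x) \<longlonglongrightarrow> (\<Prod>j\<in>(UNIV::'a set). 1 * 1)"
    unfolding box_bump_def using True by (intro tendsto_prod tendsto_mult lim) (auto simp: mem_box_cart)
  then show ?thesis using True by simp
next
  case False
  have "box_bump (real (Suc n)) 1 a b x = 0" for n
  proof (rule box_bump_eq_0)
    have "1 / real (Suc n) > 0" by simp
    then show "x \<notin> {x. \<forall>j. a $ j + 1 / real (Suc n) \<le> x $ j \<and> x $ j \<le> b $ j - 1 / real (Suc n)}"
      using False unfolding mem_box_cart mem_Collect_eq by (smt (verit))
  qed simp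
  then show ?thesis using False by simp
qed

section \<open>Fundamental lemma of the calculus of variations for measures\<close>

lemma sets_restrict_borel_eq_boxes:
  fixes \<Omega> :: "(real^'d::finite) set"
  assumes "open \<Omega>"
  shows "sets (restrict_space borel \<Omega>) = sigma_sets \<Omega> {box a b | a b. box a b \<subseteq> \<Omega>}"
    (is "_ = sigma_sets _ ?E")
proof
  interpret sigma_algebra \<Omega> "sigma_sets \<Omega> ?E" by (rule sigma_algebra_sigma_sets) auto
  have *: "(\<lambda>x. x) \<in> measurable (sigma \<Omega> ?E) borel"
  proof (rule borel_measurableI)
    fix S :: "(real^'d) set" assume "open S"
    \<comment> \<open>Every open subset of \<Omega> is a countable union of open boxes contained in
      it. Hence the identity is measurable from the box-generated sigma-algebra to the Borel
      sets.\<close>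
    then have "open (S \<inter> \<Omega>)" using assms by auto
    then obtain D where D: "countable D" "D \<subseteq> Pow (S \<inter> \<Omega>)" "\<And>X. X \<in> D \<Longrightarrow> \<exists>a b. X = box a b" "\<Union>D = S \<inter> \<Omega>"
      using open_countable_Union_open_box by metis
    then have "D \<subseteq> ?E" by blast
    then have "\<Union>D \<in> sigma_sets \<Omega> ?E" using D(1) by (intro countable_Union) auto
    moreover have "?E \<subseteq> Pow \<Omega>" by auto
    ultimately show "(\<lambda>x. x) -` S \<inter> space (sigma \<Omega> ?E) \<in> sets (sigma \<Omega> ?E)"
      by (simp add: D(4) space_measure_of_conv)
  qed
  show "sets (restrict_space borel \<Omega>) \<subseteq> sigma_sets \<Omega> ?E"
  proof
    fix A assume "A \<in> sets (restrict_space borel \<Omega>)"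
    then obtain B where "B \<in> sets borel" "A = \<Omega> \<inter> B" by (auto simp: sets_restrict_space)
    then show "A \<in> sigma_sets \<Omega> ?E"
      using measurable_sets[OF * \<open>B \<in> sets borel\<close>] Pow_def
      by (simp add: space_measure_of_conv Int_commute Collect_mono_iff subset_iff) (smt (verit) Collect_subset Int_commute Pow_iff mem_Collect_eq sets_measure_of subsetI subset_iff)
  qed
  show "sigma_sets \<Omega> ?E \<subseteq> sets (restrict_space borel \<Omega>)"
  proof -
    have "sigma_sets (space (restrict_space borel \<Omega>)) ?E \<subseteq> sets (restrict_space borel \<Omega>)"
      by (rule sets.sigma_sets_subset) (auto simp: sets_restrict_space_iff assms)
    then show ?thesis using assms by (simp add: space_restrict_space)
  qed
qed

lemma box_Int_box_vec:
  fixes a b c d :: "real^'d::finite"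
  shows "\<exists>e f. box a b \<inter> box c d = box e f"
  by (auto simp: box_Int_box)

lemma test_function_bounds:
  assumes "\<phi> \<in> test_functions \<Omega>"
  shows "continuous_on UNIV \<phi>" "\<exists>B\<ge>0. \<forall>x. \<bar>\<phi> x\<bar> \<le> B"
proof -
  have d: "\<phi> differentiable (at x)" for x
    using assms by (auto simp: test_functions_def dest: spec[of _ "[]"])
  then show c: "continuous_on UNIV \<phi>"
    by (intro continuous_at_imp_continuous_on ballI differentiable_imp_continuous_within)
  have "bounded (\<phi> ` closure {x. \<phi> x \<noteq> 0})"
    using assms by (intro compact_imp_bounded compact_continuous_image continuous_on_subset[OF c])
      (auto simp: test_functions_def)
  then obtain B where "\<And>x. x \<in> closure {x. \<phi> x \<noteq> 0} \<Longrightarrow> \<bar>\<phi> x\<bar> \<le> B"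
    by (auto simp: bounded_iff)
  then have "\<bar>\<phi> x\<bar> \<le> max B 0" for x
    using closure_subset[of "{x. \<phi> x \<noteq> 0}"] by (cases "\<phi> x = 0") force+
  then show "\<exists>B\<ge>0. \<forall>x. \<bar>\<phi> x\<bar> \<le> B" by (intro exI[of _ "max B 0"]) auto
qed

lemma test_function_measurable:
  assumes "\<phi> \<in> test_functions \<Omega>" "sets \<mu> = sets (restrict_space borel \<Omega>)"
  shows "\<phi> \<in> borel_measurable \<mu>"
  using borel_measurable_continuous_onI[OF test_function_bounds(1)[OF assms(1)]]
  by (simp add: measurable_cong_sets[OF assms(2) refl] measurable_restrict_space1)

text \<open>Bumps converge to indicators, so \<open>r\<close> integrates to zero over every open box
  in \<Omega>. Its positive and negative parts are then densities of two measures that agree on an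
  intersection-stable generator, hence everywhere.\<close>

lemma fundamental_lemma:
  fixes \<Omega> :: "(real^'d::finite) set"
  assumes "open \<Omega>" "finite_measure \<kappa>" and s: "sets \<kappa> = sets (restrict_space borel \<Omega>)"
    and r[measurable]: "integrable \<kappa> r"
    and 0: "\<And>\<phi>. \<phi> \<in> test_functions \<Omega> \<Longrightarrow> (\<integral>x. \<phi> x * r x \<partial>\<kappa>) = 0"
  shows "AE x in \<kappa>. r x = 0"
proof -
  interpret finite_measure \<kappa> by fact
  let ?E = "{box a b | a b. box a b \<subseteq> \<Omega>}"
  have sp: "space \<kappa> = \<Omega>" using sets_eq_imp_space_eq[OF s] by (simp add: space_restrict_space)
  have boxes: "(\<integral>x. indicator (box a b) x * r x \<partial>\<kappa>) = 0" if ab: "box a b \<subseteq> \<Omega>" for a b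
  proof -
    have t: "box_bump (real (Suc n)) 1 a b \<in> test_functions \<Omega>" for n
      using ab by (intro box_bump_test_function) auto
    have "(\<lambda>n. \<integral>x. box_bump (real (Suc n)) 1 a b x * r x \<partial>\<kappa>) \<longlonglongrightarrow> (\<integral>x. indicator (box a b) x * r x \<partial>\<kappa>)"
    proof (rule integral_dominated_convergence[where w = "\<lambda>x. \<bar>r x\<bar>"])
      have "box a b \<in> sets \<kappa>" using ab assms(1) by (simp add: s sets_restrict_space_iff)
      then show "(\<lambda>x. indicator (box a b) x * r x) \<in> borel_measurable \<kappa>" by measurable
      show "(\<lambda>x. box_bump (real (Suc n)) 1 a b x * r x) \<in> borel_measurable \<kappa>" for n
        using test_function_measurable[OF t s] by measurable
      show "AE x in \<kappa>. norm (box_bump (real (Suc n)) 1 a b x * r x) \<le> \<bar>r x\<bar>" for n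
        using box_bump_le_1[of "real (Suc n)" 1 a b] box_bump_nonneg[of "real (Suc n)" 1 a b]
        by (auto simp: abs_mult intro!: mult_left_le_one_le)
    qed (use r in \<open>auto intro!: tendsto_intros box_bump_tendsto simp del: of_nat_Suc\<close>)
    then show ?thesis using 0[OF t] by (simp add: LIMSEQ_const_iff)
  qed
  \<comment> \<open>Uniqueness of measures needs a countable cover of \<Omega> by generators of
    finite measure; \<Omega> itself need not be a box.\<close>
  obtain D where D: "countable D" "D \<subseteq> Pow \<Omega>" "\<And>X. X \<in> D \<Longrightarrow> \<exists>a b. X = box a b" "\<Union>D = \<Omega>"
    using open_countable_Union_open_box[OF assms(1)] by metis
  have "density \<kappa> (\<lambda>x. ennreal (max 0 (r x))) = density \<kappa> (\<lambda>x. ennreal (max 0 (- r x)))"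
  proof (rule measure_eqI_generator_eq_countable[of ?E \<Omega>])
    show "Int_stable ?E"
    proof (rule Int_stableI)
      fix A B assume "A \<in> ?E" "B \<in> ?E"
      then obtain a b c d where "A = box a b" "B = box c d" "A \<subseteq> \<Omega>" by blast
      moreover obtain e f where "box a b \<inter> box c d = box e f" using box_Int_box_vec by blast
      ultimately show "A \<inter> B \<in> ?E" by blast
    qed
    have fin: "emeasure (density \<kappa> (\<lambda>x. ennreal (max 0 (f x)))) X = ennreal (\<integral>x. indicator X x * max 0 (f x) \<partial>\<kappa>)"
      if "X \<in> sets \<kappa>" "integrable \<kappa> f" for X and f :: "real^'d \<Rightarrow> real"
    proof -
      have "integrable \<kappa> (\<lambda>x. indicator X x * max 0 (f x))"
        using that by (subst mult.commute, auto intro!: integrable_real_mult_indicator integrable_max)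
      from nn_integral_eq_integral[OF this]
      have "(\<integral>\<^sup>+ x. ennreal (indicator X x * max 0 (f x)) \<partial>\<kappa>) = ennreal (\<integral>x. indicator X x * max 0 (f x) \<partial>\<kappa>)"
        by (simp add: indicator_def)
      then show ?thesis
        using that by (subst emeasure_density) (auto simp: ennreal_mult' ennreal_indicator mult.commute)
    qed
    show "emeasure (density \<kappa> (\<lambda>x. ennreal (max 0 (r x)))) X = emeasure (density \<kappa> (\<lambda>x. ennreal (max 0 (- r x)))) X"
      if "X \<in> ?E" for X
    proof -
      from that obtain a b where X: "X = box a b" "box a b \<subseteq> \<Omega>" by blast
      then have Xs: "X \<in> sets \<kappa>" using assms(1) by (simp add: s sets_restrict_space_iff)
      have i: "integrable \<kappa> (\<lambda>x. indicator X x * max 0 (f x))" if "integrable \<kappa> f" for f :: "_ \<Rightarrow> real"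
        using that Xs by (subst mult.commute, auto intro!: integrable_real_mult_indicator integrable_max)
      have "(\<integral>x. indicator X x * max 0 (r x) \<partial>\<kappa>) - (\<integral>x. indicator X x * max 0 (- r x) \<partial>\<kappa>)
          = (\<integral>x. indicator X x * max 0 (r x) - indicator X x * max 0 (- r x) \<partial>\<kappa>)"
        by (rule Bochner_Integration.integral_diff[symmetric]) (use i[OF r] i[of "\<lambda>x. - r x"] r in auto)
      also have "\<dots> = (\<integral>x. indicator X x * r x \<partial>\<kappa>)"
        by (rule Bochner_Integration.integral_cong) (auto simp: indicator_def max_def)
      also have "\<dots> = 0" using boxes X by simp
      finally show ?thesis using r Xs by (subst (1 2) fin) auto
    qed
    show "D \<subseteq> ?E" "\<Union>D = \<Omega>" "countable D" using D by blast+
    show "emeasure (density \<kappa> (\<lambda>x. ennreal (max 0 (r x)))) X \<noteq> \<infinity>" if XD: "X \<in> D" for X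
    proof -
      have "X \<in> sets \<kappa>"
      proof -
        obtain a b where "X = box a b" using D(3)[OF XD] by blast
        moreover have "X \<subseteq> \<Omega>" using D(2) XD by blast
        ultimately show ?thesis using assms(1) by (simp add: s sets_restrict_space_iff)
      qed
      then show ?thesis using r by (subst fin) auto
    qed
  qed (auto simp: s sets_restrict_borel_eq_boxes[OF assms(1)])
  then have "AE x in \<kappa>. ennreal (max 0 (r x)) = ennreal (max 0 (- r x))"
    by (subst (asm) density_unique_iff) auto
  then show ?thesis by eventually_elim (auto simp: max_def split: if_splits)
qed

section \<open>Measures given by densities\<close>

text \<open>Both measures are absolutely continuous with respect to their sum, which is again
  finite; the densities are the Radon-Nikodym derivatives, taken real-valued.\<close>

lemma common_density:
  assumes "finite_measure \<mu>" "finite_measure \<nu>" and s: "sets \<nu> = sets \<mu>"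
  obtains \<kappa> and h k :: "'a \<Rightarrow> real" where "finite_measure \<kappa>" "sets \<kappa> = sets \<mu>"
    "h \<in> borel_measurable \<kappa>" "\<And>x. 0 \<le> h x" "\<mu> = density \<kappa> (\<lambda>x. ennreal (h x))"
    "k \<in> borel_measurable \<kappa>" "\<And>x. 0 \<le> k x" "\<nu> = density \<kappa> (\<lambda>x. ennreal (k x))"
proof -
  define \<kappa> where "\<kappa> = measure_of (space \<mu>) (sets \<mu>) (\<lambda>A. emeasure \<mu> A + emeasure \<nu> A)"
  have sk: "sets \<kappa> = sets \<mu>" and spk: "space \<kappa> = space \<mu>" by (simp_all add: \<kappa>_def)
  have e: "emeasure \<kappa> A = emeasure \<mu> A + emeasure \<nu> A" if "A \<in> sets \<mu>" for A
  proof (rule emeasure_measure_of[OF \<kappa>_def])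
    show "countably_additive (sets \<kappa>) (\<lambda>A. emeasure \<mu> A + emeasure \<nu> A)"
      unfolding countably_additive_def
    proof (intro allI impI)
      fix A :: "nat \<Rightarrow> 'a set" assume A: "range A \<subseteq> sets \<kappa>" "disjoint_family A" "\<Union>(range A) \<in> sets \<kappa>"
      have "(\<Sum>i. emeasure \<mu> (A i) + emeasure \<nu> (A i)) = (\<Sum>i. emeasure \<mu> (A i)) + (\<Sum>i. emeasure \<nu> (A i))"
        by (rule suminf_add[symmetric]) auto
      then show "(\<Sum>i. emeasure \<mu> (A i) + emeasure \<nu> (A i)) = emeasure \<mu> (\<Union>(range A)) + emeasure \<nu> (\<Union>(range A))"
        using A by (simp add: suminf_emeasure sk s)
    qed
  qed (use that sets.space_closed[of \<mu>] in \<open>auto simp: sk positive_def\<close>)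
  interpret \<mu>: finite_measure \<mu> by fact
  interpret \<nu>: finite_measure \<nu> by fact
  have fk: "finite_measure \<kappa>"
    by (rule finite_measureI)
       (use e[OF sets.top] \<mu>.emeasure_finite[of "space \<mu>"] \<nu>.emeasure_finite[of "space \<mu>"] in \<open>simp add: spk\<close>)
  interpret \<kappa>: finite_measure \<kappa> by (rule fk)
  have "absolutely_continuous \<kappa> \<mu>" "absolutely_continuous \<kappa> \<nu>"
    by (auto simp: absolutely_continuous_def null_sets_def sk s e)
  note ac = this
  obtain h where h: "h \<in> borel_measurable \<kappa>" "AE x in \<kappa>. RN_deriv \<kappa> \<mu> x = ennreal (h x)" "\<And>x. 0 \<le> h x"
    using \<kappa>.real_RN_deriv[OF assms(1) ac(1)] sk by metis
  obtain k where k: "k \<in> borel_measurable \<kappa>" "AE x in \<kappa>. RN_deriv \<kappa> \<nu> x = ennreal (k x)" "\<And>x. 0 \<le> k x"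
    using \<kappa>.real_RN_deriv[OF assms(2) ac(2)] sk s by metis
  have "\<mu> = density \<kappa> (RN_deriv \<kappa> \<mu>)" using \<kappa>.density_RN_deriv[OF ac(1)] sk by simp
  also have "\<dots> = density \<kappa> (\<lambda>x. ennreal (h x))" using h by (intro density_cong) auto
  finally have 1: "\<mu> = density \<kappa> (\<lambda>x. ennreal (h x))" .
  have "\<nu> = density \<kappa> (RN_deriv \<kappa> \<nu>)" using \<kappa>.density_RN_deriv[OF ac(2)] sk s by simp
  also have "\<dots> = density \<kappa> (\<lambda>x. ennreal (k x))" using k by (intro density_cong) auto
  finally have 2: "\<nu> = density \<kappa> (\<lambda>x. ennreal (k x))" .
  show ?thesis using that[OF fk sk h(1,3) 1 k(1,3) 2] .
qed

lemma integrable_mult_bounded: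
  fixes f g :: "'a \<Rightarrow> real"
  assumes "integrable M g" "f \<in> borel_measurable M" "\<And>x. \<bar>f x\<bar> \<le> C"
  shows "integrable M (\<lambda>x. f x * g x)"
proof (rule Bochner_Integration.integrable_bound)
  show "integrable M (\<lambda>x. C * g x)" using assms(1) by simp
  show "(\<lambda>x. f x * g x) \<in> borel_measurable M"
    using assms(1,2) by (intro borel_measurable_times) auto
  have "norm (f x * g x) \<le> norm (C * g x)" for x
    using mult_right_mono[OF assms(3)[of x] abs_ge_zero[of "g x"]] assms(3)[of x] by (simp add: abs_mult)
  then show "AE x in M. norm (f x * g x) \<le> norm (C * g x)" by simp
qed

lemma test_function_mult_integrable:
  fixes g :: "real^'d::finite \<Rightarrow> real"
  assumes "\<phi> \<in> test_functions \<Omega>" "sets \<kappa> = sets (restrict_space borel \<Omega>)" "integrable \<kappa> g"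
  shows "integrable \<kappa> (\<lambda>x. \<phi> x * g x)"
proof -
  obtain C where "\<And>x. \<bar>\<phi> x\<bar> \<le> C" using test_function_bounds[OF assms(1)] by blast
  then show ?thesis by (rule integrable_mult_bounded[OF assms(3) test_function_measurable[OF assms(1,2)]])
qed

text \<open>Positive homogeneity lets a nonnegative factor move between a density s and its
  reference measure, so the integral of f(s) depends only on the vector measure they
  represent.\<close>

definition pos_homogeneous :: "('c::real_normed_vector \<Rightarrow> real) \<Rightarrow> bool" where
  "pos_homogeneous f \<longleftrightarrow> f \<in> borel_measurable borel \<and> (\<forall>c\<ge>0. \<forall>g. f (c *\<^sub>R g) = c * f g)"

text \<open>Unlike in \<open>polar_pair\<close>, the density need not have unit norm, which leaves
  the reference measure free to be changed. The functional \<open>F\<close>, indexed by basis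
  directions, stands for a gradient or a Jacobian, so both are treated at once.\<close>

definition weak_density ::
  "(real^'d::finite) set \<Rightarrow> ('c \<Rightarrow> (real^'d \<Rightarrow> real) \<Rightarrow> real) \<Rightarrow> (real^'d) measure \<Rightarrow>
   (real^'d \<Rightarrow> 'c::euclidean_space) \<Rightarrow> bool" where
  "weak_density \<Omega> F \<mu> s \<longleftrightarrow> finite_measure \<mu> \<and> sets \<mu> = sets (restrict_space borel \<Omega>) \<and> integrable \<mu> s \<and>
     (\<forall>\<phi>\<in>test_functions \<Omega>. \<forall>b\<in>Basis. F b \<phi> = - (\<integral>x. \<phi> x * (s x \<bullet> b) \<partial>\<mu>))"

lemma weak_density_change:
  fixes s :: "real^'d::finite \<Rightarrow> 'c::euclidean_space"
  assumes \<mu>: "\<mu> = density \<kappa> (\<lambda>x. ennreal (h x))" and "finite_measure \<kappa>"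
    and h[measurable]: "h \<in> borel_measurable \<kappa>" and h0: "\<And>x. 0 \<le> h x"
    and w: "weak_density \<Omega> F \<mu> s"
  shows "weak_density \<Omega> F \<kappa> (\<lambda>x. h x *\<^sub>R s x)"
    and "pos_homogeneous f \<Longrightarrow> (\<integral>x. f (s x) \<partial>\<mu>) = (\<integral>x. f (h x *\<^sub>R s x) \<partial>\<kappa>)"
proof -
  have sk: "sets \<kappa> = sets \<mu>" by (simp add: \<mu>)
  have "integrable \<mu> s" using w by (simp add: weak_density_def)
  then have m: "s \<in> borel_measurable \<mu>" by simp
  then have [measurable]: "s \<in> borel_measurable \<kappa>" by (simp add: measurable_cong_sets[OF sk refl])
  have i: "integrable \<kappa> (\<lambda>x. h x *\<^sub>R s x)"
    using \<open>integrable \<mu> s\<close> unfolding \<mu> by (subst (asm) integrable_density) (auto simp: h0)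
  have "(\<integral>x. \<phi> x * (s x \<bullet> b) \<partial>\<mu>) = (\<integral>x. \<phi> x * (h x *\<^sub>R s x \<bullet> b) \<partial>\<kappa>)" if "\<phi> \<in> test_functions \<Omega>" for \<phi> b
  proof -
    have [measurable]: "\<phi> \<in> borel_measurable \<kappa>"
      using w sk by (intro test_function_measurable[OF that]) (auto simp: weak_density_def)
    show ?thesis unfolding \<mu> by (subst integral_density) (auto simp: h0 algebra_simps)
  qed
  with i w sk assms(2) show "weak_density \<Omega> F \<kappa> (\<lambda>x. h x *\<^sub>R s x)" by (simp add: weak_density_def)
  assume f: "pos_homogeneous f"
  then have [measurable]: "f \<in> borel_measurable borel" by (simp add: pos_homogeneous_def)
  have "(\<integral>x. f (s x) \<partial>\<mu>) = (\<integral>x. h x *\<^sub>R f (s x) \<partial>\<kappa>)"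
    unfolding \<mu> by (rule integral_density) (auto simp: h0)
  then show "(\<integral>x. f (s x) \<partial>\<mu>) = (\<integral>x. f (h x *\<^sub>R s x) \<partial>\<kappa>)"
    using f h0 by (simp add: pos_homogeneous_def)
qed

text \<open>Derivatives of two functions come with unrelated measures; they can be added or compared
  only after both are expressed by densities over one dominating measure.\<close>

lemma weak_density_common:
  assumes "weak_density \<Omega> F \<mu> s" "weak_density \<Omega> G \<nu> t"
  obtains \<kappa> s' t' where "weak_density \<Omega> F \<kappa> s'" "weak_density \<Omega> G \<kappa> t'"
    "\<And>f. pos_homogeneous f \<Longrightarrow> (\<integral>x. f (s x) \<partial>\<mu>) = (\<integral>x. f (s' x) \<partial>\<kappa>)"
    "\<And>f. pos_homogeneous f \<Longrightarrow> (\<integral>x. f (t x) \<partial>\<nu>) = (\<integral>x. f (t' x) \<partial>\<kappa>)"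
proof -
  have "finite_measure \<mu>" "finite_measure \<nu>" "sets \<nu> = sets \<mu>"
    using assms by (auto simp: weak_density_def)
  then obtain \<kappa> and h k :: "_ \<Rightarrow> real" where k: "finite_measure \<kappa>" "sets \<kappa> = sets \<mu>"
    "h \<in> borel_measurable \<kappa>" "\<And>x. 0 \<le> h x" "\<mu> = density \<kappa> (\<lambda>x. ennreal (h x))"
    "k \<in> borel_measurable \<kappa>" "\<And>x. 0 \<le> k x" "\<nu> = density \<kappa> (\<lambda>x. ennreal (k x))"
    using common_density by blast
  show ?thesis
    using that[OF weak_density_change(1)[OF k(5,1,3,4) assms(1)] weak_density_change(1)[OF k(8,1,6,7) assms(2)]
      weak_density_change(2)[OF k(5,1,3,4) assms(1)] weak_density_change(2)[OF k(8,1,6,7) assms(2)]] .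
qed

lemma weak_density_AE_unique:
  assumes "open \<Omega>" "weak_density \<Omega> F \<kappa> s" "weak_density \<Omega> F \<kappa> t"
  shows "AE x in \<kappa>. s x = t x"
proof -
  have "AE x in \<kappa>. (s x - t x) \<bullet> b = 0" if b: "b \<in> Basis" for b
  proof (rule fundamental_lemma[OF assms(1)])
    show "finite_measure \<kappa>" and s: "sets \<kappa> = sets (restrict_space borel \<Omega>)"
      using assms by (auto simp: weak_density_def)
    have i: "integrable \<kappa> s" "integrable \<kappa> t" using assms by (auto simp: weak_density_def)
    then show "integrable \<kappa> (\<lambda>x. (s x - t x) \<bullet> b)" by auto
    fix \<phi> assume \<phi>: "\<phi> \<in> test_functions \<Omega>"
    have 1: "integrable \<kappa> (\<lambda>x. \<phi> x * g x)" if "integrable \<kappa> g" for g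
      by (rule test_function_mult_integrable[OF \<phi> s that])
    have "(\<integral>x. \<phi> x * ((s x - t x) \<bullet> b) \<partial>\<kappa>) = (\<integral>x. \<phi> x * (s x \<bullet> b) - \<phi> x * (t x \<bullet> b) \<partial>\<kappa>)"
      by (simp add: inner_diff_left algebra_simps)
    also have "\<dots> = (\<integral>x. \<phi> x * (s x \<bullet> b) \<partial>\<kappa>) - (\<integral>x. \<phi> x * (t x \<bullet> b) \<partial>\<kappa>)"
      using i by (intro Bochner_Integration.integral_diff 1) auto
    also have "\<dots> = 0"
      using assms(2,3) b \<phi> unfolding weak_density_def by force
    finally show "(\<integral>x. \<phi> x * ((s x - t x) \<bullet> b) \<partial>\<kappa>) = 0" .
  qed
  then have "AE x in \<kappa>. \<forall>b\<in>Basis. (s x - t x) \<bullet> b = 0"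
    by (subst AE_ball_countable) (auto intro: countable_finite)
  then show ?thesis
  proof eventually_elim
    case (elim x)
    then have "s x - t x = 0" using euclidean_all_zero_iff by blast
    then show ?case by simp
  qed
qed

lemma weak_density_integral_unique:
  assumes "open \<Omega>" "weak_density \<Omega> F \<mu> s" "weak_density \<Omega> F \<nu> t" "pos_homogeneous f"
  shows "(\<integral>x. f (s x) \<partial>\<mu>) = (\<integral>x. f (t x) \<partial>\<nu>)"
proof -
  obtain \<kappa> s' t' where *: "weak_density \<Omega> F \<kappa> s'" "weak_density \<Omega> F \<kappa> t'"
    "(\<integral>x. f (s x) \<partial>\<mu>) = (\<integral>x. f (s' x) \<partial>\<kappa>)" "(\<integral>x. f (t x) \<partial>\<nu>) = (\<integral>x. f (t' x) \<partial>\<kappa>)"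
    by (rule weak_density_common[OF assms(2,3)]) (use assms(4) in blast)
  have [measurable]: "f \<in> borel_measurable borel" "s' \<in> borel_measurable \<kappa>" "t' \<in> borel_measurable \<kappa>"
    using assms * by (auto simp: weak_density_def pos_homogeneous_def)
  have "(\<integral>x. f (s' x) \<partial>\<kappa>) = (\<integral>x. f (t' x) \<partial>\<kappa>)"
    using weak_density_AE_unique[OF assms(1) *(1,2)] by (intro integral_cong_AE) auto
  then show ?thesis by (simp only: *(3,4))
qed

text \<open>Take the measure with density |s| and the direction \<open>sgn s\<close>. Where s = 0
  the direction is 0 instead of a unit vector, but that set is null for the new measure.\<close>

lemma weak_density_polar:
  assumes "weak_density \<Omega> F \<mu> s"
  shows "\<exists>\<mu>' \<sigma>. polar_pair \<Omega> \<mu>' \<sigma> \<and> weak_density \<Omega> F \<mu>' \<sigma>"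
proof -
  let ?\<mu>' = "density \<mu> (\<lambda>x. ennreal (norm (s x)))"
  let ?\<sigma> = "\<lambda>x. sgn (s x)"
  have f: "finite_measure \<mu>" and st: "sets \<mu> = sets (restrict_space borel \<Omega>)" and i: "integrable \<mu> s"
    using assms by (auto simp: weak_density_def)
  have [measurable]: "s \<in> borel_measurable \<mu>" using i by simp
  have "(\<integral>\<^sup>+x. ennreal (norm (s x)) \<partial>\<mu>) < \<infinity>" using i by (simp add: integrable_iff_bounded)
  then have "finite_measure ?\<mu>'"
    by (intro finite_measureI) (simp add: emeasure_density cong: nn_integral_cong)
  then interpret M: finite_measure ?\<mu>' .
  have m[measurable]: "?\<sigma> \<in> borel_measurable \<mu>" by simp
  have 1: "AE x in ?\<mu>'. norm (?\<sigma> x) = 1"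
    by (subst AE_density) (auto simp: norm_sgn)
  have p: "polar_pair \<Omega> ?\<mu>' ?\<sigma>"
    using 1 st M.finite_measure_axioms by (simp add: polar_pair_def)
  have n: "norm v *\<^sub>R sgn v = v" for v :: 'b by (cases "v = 0") (auto simp: sgn_div_norm)
  have i': "integrable ?\<mu>' ?\<sigma>" by (subst integrable_density) (use i in \<open>auto simp: n\<close>)
  have "(\<integral>x. \<phi> x * (?\<sigma> x \<bullet> b) \<partial>?\<mu>') = (\<integral>x. \<phi> x * (s x \<bullet> b) \<partial>\<mu>)" if "\<phi> \<in> test_functions \<Omega>" for \<phi> b
  proof -
    have [measurable]: "\<phi> \<in> borel_measurable \<mu>" by (rule test_function_measurable[OF that st])
    have *: "norm (s x) * (sgn (s x) \<bullet> b) = s x \<bullet> b" for x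
      by (cases "s x = 0") (auto simp: sgn_div_norm)
    show ?thesis by (subst integral_density) (auto simp: mult.left_commute[of "norm _"] *)
  qed
  with i' p M.finite_measure_axioms assms st have "weak_density \<Omega> F ?\<mu>' ?\<sigma>" by (simp add: weak_density_def)
  with p show ?thesis by blast
qed

lemma polar_pair_weak_density:
  assumes "polar_pair \<Omega> \<mu> \<sigma>"
    and "\<And>\<phi> b. \<phi> \<in> test_functions \<Omega> \<Longrightarrow> b \<in> Basis \<Longrightarrow> F b \<phi> = - (\<integral>x. \<phi> x * (\<sigma> x \<bullet> b) \<partial>\<mu>)"
  shows "weak_density \<Omega> F \<mu> \<sigma>"
proof -
  interpret finite_measure \<mu> using assms by (simp add: polar_pair_def)
  have "integrable \<mu> \<sigma>" using assms(1) by (intro integrable_const_bound[of _ 1]) (auto simp: polar_pair_def)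
  with assms finite_measure_axioms show ?thesis by (simp add: weak_density_def polar_pair_def)
qed

text \<open>The polar decomposition of the given density provides existence for the description, and
  independence of the representation provides uniqueness. Hence any integrable density computes the
  integral.\<close>

lemma measure_integral_eq:
  assumes "open \<Omega>" "pos_homogeneous f" "weak_density \<Omega> F \<mu> s"
    and D: "\<And>\<mu> s. D \<mu> s \<longleftrightarrow> (\<forall>\<phi>\<in>test_functions \<Omega>. \<forall>b\<in>Basis. F b \<phi> = - (\<integral>x. \<phi> x * (s x \<bullet> b) \<partial>\<mu>))"
  shows "measure_integral \<Omega> f D = (\<integral>x. f (s x) \<partial>\<mu>)"
  unfolding measure_integral_def
proof (rule the_equality)
  obtain \<mu>' \<sigma> where *: "polar_pair \<Omega> \<mu>' \<sigma>" "weak_density \<Omega> F \<mu>' \<sigma>"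
    using weak_density_polar[OF assms(3)] by blast
  then have "D \<mu>' \<sigma>" by (simp add: D weak_density_def)
  with * show "\<exists>\<mu>' \<sigma>. polar_pair \<Omega> \<mu>' \<sigma> \<and> D \<mu>' \<sigma> \<and> (\<integral>x. f (s x) \<partial>\<mu>) = (\<integral>x. f (\<sigma> x) \<partial>\<mu>')"
    using weak_density_integral_unique[OF assms(1,3) *(2) assms(2)] by blast
next
  fix c assume "\<exists>\<mu> \<sigma>. polar_pair \<Omega> \<mu> \<sigma> \<and> D \<mu> \<sigma> \<and> c = (\<integral>x. f (\<sigma> x) \<partial>\<mu>)"
  then obtain \<nu> \<sigma> where *: "polar_pair \<Omega> \<nu> \<sigma>" "D \<nu> \<sigma>" "c = (\<integral>x. f (\<sigma> x) \<partial>\<nu>)" by blast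
  then have "weak_density \<Omega> F \<nu> \<sigma>" by (intro polar_pair_weak_density) (auto simp: D)
  then show "c = (\<integral>x. f (s x) \<partial>\<mu>)"
    using weak_density_integral_unique[OF assms(1) _ assms(3,2)] *(3) by blast
qed

section \<open>Gradients and Jacobians as functionals on test functions\<close>

definition grad_functional :: "(real^'d::finite) set \<Rightarrow> (real^'d \<Rightarrow> real) \<Rightarrow> real^'d \<Rightarrow> (real^'d \<Rightarrow> real) \<Rightarrow> real" where
  "grad_functional \<Omega> u b \<phi> = (\<integral>x. u x * frechet_derivative \<phi> (at x) b \<partial>lebesgue_on \<Omega>)"

text \<open>A basis matrix has a single nonzero row, and the derivative of a test function maps 0 to
  0, so for basis elements the sum is one partial derivative tested against one component. The sum
  avoids decoding the indices of \<open>b\<close>.\<close>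

definition jac_functional :: "(real^'d::finite) set \<Rightarrow> (real^'d \<Rightarrow> real^'l::finite) \<Rightarrow> real^'d^'l \<Rightarrow> (real^'d \<Rightarrow> real) \<Rightarrow> real" where
  "jac_functional \<Omega> u b \<phi> = (\<integral>x. (\<Sum>i\<in>UNIV. u x $ i * frechet_derivative \<phi> (at x) (b $ i)) \<partial>lebesgue_on \<Omega>)"

lemma Basis_vec_real: "(Basis :: (real^'d::finite) set) = range (\<lambda>j. axis j 1)"
  by (auto simp: Basis_vec_def)

lemma Basis_vec_vec: "(Basis :: (real^'d::finite^'l::finite) set) = range (\<lambda>(i, j). axis i (axis j 1))"
  by (auto simp: Basis_vec_def image_iff)

lemma distr_gradient_iff:
  "distr_gradient \<Omega> u \<mu> s \<longleftrightarrow>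
    (\<forall>\<phi>\<in>test_functions \<Omega>. \<forall>b\<in>Basis. grad_functional \<Omega> u b \<phi> = - (\<integral>x. \<phi> x * (s x \<bullet> b) \<partial>\<mu>))"
  by (simp add: distr_gradient_def grad_functional_def Basis_vec_real inner_axis)

lemma test_function_differentiable:
  "\<phi> \<in> test_functions \<Omega> \<Longrightarrow> \<phi> differentiable (at x)"
  by (auto simp: test_functions_def dest: spec[of _ "[]"])

lemma jac_functional_axis:
  assumes "\<phi> \<in> test_functions \<Omega>"
  shows "jac_functional \<Omega> u (axis i (axis j 1)) \<phi> = grad_functional \<Omega> (\<lambda>x. u x $ i) (axis j 1) \<phi>"
proof -
  have "frechet_derivative \<phi> (at x) 0 = 0" for x
    by (rule linear_0) (rule linear_frechet_derivative[OF test_function_differentiable[OF assms]])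
  then have "(\<Sum>k\<in>UNIV. u x $ k * frechet_derivative \<phi> (at x) (axis i (axis j 1) $ k)) =
     u x $ i * frechet_derivative \<phi> (at x) (axis j 1)" for x
    by (subst sum.remove[of _ i]) (auto simp: axis_def intro!: sum.neutral)
  then show ?thesis by (simp add: jac_functional_def grad_functional_def)
qed

lemma distr_jacobian_iff:
  "distr_jacobian \<Omega> u \<mu> s \<longleftrightarrow>
    (\<forall>\<phi>\<in>test_functions \<Omega>. \<forall>b\<in>Basis. jac_functional \<Omega> u b \<phi> = - (\<integral>x. \<phi> x * (s x \<bullet> b) \<partial>\<mu>))"
  by (auto simp: distr_jacobian_def distr_gradient_iff Basis_vec_vec Basis_vec_real jac_functional_axis inner_axis)

lemma BV_weak_density:
  assumes "u \<in> BV \<Omega> S"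
  obtains \<mu> s where "weak_density \<Omega> (grad_functional \<Omega> u) \<mu> s"
  using assms polar_pair_weak_density unfolding BV_def distr_gradient_iff by blast

lemma BV_vec_weak_density:
  assumes "u \<in> BV_vec \<Omega> S"
  obtains \<mu> s where "weak_density \<Omega> (jac_functional \<Omega> u) \<mu> s"
  using assms polar_pair_weak_density unfolding BV_vec_def distr_jacobian_iff by blast

lemma BV_I:
  assumes "integrable (lebesgue_on \<Omega>) u" "AE x in lebesgue_on \<Omega>. u x \<in> S"
    "weak_density \<Omega> (grad_functional \<Omega> u) \<mu> s"
  shows "u \<in> BV \<Omega> S"
  using assms(1,2) weak_density_polar[OF assms(3)]
  unfolding BV_def distr_gradient_iff weak_density_def by simp blast

lemma BV_vec_I:
  assumes "integrable (lebesgue_on \<Omega>) u" "AE x in lebesgue_on \<Omega>. u x \<in> S"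
    "weak_density \<Omega> (jac_functional \<Omega> u) \<mu> s"
  shows "u \<in> BV_vec \<Omega> S"
  using assms(1,2) weak_density_polar[OF assms(3)]
  unfolding BV_vec_def distr_jacobian_iff weak_density_def by simp blast

section \<open>Weak limits of bounded sequences\<close>

text \<open>Forming midpoints is all that the parallelogram law requires. Every member is a finite
  convex combination of later terms of the sequence, so it inherits convex constraints and limits of
  linear functionals.\<close>

inductive_set tail_averages :: "(nat \<Rightarrow> 'a \<Rightarrow> 'b::real_vector) \<Rightarrow> nat \<Rightarrow> ('a \<Rightarrow> 'b) set" for \<theta> n where
  base: "m \<ge> n \<Longrightarrow> \<theta> m \<in> tail_averages \<theta> n"
| average: "f \<in> tail_averages \<theta> n \<Longrightarrow> g \<in> tail_averages \<theta> n \<Longrightarrow>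
    (\<lambda>x. (1 / 2) *\<^sub>R (f x + g x)) \<in> tail_averages \<theta> n"

lemma tail_averages_mono: "n \<le> m \<Longrightarrow> tail_averages \<theta> m \<subseteq> tail_averages \<theta> n"
proof
  fix f assume "n \<le> m" "f \<in> tail_averages \<theta> m"
  from this(2,1) show "f \<in> tail_averages \<theta> n"
    by induction (auto intro: tail_averages.intros)
qed

lemma tail_averages_range:
  assumes "f \<in> tail_averages \<theta> n" "convex S" "\<And>m. \<theta> m x \<in> S"
  shows "f x \<in> S"
  using assms(1)
proof induction
  case (average f g)
  then show ?case using convexD[OF assms(2), of "f x" "g x" "1/2" "1/2"] by (simp add: scaleR_add_right)
qed (use assms in auto)

lemma tail_averages_measurable:
  fixes \<theta> :: "nat \<Rightarrow> 'a \<Rightarrow> 'b::euclidean_space"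
  assumes "f \<in> tail_averages \<theta> n" "\<And>m. \<theta> m \<in> borel_measurable M"
  shows "f \<in> borel_measurable M"
  using assms(1) by induction (use assms(2) in auto)

lemma parallelogram_average:
  fixes f g :: "'b::real_inner"
  shows "(norm (f - g))\<^sup>2 = 2 * (norm f)\<^sup>2 + 2 * (norm g)\<^sup>2 - 4 * (norm ((1 / 2) *\<^sub>R (f + g)))\<^sup>2"
  by (simp add: power2_norm_eq_inner inner_add_left inner_add_right inner_diff_left inner_diff_right
      inner_commute algebra_simps)

text \<open>Averages over tails that almost minimise the \<open>L\<^sup>2\<close> norm form a Cauchy sequence by the
  parallelogram law; this replaces weak compactness.\<close>

lemma L2_near_minimal_averages:
  fixes \<theta> :: "nat \<Rightarrow> 'a \<Rightarrow> 'b::euclidean_space"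
  assumes "finite_measure M" and m: "\<And>n. \<theta> n \<in> borel_measurable M"
    and b: "\<And>n x. norm (\<theta> n x) \<le> C"
  obtains f where "\<And>n. f n \<in> tail_averages \<theta> n"
    "\<And>n. (\<integral>x. (norm (f (Suc n) x - f n x))\<^sup>2 \<partial>M) \<le> (1/4) ^ n"
proof -
  interpret finite_measure M by fact
  define N where "N f = (\<integral>x. (norm (f x))\<^sup>2 \<partial>M)" for f :: "'a \<Rightarrow> 'b"
  have bnd: "norm (f x) \<le> C" if "f \<in> tail_averages \<theta> n" for f n x
    using tail_averages_range[OF that convex_cball[of 0 C]] b by (simp add: dist_norm)
  have i: "integrable M (\<lambda>x. (norm (f x))\<^sup>2)" if "f \<in> tail_averages \<theta> n" for f n
    using that bnd[OF that] tail_averages_measurable[OF that m]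
    by (intro integrable_const_bound[of _ "C\<^sup>2"]) (auto intro!: power_mono AE_I2)
  \<comment> \<open>\<open>d n\<close> is the infimal energy over the n-th tail. It increases
    because the tails shrink, and the uniform bound on \<theta> keeps it bounded.\<close>
  define d where "d n = (INF f\<in>tail_averages \<theta> n. N f)" for n
  have N0: "N f \<ge> 0" for f by (auto simp: N_def)
  have bb: "bdd_below (N ` A)" for A by (rule bdd_belowI2[of _ 0]) (rule N0)
  have ne: "\<theta> n \<in> tail_averages \<theta> n" for n by (auto intro: tail_averages.base)
  have d_le: "d n \<le> N f" if "f \<in> tail_averages \<theta> n" for n f
    unfolding d_def by (rule cINF_lower[OF bb that])
  have "incseq d" unfolding d_def incseq_def
    by (intro allI impI cINF_superset_mono tail_averages_mono bb) (use ne in auto)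
  moreover have "d n \<le> C\<^sup>2 * measure M (space M)" for n
  proof -
    have "d n \<le> N (\<theta> n)" by (rule d_le[OF ne])
    also have "\<dots> \<le> (\<integral>x. C\<^sup>2 \<partial>M)" unfolding N_def
      by (intro integral_mono i[OF ne]) (auto intro!: power_mono b)
    finally show ?thesis by (simp add: mult.commute)
  qed
  ultimately obtain D where D: "d \<longlonglongrightarrow> D" "\<And>n. d n \<le> D"
    using incseq_convergent[of d] by blast
  have "\<exists>f. f \<in> tail_averages \<theta> m \<and> N f < D + e" if "e > 0" for e m
  proof -
    have "(INF f\<in>tail_averages \<theta> m. N f) < D + e" using D(2)[of m] that by (simp add: d_def)
    then show ?thesis using ne by (subst (asm) cINF_less_iff[OF _ bb]) auto
  qed
  \<comment> \<open>The tolerance (1/4)^n / 8 fits the weights 2, 2 and 4 of the parallelogram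
    identity: the errors add up to (1/16 + 1/4 + 1/2) (1/4)^n, which is below (1/4)^n.\<close>
  then have "\<exists>f. f \<in> tail_averages \<theta> m \<and> N f < D + (1/4) ^ n / 8" for m n by simp
  then obtain F where F: "\<And>m n. F m n \<in> tail_averages \<theta> m" "\<And>m n. N (F m n) < D + (1/4) ^ n / 8"
    by metis
  have "\<forall>n. \<exists>m. \<forall>k\<ge>m. d k > D - (1/4) ^ n / 8"
  proof
    fix n
    have "\<forall>\<^sub>F k in sequentially. d k > D - (1/4) ^ n / 8"
      by (rule order_tendstoD(1)[OF D(1)]) simp
    then show "\<exists>m. \<forall>k\<ge>m. d k > D - (1/4) ^ n / 8" by (simp add: eventually_sequentially)
  qed
  then obtain r where r: "\<And>n k. k \<ge> r n \<Longrightarrow> d k > D - (1/4) ^ n / 8" by metis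
  \<comment> \<open>Partial sums make \<open>q\<close> monotone and keep \<open>q n\<close> above
    both \<open>r n\<close> and \<open>n\<close>. By monotonicity consecutive picks lie in one tail
    set, so their midpoint competes in the same infimum.\<close>
  define q where "q n = (\<Sum>i\<le>n. r i) + n" for n
  have q: "q n \<ge> r n" "q n \<ge> n" "q n \<le> q (Suc n)" for n
    by (auto simp: q_def intro: order_trans[OF member_le_sum[of n "{..n}" r]])
  show ?thesis
  proof (rule that[of "\<lambda>n. F (q n) n"])
    show "F (q n) n \<in> tail_averages \<theta> n" for n using F(1) tail_averages_mono[OF q(2)] by blast
    fix n
    let ?f = "F (q (Suc n)) (Suc n)" and ?g = "F (q n) n"
    have f: "?f \<in> tail_averages \<theta> (q n)" "?g \<in> tail_averages \<theta> (q n)"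
      using F(1) tail_averages_mono[OF q(3)] by blast+
    define h where "h x = (1 / 2) *\<^sub>R (?f x + ?g x)" for x
    have h: "h \<in> tail_averages \<theta> (q n)" unfolding h_def[abs_def] by (rule tail_averages.average[OF f])
    have ar: "2 * a + 2 * b - 4 * c \<le> 2 * x + 2 * y - 4 * z" if "a < x" "b < y" "w \<le> c" "z < w"
      for a b c x y z w :: real using that by linarith
    have "(\<integral>x. (norm (?f x - ?g x))\<^sup>2 \<partial>M) = 2 * N ?f + 2 * N ?g - 4 * N h"
      unfolding parallelogram_average N_def using i[OF f(1)] i[OF f(2)] i[OF h]
      by (simp flip: h_def)
    also have "\<dots> \<le> 2 * (D + (1/4) ^ Suc n / 8) + 2 * (D + (1/4) ^ n / 8) - 4 * (D - (1/4) ^ n / 8)"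
      by (rule ar[OF F(2) F(2) d_le[OF h] r[OF q(1)]])
    also have "\<dots> \<le> (1/4) ^ n" by simp
    finally show "(\<integral>x. (norm (?f x - ?g x))\<^sup>2 \<partial>M) \<le> (1/4) ^ n" .
  qed
qed

text \<open>Squared L2 distances of order 4^(-n) make the L1 distances of consecutive terms
  summable, so the telescoping series converges absolutely at almost every point.\<close>

lemma tail_averages_AE_convergent:
  fixes \<theta> :: "nat \<Rightarrow> 'a \<Rightarrow> 'b::euclidean_space"
  assumes "finite_measure M" and m: "\<And>n. \<theta> n \<in> borel_measurable M"
    and b: "\<And>n x. norm (\<theta> n x) \<le> C"
  obtains f g where "\<And>n. f n \<in> tail_averages \<theta> n" "g \<in> borel_measurable M"
    "AE x in M. (\<lambda>n. f n x) \<longlonglongrightarrow> g x"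
proof -
  interpret finite_measure M by fact
  obtain f where f: "\<And>n. f n \<in> tail_averages \<theta> n"
    "\<And>n. (\<integral>x. (norm (f (Suc n) x - f n x))\<^sup>2 \<partial>M) \<le> (1/4) ^ n"
    using L2_near_minimal_averages[where \<theta> = \<theta>, OF assms] by metis
  have [measurable]: "f n \<in> borel_measurable M" for n by (rule tail_averages_measurable[OF f(1) m])
  have bnd: "norm (f n x) \<le> C" for n x
    using tail_averages_range[OF f(1) convex_cball[of 0 C]] b by (simp add: dist_norm)
  let ?d = "\<lambda>n x. norm (f (Suc n) x - f n x)"
  have d: "?d n x \<le> 2 * C" for n x
    by (rule order_trans[OF norm_triangle_ineq4]) (use bnd[of "Suc n" x] bnd[of n x] in linarith)
  have i: "integrable M (?d n)" "integrable M (\<lambda>x. (?d n x)\<^sup>2)" for n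
  proof -
    show "integrable M (?d n)"
      by (rule integrable_const_bound[of _ "2 * C"]) (use d in simp_all)
    have "(?d n x)\<^sup>2 \<le> (2 * C)\<^sup>2" for x by (rule power_mono[OF d]) simp
    then show "integrable M (\<lambda>x. (?d n x)\<^sup>2)"
      by (intro integrable_const_bound[of _ "(2 * C)\<^sup>2"]) simp_all
  qed
  have L1: "(\<integral>x. ?d n x \<partial>M) \<le> (1/2) ^ n * (1 + measure M (space M))" for n
  proof -
    \<comment> \<open>In place of Cauchy-Schwarz: a \<le> 2^n a^2 + 2^(-n) trades the bound 4^(-n)
      on squares for a bound of order 2^(-n) on norms.\<close>
    have "?d n x \<le> 2 ^ n * (?d n x)\<^sup>2 + (1/2) ^ n" for x
    proof -
      have "0 \<le> (2 ^ n * ?d n x - 1)\<^sup>2 + 2 ^ n * ?d n x" by simp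
      then have "2 ^ n * ?d n x \<le> (2 ^ n * ?d n x)\<^sup>2 + 1" by (simp add: power2_eq_square algebra_simps)
      then have "(1/2) ^ n * (2 ^ n * ?d n x) \<le> (1/2) ^ n * ((2 ^ n * ?d n x)\<^sup>2 + 1)"
        by (intro mult_left_mono) auto
      then show ?thesis by (simp add: field_simps power2_eq_square)
    qed
    then have "(\<integral>x. ?d n x \<partial>M) \<le> (\<integral>x. 2 ^ n * (?d n x)\<^sup>2 + (1/2) ^ n \<partial>M)"
      using i by (intro integral_mono) auto
    also have "\<dots> = 2 ^ n * (\<integral>x. (?d n x)\<^sup>2 \<partial>M) + (1/2) ^ n * measure M (space M)"
      using i by simp
    also have "\<dots> \<le> 2 ^ n * (1/4) ^ n + (1/2) ^ n * measure M (space M)"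
      using f(2)[of n] by simp
    also have "(2::real) ^ n * (1/4) ^ n = (1/2) ^ n" by (simp flip: power_mult_distrib)
    finally show ?thesis by (simp add: algebra_simps)
  qed
  have "(\<integral>\<^sup>+x. (\<Sum>n. ennreal (?d n x)) \<partial>M) = (\<Sum>n. \<integral>\<^sup>+x. ennreal (?d n x) \<partial>M)"
    by (rule nn_integral_suminf) auto
  also have "\<dots> = (\<Sum>n. ennreal (\<integral>x. ?d n x \<partial>M))"
    using i by (subst nn_integral_eq_integral) auto
  also have "\<dots> \<le> (\<Sum>n. ennreal ((1/2) ^ n * (1 + measure M (space M))))"
    by (intro suminf_le ennreal_leI L1) auto
  also have "\<dots> < \<infinity>"
    by (subst suminf_ennreal2) (auto intro!: summable_mult2 summable_geometric)
  finally have fin: "(\<integral>\<^sup>+x. (\<Sum>n. ennreal (?d n x)) \<partial>M) \<noteq> \<infinity>" by simp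
  have "AE x in M. (\<Sum>n. ennreal (?d n x)) \<noteq> \<infinity>"
    by (rule nn_integral_PInf_AE[OF _ fin]) auto
  then have conv: "AE x in M. convergent (\<lambda>n. f n x)"
  proof eventually_elim
    case (elim x)
    have "summable (\<lambda>n. ?d n x)" by (rule summable_suminf_not_top) (use elim in auto)
    then have "summable (\<lambda>n. f (Suc n) x - f n x)" by (rule summable_norm_cancel)
    then have "convergent (\<lambda>n. \<Sum>k<n. f (Suc k) x - f k x)" by (simp add: summable_iff_convergent)
    then have "convergent (\<lambda>n. f n x - f 0 x)" by (simp add: sum_lessThan_telescope[of "\<lambda>k. f k x"])
    then show ?case by (simp add: convergent_diff_const_right_iff)
  qed
  show ?thesis
  proof (rule that[OF f(1)])
    show "(\<lambda>x. lim (\<lambda>n. f n x)) \<in> borel_measurable M" by measurable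
    show "AE x in M. (\<lambda>n. f n x) \<longlonglongrightarrow> lim (\<lambda>n. f n x)"
      using conv by eventually_elim (simp add: convergent_LIMSEQ_iff)
  qed
qed

text \<open>If the integrals against h converge along the sequence, they have the same limit along
  averages of its tails, and dominated convergence identifies that limit with the integral against
  the pointwise limit of the averages. No subsequence is extracted.\<close>

lemma weak_limit_bounded_sequence:
  fixes \<theta> :: "nat \<Rightarrow> 'a \<Rightarrow> 'b::euclidean_space"
  assumes "finite_measure M" and m: "\<And>n. \<theta> n \<in> borel_measurable M"
    and S: "\<And>n x. \<theta> n x \<in> S" "convex S" "compact S"
  obtains g where "g \<in> borel_measurable M" "\<And>x. g x \<in> S"
    "\<And>h b L. integrable M h \<Longrightarrow> (\<lambda>n. \<integral>x. h x * (\<theta> n x \<bullet> b) \<partial>M) \<longlonglongrightarrow> L \<Longrightarrow> (\<integral>x. h x * (g x \<bullet> b) \<partial>M) = L"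
proof -
  interpret finite_measure M by fact
  obtain C where C: "\<And>s. s \<in> S \<Longrightarrow> norm s \<le> C"
    using compact_imp_bounded[OF S(3)] by (auto simp: bounded_iff)
  obtain f g where f: "\<And>n. f n \<in> tail_averages \<theta> n" and g[measurable]: "g \<in> borel_measurable M"
    and lim: "AE x in M. (\<lambda>n. f n x) \<longlonglongrightarrow> g x"
    by (rule tail_averages_AE_convergent[where \<theta> = \<theta>, OF assms(1) m, where C = C]) (use C S(1) in auto)
  have [measurable]: "f n \<in> borel_measurable M" for n by (rule tail_averages_measurable[OF f m])
  have fS: "f n x \<in> S" for n x by (rule tail_averages_range[OF f S(2,1)])
  \<comment> \<open>The pointwise limit lies in the closed set S off a null set; substituting
    \<theta> 0 elsewhere keeps the values in S at every point.\<close>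
  define g' where "g' x = (if g x \<in> S then g x else \<theta> 0 x)" for x
  have [measurable]: "S \<in> sets borel" using compact_imp_closed[OF S(3)] by simp
  have [measurable]: "\<theta> n \<in> borel_measurable M" for n by (rule m)
  have g'[measurable]: "g' \<in> borel_measurable M" unfolding g'_def[abs_def] by measurable
  have lim': "AE x in M. (\<lambda>n. f n x) \<longlonglongrightarrow> g' x"
    using lim
  proof eventually_elim
    case (elim x)
    then have "g x \<in> S" using closed_sequentially[OF compact_imp_closed[OF S(3)], of "\<lambda>n. f n x"] fS by blast
    with elim show ?case by (simp add: g'_def)
  qed
  show ?thesis
  proof (rule that[OF g'])
    show "g' x \<in> S" for x using S(1) by (simp add: g'_def)
    fix h b L assume h: "integrable M h" and L: "(\<lambda>n. \<integral>x. h x * (\<theta> n x \<bullet> b) \<partial>M) \<longlonglongrightarrow> L"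
    have [measurable]: "h \<in> borel_measurable M" using h by simp
    have i: "integrable M (\<lambda>x. h x * (k x \<bullet> b))" if "k \<in> borel_measurable M" "\<And>x. k x \<in> S" for k
    proof (rule Bochner_Integration.integrable_bound)
      show "integrable M (\<lambda>x. (C * norm b) * h x)" using h by simp
      show "(\<lambda>x. h x * (k x \<bullet> b)) \<in> borel_measurable M" using that by measurable
      have "\<bar>k x \<bullet> b\<bar> \<le> C * norm b" for x
        using Cauchy_Schwarz_ineq2[of "k x" b] mult_right_mono[OF C[OF that(2)[of x]] norm_ge_zero[of b]] by linarith
      from mult_right_mono[OF this abs_ge_zero]
      have "\<bar>k x \<bullet> b\<bar> * \<bar>h x\<bar> \<le> \<bar>C * norm b\<bar> * \<bar>h x\<bar>" for x
        by (smt (verit) abs_ge_self mult_right_mono abs_ge_zero)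
      then show "AE x in M. norm (h x * (k x \<bullet> b)) \<le> norm (C * norm b * h x)"
        by (simp add: abs_mult mult.commute)
    qed
    \<comment> \<open>The functions k with this error bound are closed under midpoints, so a bound
      valid for all later terms of the sequence passes to the whole tail set.\<close>
    have avg: "\<bar>(\<integral>x. h x * (k x \<bullet> b) \<partial>M) - L\<bar> \<le> e"
      if "k \<in> tail_averages \<theta> n" "\<And>m. m \<ge> n \<Longrightarrow> \<bar>(\<integral>x. h x * (\<theta> m x \<bullet> b) \<partial>M) - L\<bar> \<le> e" for k n e
      using that(1)
    proof induction
      case (average f g)
      have *: "integrable M (\<lambda>x. h x * (f x \<bullet> b))" "integrable M (\<lambda>x. h x * (g x \<bullet> b))"
        by (rule i[OF tail_averages_measurable[where \<theta> = \<theta>, OF average.hyps(1) m]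
                tail_averages_range[where \<theta> = \<theta>, OF average.hyps(1) S(2,1)]],
            rule i[OF tail_averages_measurable[where \<theta> = \<theta>, OF average.hyps(2) m]
                tail_averages_range[where \<theta> = \<theta>, OF average.hyps(2) S(2,1)]])
      have "(\<integral>x. h x * ((1 / 2) *\<^sub>R (f x + g x) \<bullet> b) \<partial>M)
          = (\<integral>x. (1/2) * (h x * (f x \<bullet> b)) + (1/2) * (h x * (g x \<bullet> b)) \<partial>M)"
        by (rule Bochner_Integration.integral_cong) (simp_all add: inner_add_left field_simps)
      also have "\<dots> = (1/2) * (\<integral>x. h x * (f x \<bullet> b) \<partial>M) + (1/2) * (\<integral>x. h x * (g x \<bullet> b) \<partial>M)"
        using * by (subst Bochner_Integration.integral_add) auto
      finally show ?case using average.IH by linarith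
    qed (use that(2) in auto)
    have "(\<lambda>n. \<integral>x. h x * (f n x \<bullet> b) \<partial>M) \<longlonglongrightarrow> L"
    proof (rule LIMSEQ_I)
      fix e :: real assume "e > 0"
      then obtain n0 where n0: "\<And>m. m \<ge> n0 \<Longrightarrow> \<bar>(\<integral>x. h x * (\<theta> m x \<bullet> b) \<partial>M) - L\<bar> < e / 2"
        using LIMSEQ_D[OF L, of "e / 2"] by auto
      have "norm ((\<integral>x. h x * (f n x \<bullet> b) \<partial>M) - L) < e" if "n \<ge> n0" for n
      proof -
        have "f n \<in> tail_averages \<theta> n0" using f tail_averages_mono[OF that] by blast
        from avg[OF this, of "e / 2"] n0 have "\<bar>(\<integral>x. h x * (f n x \<bullet> b) \<partial>M) - L\<bar> \<le> e / 2"
          by (meson less_imp_le)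
        then show ?thesis using \<open>e > 0\<close> by simp
      qed
      then show "\<exists>no. \<forall>n\<ge>no. norm ((\<integral>x. h x * (f n x \<bullet> b) \<partial>M) - L) < e" by blast
    qed
    moreover have "(\<lambda>n. \<integral>x. h x * (f n x \<bullet> b) \<partial>M) \<longlonglongrightarrow> (\<integral>x. h x * (g' x \<bullet> b) \<partial>M)"
    proof (rule integral_dominated_convergence[where w = "\<lambda>x. \<bar>h x\<bar> * (C * norm b)"])
      show "AE x in M. (\<lambda>n. h x * (f n x \<bullet> b)) \<longlonglongrightarrow> h x * (g' x \<bullet> b)"
        using lim' by eventually_elim (intro tendsto_intros)
      show "AE x in M. norm (h x * (f n x \<bullet> b)) \<le> \<bar>h x\<bar> * (C * norm b)" for n
      proof (rule AE_I2)
        fix x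
        have "\<bar>f n x \<bullet> b\<bar> \<le> C * norm b"
          using Cauchy_Schwarz_ineq2[of "f n x" b] mult_right_mono[OF C[OF fS[of n x]] norm_ge_zero[of b]] by linarith
        then show "norm (h x * (f n x \<bullet> b)) \<le> \<bar>h x\<bar> * (C * norm b)" by (simp add: abs_mult mult_left_mono)
      qed
    qed (use h in auto)
    ultimately show "(\<integral>x. h x * (g' x \<bullet> b) \<partial>M) = L" using LIMSEQ_unique by blast
  qed
qed

section \<open>Mollification\<close>

lemma distr_lborel_shift: "distr lborel borel (\<lambda>y. y - c :: 'a::euclidean_space) = lborel"
  using lborel_affine[of 1 "- c"] by (simp add: density_1)

lemma distr_lborel_reflect: "distr lborel borel (\<lambda>y. c - y :: 'a::euclidean_space) = lborel"
  using lborel_affine[of "-1" c] by (simp add: density_1)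

lemma lborel_integral_shift:
  fixes f :: "'a::euclidean_space \<Rightarrow> real"
  assumes [measurable]: "f \<in> borel_measurable borel"
  shows "(\<integral>y. f (y - c) \<partial>lborel) = (\<integral>y. f y \<partial>lborel)"
  by (subst (2) distr_lborel_shift[of c, symmetric]) (simp add: integral_distr)

lemma lborel_integral_reflect:
  fixes f :: "'a::euclidean_space \<Rightarrow> real"
  assumes [measurable]: "f \<in> borel_measurable borel"
  shows "(\<integral>y. f (c - y) \<partial>lborel) = (\<integral>y. f y \<partial>lborel)"
  by (subst (2) distr_lborel_reflect[of c, symmetric]) (simp add: integral_distr)

lemma lborel_integrable_reflect:
  fixes f :: "'a::euclidean_space \<Rightarrow> real"
  assumes "integrable lborel f"
  shows "integrable lborel (\<lambda>y. f (c - y))"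
proof -
  have "integrable (distr lborel borel (\<lambda>y. c - y)) f" using assms by (simp add: distr_lborel_reflect)
  then show ?thesis by (subst (asm) integrable_distr_eq) (use assms in auto)
qed

lemma lborel_integrable_shift:
  fixes f :: "'a::euclidean_space \<Rightarrow> real"
  assumes "integrable lborel f"
  shows "integrable lborel (\<lambda>y. f (y - c))"
proof -
  have "integrable (distr lborel borel (\<lambda>y. y - c)) f" using assms by (simp add: distr_lborel_shift)
  then show ?thesis by (subst (asm) integrable_distr_eq) (use assms in auto)
qed

lemma lborel_nn_integral_reflect:
  fixes f :: "'a::euclidean_space \<Rightarrow> ennreal"
  assumes [measurable]: "f \<in> borel_measurable borel"
  shows "(\<integral>\<^sup>+y. f (c - y) \<partial>lborel) = (\<integral>\<^sup>+y. f y \<partial>lborel)"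
  by (subst (2) distr_lborel_reflect[of c, symmetric]) (simp add: nn_integral_distr)

lemma lborel_nn_integral_shift:
  fixes f :: "'a::euclidean_space \<Rightarrow> ennreal"
  assumes [measurable]: "f \<in> borel_measurable borel"
  shows "(\<integral>\<^sup>+y. f (y - c) \<partial>lborel) = (\<integral>\<^sup>+y. f y \<partial>lborel)"
  by (subst (2) distr_lborel_shift[of c, symmetric]) (simp add: nn_integral_distr)

lemma integrable_bounded_support:
  fixes f :: "'a::euclidean_space \<Rightarrow> real"
  assumes [measurable]: "f \<in> borel_measurable borel" and "\<And>x. \<bar>f x\<bar> \<le> C" and "\<And>x. norm x > R \<Longrightarrow> f x = 0"
  shows "integrable lborel f"
proof (rule Bochner_Integration.integrable_bound)
  show "integrable lborel (\<lambda>x. C * indicator (cball 0 R) x :: real)"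
    by (intro integrable_mult_right integrable_real_indicator) (use emeasure_lborel_cball_finite in simp_all)
  have "\<bar>f x\<bar> \<le> \<bar>C * indicator (cball 0 R) x\<bar>" for x
    using assms(2)[of x] assms(3)[of x] by (cases "norm x > R") (auto simp: indicator_def)
  then show "AE x in lborel. norm (f x) \<le> norm (C * indicator (cball 0 R) x)" by simp
qed simp

section \<open>Partial derivatives of test functions\<close>

abbreviation pd :: "'d::finite \<Rightarrow> (real^'d \<Rightarrow> real) \<Rightarrow> real^'d \<Rightarrow> real" where
  "pd j \<phi> x \<equiv> frechet_derivative \<phi> (at x) (axis j 1)"

lemma iterated_partial_append:
  "iterated_partial js (iterated_partial [j] \<phi>) = iterated_partial (js @ [j]) \<phi>"
  by (induction js) auto

lemma pd_eq_0:
  assumes "x \<notin> closure {x. \<phi> x \<noteq> 0}"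
  shows "pd j \<phi> x = 0"
proof -
  have "(\<phi> has_derivative (\<lambda>_. 0)) (at x)"
  proof (rule has_derivative_transform_within_open)
    show "((\<lambda>_. 0) has_derivative (\<lambda>_. 0)) (at x)" by simp
    show "open (- closure {x. \<phi> x \<noteq> 0})" by auto
    show "0 = \<phi> y" if "y \<in> - closure {x. \<phi> x \<noteq> 0}" for y
      using that closure_subset[of "{x. \<phi> x \<noteq> 0}"] by auto
  qed (use assms in auto)
  from frechet_derivative_at[OF this] show ?thesis by (metis)
qed

lemma pd_test_function:
  assumes "\<phi> \<in> test_functions \<Omega>"
  shows "pd j \<phi> \<in> test_functions \<Omega>"
proof -
  have "iterated_partial js (pd j \<phi>) differentiable (at x)" for js x
    using iterated_partial_append[of js j \<phi>] assms by (simp add: test_functions_def)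
  moreover have "{x. pd j \<phi> x \<noteq> 0} \<subseteq> closure {x. \<phi> x \<noteq> 0}"
    using pd_eq_0[of _ \<phi> j] by blast
  then have "closure {x. pd j \<phi> x \<noteq> 0} \<subseteq> closure {x. \<phi> x \<noteq> 0}"
    by (rule closure_minimal) simp
  ultimately show ?thesis using assms unfolding test_functions_def
    by (auto simp: compact_eq_bounded_closed intro: bounded_subset)
qed

lemma test_function_borel: "\<phi> \<in> test_functions \<Omega> \<Longrightarrow> \<phi> \<in> borel_measurable borel"
  by (rule borel_measurable_continuous_onI[OF test_function_bounds(1)])

lemma test_function_line_derivative:
  assumes "\<And>x. \<phi> differentiable (at x)"
  shows "((\<lambda>t. \<phi> (x + t *\<^sub>R axis j 1)) has_real_derivative pd j \<phi> (x + t *\<^sub>R axis j 1)) (at t)"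
proof -
  let ?e = "axis j 1 :: real^_"
  have "(\<phi> has_derivative frechet_derivative \<phi> (at (x + t *\<^sub>R ?e))) (at (x + t *\<^sub>R ?e))"
    using assms frechet_derivative_works by blast
  moreover have "((\<lambda>t. x + t *\<^sub>R ?e) has_derivative (\<lambda>h. h *\<^sub>R ?e)) (at t)"
    by (auto intro!: derivative_eq_intros)
  ultimately have "((\<lambda>t. \<phi> (x + t *\<^sub>R ?e)) has_derivative
      (\<lambda>h. frechet_derivative \<phi> (at (x + t *\<^sub>R ?e)) (h *\<^sub>R ?e))) (at t)"
    by (rule has_derivative_compose[rotated])
  moreover have "frechet_derivative \<phi> (at y) (h *\<^sub>R ?e) = pd j \<phi> y * h" for y h
    using linear_cmul[OF linear_frechet_derivative[OF assms], of y h ?e] by simp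
  ultimately show ?thesis by (simp add: has_field_derivative_def mult_commute_abs)
qed

lemma test_function_support_bounded:
  assumes "\<phi> \<in> test_functions \<Omega>"
  obtains R where "\<And>x. norm x > R \<Longrightarrow> \<phi> x = 0"
proof -
  have "bounded (closure {x. \<phi> x \<noteq> 0})" using assms by (auto simp: test_functions_def compact_imp_bounded)
  then obtain R where "\<And>x. x \<in> closure {x. \<phi> x \<noteq> 0} \<Longrightarrow> norm x \<le> R" by (auto simp: bounded_iff)
  then show ?thesis using that[of R] closure_subset[of "{x. \<phi> x \<noteq> 0}"] by force
qed

lemma test_function_integrable:
  assumes "\<phi> \<in> test_functions \<Omega>"
  shows "integrable lborel \<phi>"
proof -
  obtain C where "\<And>x. \<bar>\<phi> x\<bar> \<le> C" using test_function_bounds[OF assms] by blast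
  moreover obtain R where "\<And>x. norm x > R \<Longrightarrow> \<phi> x = 0" using test_function_support_bounded[OF assms] by blast
  ultimately show ?thesis using test_function_borel[OF assms] by (intro integrable_bounded_support)
qed

text \<open>Difference quotients of F integrate to zero by translation invariance and converge,
  uniformly bounded on a fixed ball, to G. Differentiability along one axis is enough, so the lemma
  applies to mollified functions without computing their Frechet derivative.\<close>

lemma integral_line_derivative_eq_0:
  fixes F G :: "real^'d::finite \<Rightarrow> real"
  assumes F[measurable]: "F \<in> borel_measurable borel"
    and d: "\<And>x t. ((\<lambda>t. F (x + t *\<^sub>R axis j 1)) has_real_derivative G (x + t *\<^sub>R axis j 1)) (at t)"
    and C: "\<And>x. \<bar>G x\<bar> \<le> C" and 0: "\<And>x. norm x > R \<Longrightarrow> F x = 0"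
  shows "(\<integral>x. G x \<partial>lborel) = 0"
proof -
  let ?e = "axis j 1 :: real^'d"
  have lip: "\<bar>F (x + t *\<^sub>R ?e) - F x\<bar> \<le> C * \<bar>t\<bar>" for x t
  proof -
    have "\<bar>F (x + t *\<^sub>R ?e) - F (x + 0 *\<^sub>R ?e)\<bar> \<le> C * \<bar>t - 0\<bar>"
      using field_differentiable_bound[of UNIV "\<lambda>t. F (x + t *\<^sub>R ?e)" "\<lambda>t. G (x + t *\<^sub>R ?e)" C t 0]
        d C by auto
    then show ?thesis by simp
  qed
  define q where "q n x = real (Suc n) * (F (x + (1 / real (Suc n)) *\<^sub>R ?e) - F x)" for n x
  have [measurable]: "q n \<in> borel_measurable borel" for n unfolding q_def[abs_def] by measurable
  have lim: "(\<lambda>n. q n x) \<longlonglongrightarrow> G x" for x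
  proof -
    have "((\<lambda>h. (F (x + h *\<^sub>R ?e) - F x) / h) \<longlongrightarrow> G x) (at 0)"
      using d[of x 0] by (simp add: DERIV_def)
    moreover have "filterlim (\<lambda>n. 1 / real (Suc n)) (at 0) sequentially"
      using LIMSEQ_inverse_real_of_nat by (simp add: filterlim_at inverse_eq_divide)
    ultimately have "(\<lambda>n. (F (x + (1 / real (Suc n)) *\<^sub>R ?e) - F x) / (1 / real (Suc n))) \<longlonglongrightarrow> G x"
      by (rule filterlim_compose)
    then show ?thesis by (simp add: q_def divide_simps mult.commute)
  qed
  have "C \<ge> 0" using C[of 0] by linarith
  \<comment> \<open>From a point of the ball of radius R, a shift by 2 |R| + 1 along the axis ends
    outside the ball, where F vanishes. The Lipschitz bound along the line then bounds F.\<close>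
  have Fb: "\<bar>F x\<bar> \<le> C * (2 * \<bar>R\<bar> + 1)" for x
  proof (cases "norm x > R")
    case False
    then have "norm (x + (2 * \<bar>R\<bar> + 1) *\<^sub>R ?e) > R"
      using norm_triangle_ineq2[of "(2 * \<bar>R\<bar> + 1) *\<^sub>R ?e" "- x"] by (simp add: add.commute)
    then have "F (x + (2 * \<bar>R\<bar> + 1) *\<^sub>R ?e) = 0" by (rule 0)
    then show ?thesis using lip[of x "2 * \<bar>R\<bar> + 1"] by simp
  qed (use 0 \<open>C \<ge> 0\<close> in auto)
  have Fi: "integrable lborel F" using integrable_bounded_support[OF F Fb 0] .
  have q0: "(\<integral>x. q n x \<partial>lborel) = 0" for n
  proof -
    let ?c = "- ((1 / real (Suc n)) *\<^sub>R ?e)"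
    have "(\<integral>x. q n x \<partial>lborel) = real (Suc n) * ((\<integral>x. F (x - ?c) \<partial>lborel) - (\<integral>x. F x \<partial>lborel))"
      unfolding q_def using Fi lborel_integrable_shift[OF Fi, of ?c] by simp
    then show ?thesis by (subst (asm) lborel_integral_shift) auto
  qed
  \<comment> \<open>The radius is enlarged by 1 because the shifts 1 / (n + 1) never exceed
    1.\<close>
  have qb: "\<bar>q n x\<bar> \<le> C * indicator (cball 0 (\<bar>R\<bar> + 1)) x" for n x
  proof (cases "x \<in> cball 0 (\<bar>R\<bar> + 1)")
    case True
    have "\<bar>q n x\<bar> \<le> real (Suc n) * (C * \<bar>1 / real (Suc n)\<bar>)"
      unfolding q_def abs_mult using lip[of x "1 / real (Suc n)"] by (intro mult_mono) auto
    also have "\<dots> = C" by simp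
    finally show ?thesis using True by simp
  next
    case False
    define w where "w = (1 / real (Suc n)) *\<^sub>R ?e"
    have s: "norm w \<le> 1" by (simp add: w_def)
    have "norm (x + w) > R"
      using False s norm_triangle_ineq2[of x "- w"] by simp
    then show ?thesis using False 0[of x] 0[of "x + w"] by (simp add: q_def w_def)
  qed
  have "(\<lambda>n. \<integral>x. q n x \<partial>lborel) \<longlonglongrightarrow> (\<integral>x. G x \<partial>lborel)"
  proof (rule integral_dominated_convergence[where w = "\<lambda>x. C * indicator (cball 0 (\<bar>R\<bar> + 1)) x"])
    show "G \<in> borel_measurable lborel"
      using borel_measurable_LIMSEQ_real[of lborel q G] lim by simp
    show "integrable lborel (\<lambda>x. C * indicator (cball 0 (\<bar>R\<bar> + 1)) x :: real)"
      by (intro integrable_mult_right integrable_real_indicator) (use emeasure_lborel_cball_finite in simp_all)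
  qed (use lim qb in auto)
  then show ?thesis by (simp add: q0 LIMSEQ_const_iff)
qed

lemma flat_algebra_reflect:
  assumes "f \<in> flat_algebra" shows "(\<lambda>y. f (x - y)) \<in> flat_algebra"
  using assms
proof induction
  case (flat p c j a)
  have "(\<lambda>y. flat p ((- c) * y $ j + (c * x $ j + a))) \<in> flat_algebra" by (rule flat_algebra.flat)
  then show ?case by (simp add: algebra_simps)
qed (auto intro: flat_algebra.intros)

text \<open>A bump on a small cube around 0, divided by its integral. The kernel belongs to
  \<open>flat_algebra\<close>, so its reflections and translates are test functions as well.\<close>

lemma mollifier_exists:
  assumes "r > 0"
  obtains \<eta> :: "real^'d::finite \<Rightarrow> real" where "\<eta> \<in> flat_algebra" "\<And>x. 0 \<le> \<eta> x" "\<And>x. norm x > r \<Longrightarrow> \<eta> x = 0"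
    "(\<integral>x. \<eta> x \<partial>lborel) = 1"
proof -
  \<comment> \<open>The cube of half-width r / d lies in the ball of radius r, since the Euclidean
    norm is at most the sum of the absolute coordinates.\<close>
  define e where "e = r / real CARD('d)"
  have e: "e > 0" using assms by (simp add: e_def)
  let ?a = "(\<chi> j. - e) :: real^'d" and ?b = "(\<chi> j. e) :: real^'d"
  let ?B = "box_bump 1 0 ?a ?b"
  have B0: "?B x = 0" if "norm x > r" for x
  proof (rule box_bump_eq_0)
    show "x \<notin> {x. \<forall>j. ?a $ j + 0 / 1 \<le> x $ j \<and> x $ j \<le> ?b $ j - 0 / 1}"
    proof
      assume A: "x \<in> {x. \<forall>j. ?a $ j + 0 / 1 \<le> x $ j \<and> x $ j \<le> ?b $ j - 0 / 1}"
      have "\<bar>x $ j\<bar> \<le> e" for j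
      proof -
        have "- e \<le> x $ j \<and> x $ j \<le> e" using A by simp
        then show ?thesis by linarith
      qed
      then have "(\<Sum>j\<in>UNIV. \<bar>x $ j\<bar>) \<le> real CARD('d) * e" by (intro sum_bounded_above)
      then have "norm x \<le> r" using norm_le_l1_cart[of x] by (simp add: e_def)
      with that show False by simp
    qed
  qed simp
  have [measurable]: "?B \<in> borel_measurable borel"
    using flat_algebra_partial(1)[OF box_bump_flat_algebra]
    by (intro borel_measurable_continuous_onI continuous_at_imp_continuous_on ballI differentiable_imp_continuous_within)
  have i: "integrable lborel ?B"
    by (rule integrable_bounded_support[of _ 1 r]) (simp_all add: abs_of_nonneg[OF box_bump_nonneg] box_bump_le_1 B0)
  \<comment> \<open>Positivity on a nonempty open box excludes a zero integral, so the bump can be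
    normalised.\<close>
  have "(\<integral>x. ?B x \<partial>lborel) \<noteq> 0"
  proof
    assume "(\<integral>x. ?B x \<partial>lborel) = 0"
    then have A: "AE x in lborel. ?B x = 0"
      by (subst (asm) integral_nonneg_eq_0_iff_AE[OF i]) (simp_all add: box_bump_nonneg)
    have pos: "?B x > 0" if "x \<in> box ?a ?b" for x
    proof -
      have "- e < x $ j" "x $ j < e" for j using that by (auto simp: mem_box_cart)
      then have "0 < 1 * (x $ j - ?a $ j) - 0" "0 < 1 * (?b $ j - x $ j) - 0" for j
      proof -
        show "0 < 1 * (x $ j - ?a $ j) - 0" "0 < 1 * (?b $ j - x $ j) - 0" for j
          using \<open>\<And>j. - e < x $ j\<close>[of j] \<open>\<And>j. x $ j < e\<close>[of j] by simp_all
      qed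
      then show ?thesis unfolding box_bump_def by (intro prod_pos mult_pos_pos flat_1_pos ballI)
    qed
    have "AE x in lborel. x \<notin> box ?a ?b"
      using A by (rule eventually_mono) (use pos less_irrefl in metis)
    then have "emeasure lborel (box ?a ?b) = 0" by (subst (asm) AE_iff_measurable[of "box ?a ?b"]) simp_all
    moreover have "emeasure lborel (box ?a ?b) > 0"
    proof -
      have "0 \<in> box ?a ?b" using e by (simp add: mem_box_cart)
      then have "box ?a ?b \<noteq> {}" by blast
      then have "\<not> negligible (box ?a ?b)" by (simp add: open_not_negligible open_box)
      then show ?thesis
        by (auto simp: negligible_iff_null_sets null_sets_completion_iff null_sets_def zero_less_iff_neq_zero)
    qed
    ultimately show False by simp
  qed
  moreover have "(\<integral>x. ?B x \<partial>lborel) \<ge> 0" by (simp add: box_bump_nonneg)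
  ultimately have p: "(\<integral>x. ?B x \<partial>lborel) > 0" by simp
  show ?thesis
  proof (rule that[of "\<lambda>x. (1 / (\<integral>x. ?B x \<partial>lborel)) * ?B x"])
    show "(\<lambda>x. 1 / (\<integral>x. ?B x \<partial>lborel) * ?B x) \<in> flat_algebra"
      by (intro flat_algebra.intros box_bump_flat_algebra)
    show "0 \<le> 1 / (\<integral>x. ?B x \<partial>lborel) * ?B x" for x using p box_bump_nonneg by (intro mult_nonneg_nonneg) auto
  qed (use B0 p in auto)
qed

lemma abs_integral_mult_bounded:
  fixes f g :: "'a \<Rightarrow> real"
  assumes "integrable M g" "f \<in> borel_measurable M" "\<And>x. \<bar>f x\<bar> \<le> C"
  shows "\<bar>\<integral>x. f x * g x \<partial>M\<bar> \<le> C * (\<integral>x. \<bar>g x\<bar> \<partial>M)"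
proof -
  have "\<bar>\<integral>x. f x * g x \<partial>M\<bar> \<le> (\<integral>x. \<bar>f x * g x\<bar> \<partial>M)" by (rule integral_abs_bound)
  also have "\<dots> \<le> (\<integral>x. C * \<bar>g x\<bar> \<partial>M)"
  proof (rule integral_mono)
    show "integrable M (\<lambda>x. \<bar>f x * g x\<bar>)"
      using integrable_mult_bounded[OF assms] by (rule integrable_abs)
    show "\<bar>f x * g x\<bar> \<le> C * \<bar>g x\<bar>" for x
      unfolding abs_mult by (rule mult_right_mono[OF assms(3)]) simp
  qed (use assms(1) in simp)
  finally show ?thesis by simp
qed

text \<open>\<open>v\<close> lives on the whole space, not on \<Omega>, so that the convolution is
  defined everywhere; the restriction to points with a ball inside \<Omega> appears only when the
  weak derivative is tested.\<close>

locale mollification =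
  fixes \<eta> :: "real^'d::finite \<Rightarrow> real" and r :: real and v :: "real^'d \<Rightarrow> real"
  assumes eta_alg: "\<eta> \<in> flat_algebra" and eta_nonneg: "\<And>x. 0 \<le> \<eta> x"
    and eta_support: "\<And>x. norm x > r \<Longrightarrow> \<eta> x = 0" and eta_integral: "(\<integral>x. \<eta> x \<partial>lborel) = 1"
    and v_integrable: "integrable lborel v"
begin

lemma eta_test: "\<eta> \<in> test_functions UNIV"
  by (rule flat_algebra_test_function[OF eta_alg, of "cball 0 r"]) (use eta_support in auto)

lemma eta_reflect_test:
  assumes "cball x r \<subseteq> \<Omega>"
  shows "(\<lambda>y. \<eta> (x - y)) \<in> test_functions \<Omega>"
proof (rule flat_algebra_test_function[OF flat_algebra_reflect[OF eta_alg], of "cball x r"])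
  show "\<eta> (x - y) = 0" if "y \<notin> cball x r" for y
    using that by (intro eta_support) (simp add: dist_norm)
qed (use assms in auto)

lemma eta_borel[measurable]: "\<eta> \<in> borel_measurable borel"
  by (rule test_function_borel[OF eta_test])

lemma pd_eta_borel[measurable]: "pd j \<eta> \<in> borel_measurable borel"
  by (rule test_function_borel[OF pd_test_function[OF eta_test]])

lemma v_borel[measurable]: "v \<in> borel_measurable borel"
  using v_integrable by simp

lemma eta_integrable: "integrable lborel \<eta>"
  by (rule test_function_integrable[OF eta_test])

lemma eta_bound: obtains C where "\<And>x. \<bar>\<eta> x\<bar> \<le> C" "C \<ge> 0"
  using test_function_bounds(2)[OF eta_test] by blast

lemma pd_eta_bound: obtains C where "\<And>x. \<bar>pd j \<eta> x\<bar> \<le> C" "C \<ge> 0"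
  using test_function_bounds(2)[OF pd_test_function[OF eta_test]] by blast

definition mv :: "real^'d \<Rightarrow> real" where "mv x = (\<integral>y. \<eta> (x - y) * v y \<partial>lborel)"
definition dmv :: "'d \<Rightarrow> real^'d \<Rightarrow> real" where "dmv j x = (\<integral>y. pd j \<eta> (x - y) * v y \<partial>lborel)"

lemma mv_integrand_integrable: "integrable lborel (\<lambda>y. \<eta> (x - y) * v y)"
  by (rule eta_bound) (rule integrable_mult_bounded[OF v_integrable], auto)

lemma mv_borel[measurable]: "mv \<in> borel_measurable borel"
  unfolding mv_def[abs_def] by measurable

lemma dmv_borel[measurable]: "dmv j \<in> borel_measurable borel"
  unfolding dmv_def[abs_def] by measurable

lemma dmv_bound: obtains C where "\<And>x. \<bar>dmv j x\<bar> \<le> C"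
proof -
  obtain C where C: "\<And>x. \<bar>pd j \<eta> x\<bar> \<le> C" "C \<ge> 0" using pd_eta_bound[where j = j] by blast
  have "\<bar>dmv j x\<bar> \<le> C * (\<integral>y. \<bar>v y\<bar> \<partial>lborel)" for x
    unfolding dmv_def by (rule abs_integral_mult_bounded[OF v_integrable]) (use C in auto)
  then show ?thesis by (rule that)
qed

text \<open>Differentiation under the integral: difference quotients of the kernel are bounded by a
  Lipschitz constant C, so C |v| is a dominating function.\<close>

lemma mv_line_derivative:
  "((\<lambda>t. mv (x + t *\<^sub>R axis j 1)) has_real_derivative dmv j (x + t *\<^sub>R axis j 1)) (at t)"
proof -
  let ?e = "axis j 1 :: real^'d"
  obtain C where C: "\<And>x. \<bar>pd j \<eta> x\<bar> \<le> C" "C \<ge> 0" using pd_eta_bound[where j = j] by blast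
  have der: "((\<lambda>t. \<eta> (y + t *\<^sub>R ?e)) has_real_derivative pd j \<eta> (y + t *\<^sub>R ?e)) (at t)" for y t
    by (rule test_function_line_derivative[OF test_function_differentiable[OF eta_test]])
  have lip: "\<bar>\<eta> (y + h *\<^sub>R ?e) - \<eta> y\<bar> \<le> C * \<bar>h\<bar>" for y h
  proof -
    have "\<bar>\<eta> (y + h *\<^sub>R ?e) - \<eta> (y + 0 *\<^sub>R ?e)\<bar> \<le> C * \<bar>h - 0\<bar>"
      using field_differentiable_bound[of UNIV "\<lambda>t. \<eta> (y + t *\<^sub>R ?e)" "\<lambda>t. pd j \<eta> (y + t *\<^sub>R ?e)" C h 0]
        der C by auto
    then show ?thesis by simp
  qed
  define z where "z = x + t *\<^sub>R ?e"
  let ?q = "\<lambda>h y. (\<eta> (z - y + h *\<^sub>R ?e) - \<eta> (z - y)) / h * v y"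
  have "((\<lambda>h. (mv (z + h *\<^sub>R ?e) - mv z) / h) \<longlongrightarrow> dmv j z) (at 0)"
    unfolding tendsto_at_iff_sequentially comp_def
  proof (intro allI impI)
    fix X :: "nat \<Rightarrow> real" assume X: "\<forall>i. X i \<in> UNIV - {0}" "X \<longlonglongrightarrow> 0"
    have eq: "(mv (z + X n *\<^sub>R ?e) - mv z) / X n = (\<integral>y. ?q (X n) y \<partial>lborel)" for n
    proof -
      have "mv (z + X n *\<^sub>R ?e) - mv z = (\<integral>y. \<eta> (z + X n *\<^sub>R ?e - y) * v y - \<eta> (z - y) * v y \<partial>lborel)"
        unfolding mv_def by (rule Bochner_Integration.integral_diff[symmetric]) (rule mv_integrand_integrable)+
      then have "(mv (z + X n *\<^sub>R ?e) - mv z) / X n =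
          (\<integral>y. (\<eta> (z + X n *\<^sub>R ?e - y) * v y - \<eta> (z - y) * v y) / X n \<partial>lborel)" by simp
      also have "\<dots> = (\<integral>y. ?q (X n) y \<partial>lborel)"
        by (rule Bochner_Integration.integral_cong) (simp_all add: algebra_simps diff_divide_distrib)
      finally show ?thesis .
    qed
    have "(\<lambda>n. \<integral>y. ?q (X n) y \<partial>lborel) \<longlonglongrightarrow> (\<integral>y. pd j \<eta> (z - y) * v y \<partial>lborel)"
    proof (rule integral_dominated_convergence[where w = "\<lambda>y. C * \<bar>v y\<bar>"])
      show "AE y in lborel. (\<lambda>n. ?q (X n) y) \<longlonglongrightarrow> pd j \<eta> (z - y) * v y"
      proof (rule AE_I2)
        fix y
        have "((\<lambda>h. (\<eta> (z - y + h *\<^sub>R ?e) - \<eta> (z - y)) / h) \<longlongrightarrow> pd j \<eta> (z - y)) (at 0)"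
          using der[of "z - y" 0] by (simp add: DERIV_def)
        then have "(\<lambda>n. (\<eta> (z - y + X n *\<^sub>R ?e) - \<eta> (z - y)) / X n) \<longlonglongrightarrow> pd j \<eta> (z - y)"
          using X unfolding tendsto_at_iff_sequentially comp_def by blast
        then show "(\<lambda>n. ?q (X n) y) \<longlonglongrightarrow> pd j \<eta> (z - y) * v y" by (intro tendsto_intros)
      qed
      show "AE y in lborel. norm (?q (X n) y) \<le> C * \<bar>v y\<bar>" for n
      proof (rule AE_I2)
        fix y
        have "\<bar>(\<eta> (z - y + X n *\<^sub>R ?e) - \<eta> (z - y)) / X n\<bar> \<le> C"
          using lip[of "z - y" "X n"] X(1) by (simp add: abs_divide divide_le_eq)
        from mult_right_mono[OF this abs_ge_zero[of "v y"]]
        show "norm (?q (X n) y) \<le> C * \<bar>v y\<bar>" unfolding real_norm_def abs_mult .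
      qed
    qed (use v_integrable in auto)
    then show "(\<lambda>n. (mv (z + X n *\<^sub>R ?e) - mv z) / X n) \<longlonglongrightarrow> dmv j z" by (simp add: eq dmv_def)
  qed
  then have "((\<lambda>h. mv (z + h *\<^sub>R ?e)) has_real_derivative dmv j z) (at 0)"
    by (simp add: DERIV_def)
  then have "((\<lambda>h. mv (x + (h + t) *\<^sub>R ?e)) has_real_derivative dmv j z) (at 0)"
    by (simp add: z_def algebra_simps)
  then show ?thesis using DERIV_shift[of "\<lambda>h. mv (x + h *\<^sub>R ?e)" _ 0 t] by (simp add: z_def)
qed

lemma eta_reflect_integral: "(\<integral>y. \<eta> (x - y) \<partial>lborel) = 1"
  using lborel_integral_reflect[of \<eta> x] eta_integral by simp

lemma eta_shift_integral: "(\<integral>x. \<eta> (x - y) \<partial>lborel) = 1"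
  using lborel_integral_shift[of \<eta> y] eta_integral by simp

text \<open>The error at x is an average, with weight \<eta>, of the translation errors v (x - h) -
  v x over |h| \<le> r. Exchanging the integrals bounds its L1 norm by the worst translation
  error.\<close>

lemma mv_minus_v_le:
  assumes \<tau>: "\<And>h. norm h \<le> r \<Longrightarrow> (\<integral>\<^sup>+x. ennreal \<bar>v (x - h) - v x\<bar> \<partial>lborel) \<le> ennreal e"
  shows "(\<integral>\<^sup>+x. ennreal \<bar>mv x - v x\<bar> \<partial>lborel) \<le> ennreal e"
proof -
  have 1: "ennreal \<bar>mv x - v x\<bar> \<le> (\<integral>\<^sup>+h. ennreal (\<eta> h) * ennreal \<bar>v (x - h) - v x\<bar> \<partial>lborel)" for x
  proof -
    have i: "integrable lborel (\<lambda>y. \<eta> (x - y) * (v y - v x))"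
      using mv_integrand_integrable[of x] lborel_integrable_reflect[OF eta_integrable, of x]
      by (simp add: algebra_simps)
    have "mv x - v x = (\<integral>y. \<eta> (x - y) * v y \<partial>lborel) - (\<integral>y. \<eta> (x - y) * v x \<partial>lborel)"
      by (simp add: mv_def eta_reflect_integral)
    also have "\<dots> = (\<integral>y. \<eta> (x - y) * v y - \<eta> (x - y) * v x \<partial>lborel)"
      using mv_integrand_integrable[of x] lborel_integrable_reflect[OF eta_integrable, of x]
      by (intro Bochner_Integration.integral_diff[symmetric]) auto
    also have "\<dots> = (\<integral>y. \<eta> (x - y) * (v y - v x) \<partial>lborel)" by (simp add: right_diff_distrib)
    finally have "ennreal \<bar>mv x - v x\<bar> \<le> (\<integral>\<^sup>+y. ennreal \<bar>\<eta> (x - y) * (v y - v x)\<bar> \<partial>lborel)"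
      using integral_norm_bound_ennreal[OF i] by simp
    also have "\<dots> = (\<integral>\<^sup>+h. ennreal \<bar>\<eta> h * (v (x - h) - v x)\<bar> \<partial>lborel)"
      using lborel_nn_integral_reflect[of "\<lambda>h. ennreal \<bar>\<eta> h * (v (x - h) - v x)\<bar>" x] by simp
    also have "\<dots> = (\<integral>\<^sup>+h. ennreal (\<eta> h) * ennreal \<bar>v (x - h) - v x\<bar> \<partial>lborel)"
      by (simp add: abs_mult eta_nonneg ennreal_mult)
    finally show ?thesis .
  qed
  have "(\<integral>\<^sup>+x. ennreal \<bar>mv x - v x\<bar> \<partial>lborel)
      \<le> (\<integral>\<^sup>+x. (\<integral>\<^sup>+h. ennreal (\<eta> h) * ennreal \<bar>v (x - h) - v x\<bar> \<partial>lborel) \<partial>lborel)"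
    by (intro nn_integral_mono 1)
  also have "\<dots> = (\<integral>\<^sup>+h. (\<integral>\<^sup>+x. ennreal (\<eta> h) * ennreal \<bar>v (x - h) - v x\<bar> \<partial>lborel) \<partial>lborel)"
    by (rule lborel_pair.Fubini') measurable
  also have "\<dots> = (\<integral>\<^sup>+h. ennreal (\<eta> h) * (\<integral>\<^sup>+x. ennreal \<bar>v (x - h) - v x\<bar> \<partial>lborel) \<partial>lborel)"
    by (intro nn_integral_cong nn_integral_cmult) measurable
  also have "\<dots> \<le> (\<integral>\<^sup>+h. ennreal (\<eta> h) * ennreal e \<partial>lborel)"
  proof (intro nn_integral_mono)
    fix h
    show "ennreal (\<eta> h) * (\<integral>\<^sup>+x. ennreal \<bar>v (x - h) - v x\<bar> \<partial>lborel) \<le> ennreal (\<eta> h) * ennreal e"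
      using \<tau>[of h] eta_support[of h] by (cases "norm h \<le> r") (auto intro: mult_left_mono)
  qed
  also have "\<dots> = ennreal e"
    using eta_integrable by (simp add: nn_integral_multc nn_integral_eq_integral eta_nonneg eta_integral)
  finally show ?thesis .
qed

text \<open>The reflected kernel y -> \<eta> (x - y) is a test function on \<Omega> as soon as the
  ball about x fits inside. The sign from the reflection cancels the sign of the weak
  derivative.\<close>

lemma dmv_eq:
  assumes w: "\<And>\<phi> j. \<phi> \<in> test_functions \<Omega> \<Longrightarrow> (\<integral>x. v x * pd j \<phi> x \<partial>lborel) = - (\<integral>x. \<phi> x * (s x $ j) \<partial>\<mu>)"
    and x: "cball x r \<subseteq> \<Omega>"
  shows "dmv j x = (\<integral>y. \<eta> (x - y) * (s y $ j) \<partial>\<mu>)"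
proof -
  have pd: "pd j (\<lambda>y. \<eta> (x - y)) y = - pd j \<eta> (x - y)" for y
  proof -
    have "(\<eta> has_derivative frechet_derivative \<eta> (at (x - y))) (at (x - y))"
      using test_function_differentiable[OF eta_test] frechet_derivative_works by blast
    moreover have "((\<lambda>y. x - y) has_derivative (\<lambda>h. - h)) (at y)" by (auto intro!: derivative_eq_intros)
    ultimately have "((\<lambda>y. \<eta> (x - y)) has_derivative (\<lambda>h. frechet_derivative \<eta> (at (x - y)) (- h))) (at y)"
      by (rule has_derivative_compose[rotated])
    from frechet_derivative_at[OF this]
    have "pd j (\<lambda>y. \<eta> (x - y)) y = frechet_derivative \<eta> (at (x - y)) (- axis j 1)" by metis
    then show ?thesis
      using linear_neg[OF linear_frechet_derivative[OF test_function_differentiable[OF eta_test]]] by simp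
  qed
  have "(\<integral>y. v y * pd j (\<lambda>y. \<eta> (x - y)) y \<partial>lborel) = - (\<integral>y. \<eta> (x - y) * (s y $ j) \<partial>\<mu>)"
    by (rule w[OF eta_reflect_test[OF x]])
  then show ?thesis unfolding pd by (simp add: dmv_def mult.commute)
qed

text \<open>Integrate by parts with the differentiable function \<psi>(mv) and replace the
  derivative of mv by the mollified derivative measure. Fubini then moves the mollification onto the
  weight \<phi> \<psi>'(mv), which leaves an integral against the original measure.\<close>

lemma mollified_chain_rule:
  fixes s :: "real^'d \<Rightarrow> real^'d"
  assumes \<Omega>: "open \<Omega>" "finite_measure \<mu>" and sets: "sets \<mu> = sets (restrict_space borel \<Omega>)"
    and s: "integrable \<mu> s"
    and w: "\<And>\<phi> j. \<phi> \<in> test_functions \<Omega> \<Longrightarrow> (\<integral>x. v x * pd j \<phi> x \<partial>lborel) = - (\<integral>x. \<phi> x * (s x $ j) \<partial>\<mu>)"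
    and \<psi>: "\<And>t. (\<psi> has_real_derivative \<psi>' t) (at t)" "\<psi>' \<in> borel_measurable borel" "\<And>t. \<bar>\<psi>' t\<bar> \<le> 1"
    and \<phi>: "\<phi> \<in> test_functions \<Omega>" and supp: "\<And>x. \<phi> x \<noteq> 0 \<Longrightarrow> cball x r \<subseteq> \<Omega>"
  shows "(\<integral>x. \<psi> (mv x) * pd j \<phi> x \<partial>lborel)
    = - (\<integral>y. (\<integral>x. \<phi> x * \<psi>' (mv x) * \<eta> (x - y) \<partial>lborel) * (s y $ j) \<partial>\<mu>)"
proof -
  interpret M: finite_measure \<mu> by fact
  interpret P: pair_sigma_finite lborel \<mu> ..
  note [measurable] = \<psi>(2) test_function_borel[OF \<phi>] test_function_borel[OF pd_test_function[OF \<phi>]]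
  have "continuous_on UNIV \<psi>"
    using \<psi>(1) by (intro continuous_at_imp_continuous_on ballI DERIV_isCont) auto
  then have [measurable]: "\<psi> \<in> borel_measurable borel" by (rule borel_measurable_continuous_onI)
  obtain R where R: "\<And>x. norm x > R \<Longrightarrow> \<phi> x = 0" by (rule test_function_support_bounded[OF \<phi>]) blast
  obtain R' where R': "\<And>x. norm x > R' \<Longrightarrow> pd j \<phi> x = 0"
    by (rule test_function_support_bounded[OF pd_test_function[OF \<phi>]]) blast
  obtain A where A: "\<And>x. \<bar>\<phi> x\<bar> \<le> A" "A \<ge> 0" using test_function_bounds(2)[OF \<phi>] by blast
  obtain A' where A': "\<And>x. \<bar>pd j \<phi> x\<bar> \<le> A'" "A' \<ge> 0" using test_function_bounds(2)[OF pd_test_function[OF \<phi>]] by blast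
  obtain D where D: "\<And>x. \<bar>dmv j x\<bar> \<le> D" using dmv_bound[where j = j] by blast
  obtain K where K: "\<And>x. \<bar>\<eta> x\<bar> \<le> K" "K \<ge> 0" using eta_bound by blast
  have mvb: "\<bar>mv x\<bar> \<le> K * (\<integral>y. \<bar>v y\<bar> \<partial>lborel)" for x
    unfolding mv_def by (rule abs_integral_mult_bounded[OF v_integrable]) (use K in auto)
  have \<psi>lip: "\<bar>\<psi> t - \<psi> 0\<bar> \<le> \<bar>t\<bar>" for t
    using field_differentiable_bound[of UNIV \<psi> \<psi>' 1 t 0] \<psi> by auto
  define B where "B = \<bar>\<psi> 0\<bar> + K * (\<integral>y. \<bar>v y\<bar> \<partial>lborel)"
  have B: "\<bar>\<psi> (mv x)\<bar> \<le> B" for x using \<psi>lip[of "mv x"] mvb[of x] unfolding B_def by linarith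
  have B0: "B \<ge> 0" using B[of 0] by linarith
  let ?G = "\<lambda>x. \<psi> (mv x) * pd j \<phi> x + \<phi> x * \<psi>' (mv x) * dmv j x"
  \<comment> \<open>By the product rule \<open>?G\<close> is the derivative of \<psi>(mv) \<phi>
    along the axis, and \<phi> has bounded support.\<close>
  have "(\<integral>x. ?G x \<partial>lborel) = 0"
  proof (rule integral_line_derivative_eq_0[where F = "\<lambda>x. \<psi> (mv x) * \<phi> x" and j = j and R = R and C = "B * A' + A * 1 * D"])
    fix x t
    have "((\<lambda>t. \<psi> (mv (x + t *\<^sub>R axis j 1))) has_real_derivative
        \<psi>' (mv (x + t *\<^sub>R axis j 1)) * dmv j (x + t *\<^sub>R axis j 1)) (at t)"
      by (rule DERIV_chain2[OF \<psi>(1) mv_line_derivative])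
    from DERIV_mult[OF this test_function_line_derivative[OF test_function_differentiable[OF \<phi>]]]
    show "((\<lambda>t. \<psi> (mv (x + t *\<^sub>R axis j 1)) * \<phi> (x + t *\<^sub>R axis j 1)) has_real_derivative ?G (x + t *\<^sub>R axis j 1)) (at t)"
      by (rule DERIV_cong) (simp add: algebra_simps)
  next
    fix x
    have "\<bar>?G x\<bar> \<le> \<bar>\<psi> (mv x)\<bar> * \<bar>pd j \<phi> x\<bar> + \<bar>\<phi> x\<bar> * \<bar>\<psi>' (mv x)\<bar> * \<bar>dmv j x\<bar>"
      by (rule order_trans[OF abs_triangle_ineq]) (simp add: abs_mult)
    also have "\<dots> \<le> B * A' + A * 1 * D"
      by (intro add_mono mult_mono B A A' D \<psi> mult_nonneg_nonneg abs_ge_zero B0) auto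
    finally show "\<bar>?G x\<bar> \<le> B * A' + A * 1 * D" .
  qed (use R in auto)
  moreover have i1: "integrable lborel (\<lambda>x. \<psi> (mv x) * pd j \<phi> x)"
    by (rule integrable_mult_bounded[OF test_function_integrable[OF pd_test_function[OF \<phi>]] _ B]) simp
  moreover have i2: "integrable lborel (\<lambda>x. \<phi> x * \<psi>' (mv x) * dmv j x)"
  proof -
    have "integrable lborel (\<lambda>x. (\<psi>' (mv x) * dmv j x) * \<phi> x)"
    proof (rule integrable_mult_bounded[OF test_function_integrable[OF \<phi>]])
      show "\<bar>\<psi>' (mv x) * dmv j x\<bar> \<le> 1 * D" for x
        unfolding abs_mult by (intro mult_mono \<psi> D) auto
    qed simp
    then show ?thesis by (simp add: mult.commute mult.left_commute)
  qed
  ultimately have 1: "(\<integral>x. \<psi> (mv x) * pd j \<phi> x \<partial>lborel) = - (\<integral>x. \<phi> x * \<psi>' (mv x) * dmv j x \<partial>lborel)"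
    by simp
  have m: "s \<in> borel_measurable \<mu>" using s by simp
  then have [measurable]: "(\<lambda>y. s y $ j) \<in> borel_measurable \<mu>"
    by (intro measurable_compose[OF m]) auto
  have si: "integrable \<mu> (\<lambda>y. s y $ j)"
    using integrable_inner_left[of "axis j 1", OF s] by (simp add: inner_axis)
  have [measurable]: "(\<lambda>y. y) \<in> measurable \<mu> borel"
    using measurable_restrict_space1[of "\<lambda>y. y" borel borel \<Omega>] by (simp add: measurable_cong_sets[OF sets refl])
  have "(\<integral>x. \<phi> x * \<psi>' (mv x) * dmv j x \<partial>lborel)
      = (\<integral>x. (\<integral>y. \<phi> x * \<psi>' (mv x) * \<eta> (x - y) * (s y $ j) \<partial>\<mu>) \<partial>lborel)"
  proof (rule Bochner_Integration.integral_cong[OF refl])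
    fix x
    show "\<phi> x * \<psi>' (mv x) * dmv j x = (\<integral>y. \<phi> x * \<psi>' (mv x) * \<eta> (x - y) * (s y $ j) \<partial>\<mu>)"
    \<comment> \<open>The formula for \<open>dmv\<close> is available only where a ball of radius r
      fits into \<Omega>; at all other points \<phi> is 0 and both sides vanish.\<close>
    proof (cases "\<phi> x = 0")
      case False
      have "dmv j x = (\<integral>y. \<eta> (x - y) * (s y $ j) \<partial>\<mu>)" by (rule dmv_eq[OF w supp[OF False]])
      then show ?thesis by (simp add: mult.assoc)
    qed simp
  qed
  also have "\<dots> = (\<integral>y. (\<integral>x. \<phi> x * \<psi>' (mv x) * \<eta> (x - y) * (s y $ j) \<partial>lborel) \<partial>\<mu>)"
  proof (rule P.Fubini_integral[symmetric])
    have "integrable (lborel \<Otimes>\<^sub>M \<mu>) (\<lambda>(x, y). \<phi> x * (s y $ j))"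
    proof (rule P.Fubini_integrable)
      show "(\<lambda>(x, y). \<phi> x * (s y $ j)) \<in> borel_measurable (lborel \<Otimes>\<^sub>M \<mu>)" by measurable
      show "integrable lborel (\<lambda>x. \<integral>y. norm (case (x, y) of (x, y) \<Rightarrow> \<phi> x * (s y $ j)) \<partial>\<mu>)"
        using test_function_integrable[OF \<phi>] by (simp add: abs_mult)
      show "AE x in lborel. integrable \<mu> (\<lambda>y. case (x, y) of (x, y) \<Rightarrow> \<phi> x * (s y $ j))"
        using si by simp
    qed
    then have "integrable (lborel \<Otimes>\<^sub>M \<mu>) (\<lambda>p. (\<psi>' (mv (fst p)) * \<eta> (fst p - snd p)) * (case p of (x, y) \<Rightarrow> \<phi> x * (s y $ j)))"
    proof (rule integrable_mult_bounded)
      show "(\<lambda>p. \<psi>' (mv (fst p)) * \<eta> (fst p - snd p)) \<in> borel_measurable (lborel \<Otimes>\<^sub>M \<mu>)" by measurable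
      show "\<bar>\<psi>' (mv (fst p)) * \<eta> (fst p - snd p)\<bar> \<le> 1 * K" for p :: "(real^'d) \<times> (real^'d)"
        unfolding abs_mult by (intro mult_mono \<psi> K) auto
    qed
    then show "integrable (lborel \<Otimes>\<^sub>M \<mu>) (\<lambda>(x, y). \<phi> x * \<psi>' (mv x) * \<eta> (x - y) * (s y $ j))"
      by (simp add: case_prod_beta' mult.commute mult.left_commute)
  qed
  also have "\<dots> = (\<integral>y. (\<integral>x. \<phi> x * \<psi>' (mv x) * \<eta> (x - y) \<partial>lborel) * (s y $ j) \<partial>\<mu>)" by simp
  finally show ?thesis using 1 by simp
qed

end

section \<open>Chain rule for functions of bounded variation\<close>

text \<open>Measurability yields continuous functions converging almost everywhere. Truncating them
  at the bound M keeps them continuous and permits dominated convergence on the ball.\<close>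

lemma continuous_L1_approximation:
  fixes v :: "real^'d::finite \<Rightarrow> real"
  assumes v[measurable]: "v \<in> borel_measurable borel" and M: "\<And>x. \<bar>v x\<bar> \<le> M" and e: "e > 0"
  obtains g where "continuous_on UNIV g" "(\<integral>\<^sup>+x. ennreal (indicator (cball 0 R) x * \<bar>v x - g x\<bar>) \<partial>lborel) \<le> ennreal e"
proof -
  have "v \<in> borel_measurable lebesgue" by (rule measurable_completion) simp
  then have "v measurable_on UNIV" by (rule lebesgue_measurable_imp_measurable_on) simp
  then obtain N G where N: "negligible N" and G: "\<And>n. continuous_on UNIV (G n)"
    and lim: "\<And>x. x \<notin> N \<Longrightarrow> (\<lambda>n. G n x) \<longlonglongrightarrow> v x"
    unfolding measurable_on_def by auto
  define H where "H n x = max (- M) (min M (G n x))" for n x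
  have H: "continuous_on UNIV (H n)" for n
    unfolding H_def[abs_def] by (intro continuous_intros G)
  have [measurable]: "H n \<in> borel_measurable borel" for n by (rule borel_measurable_continuous_onI[OF H])
  have "M \<ge> 0" using M[of 0] by linarith
  have Hb: "\<bar>H n x\<bar> \<le> M" for n x using \<open>M \<ge> 0\<close> by (auto simp: H_def max_def min_def abs_if)
  have Hlim: "(\<lambda>n. H n x) \<longlonglongrightarrow> v x" if "x \<notin> N" for x
  proof -
    have "(\<lambda>n. H n x) \<longlonglongrightarrow> max (- M) (min M (v x))"
      unfolding H_def by (intro tendsto_intros lim that)
    then show ?thesis using M[of x] by (simp add: max_def min_def abs_le_iff split: if_splits)
  qed
  have "AE x in lebesgue. x \<notin> N" using N by (simp add: negligible_iff_null_sets AE_not_in)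
  then have ae: "AE x in lborel. x \<notin> N" by (simp add: AE_completion_iff)
  let ?B = "cball 0 R :: (real^'d) set"
  have ib: "integrable lborel (\<lambda>x. C * indicator ?B x :: real)" for C
    by (intro integrable_mult_right integrable_real_indicator) (use emeasure_lborel_cball_finite in simp_all)
  have bnd: "norm (indicator ?B x * \<bar>v x - H n x\<bar>) \<le> 2 * M * indicator ?B x" for n x
  proof -
    have "\<bar>v x - H n x\<bar> \<le> 2 * M" using M[of x] Hb[of n x] by linarith
    then show ?thesis by (simp add: indicator_def)
  qed
  have m: "(\<lambda>x. indicator ?B x * \<bar>v x - H n x\<bar>) \<in> borel_measurable borel" for n
    by (intro borel_measurable_times borel_measurable_indicator borel_measurable_abs borel_measurable_diff v
        borel_measurable_continuous_onI[OF H] borel_closed closed_cball)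
  have i: "integrable lborel (\<lambda>x. indicator ?B x * \<bar>v x - H n x\<bar>)" for n
  proof (rule Bochner_Integration.integrable_bound[OF ib[of "2 * M"]])
    show "AE x in lborel. norm (indicator ?B x * \<bar>v x - H n x\<bar>) \<le> norm (2 * M * indicator ?B x)"
      using order_trans[OF bnd abs_ge_self] by simp
  qed (simp add: m)
  have "(\<lambda>n. \<integral>x. indicator ?B x * \<bar>v x - H n x\<bar> \<partial>lborel) \<longlonglongrightarrow> (\<integral>x. indicator ?B x * \<bar>v x - v x\<bar> \<partial>(lborel :: (real^'d) measure))"
  proof (rule integral_dominated_convergence[OF _ _ ib])
    show "AE x in lborel. (\<lambda>n. indicator ?B x * \<bar>v x - H n x\<bar>) \<longlonglongrightarrow> indicator ?B x * \<bar>v x - v x\<bar>"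
      using ae by eventually_elim (intro tendsto_intros Hlim)
    show "AE x in lborel. norm (indicator ?B x * \<bar>v x - H n x\<bar>) \<le> 2 * M * indicator ?B x" for n
      using bnd by simp
  qed (simp_all add: m)
  then have "(\<lambda>n. \<integral>x. indicator ?B x * \<bar>v x - H n x\<bar> \<partial>lborel) \<longlonglongrightarrow> 0" by simp
  from order_tendstoD(2)[OF this e] obtain n where "(\<integral>x. indicator ?B x * \<bar>v x - H n x\<bar> \<partial>lborel) < e"
    by (auto simp: eventually_sequentially)
  moreover have "(\<integral>\<^sup>+x. ennreal (indicator ?B x * \<bar>v x - H n x\<bar>) \<partial>lborel)
      = ennreal (\<integral>x. indicator ?B x * \<bar>v x - H n x\<bar> \<partial>lborel)"
    by (rule nn_integral_eq_integral[OF i]) simp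
  ultimately show ?thesis using that[OF H, of n] by (simp add: ennreal_leI)
qed

text \<open>Approximate v in L1 by a continuous g on a ball. The difference v - g and its translate
  cost e / 3 each, and the uniform continuity of g costs the remaining third.\<close>

lemma L1_translation_continuous:
  fixes v :: "real^'d::finite \<Rightarrow> real"
  assumes v[measurable]: "v \<in> borel_measurable borel" and M: "\<And>x. \<bar>v x\<bar> \<le> M"
    and R: "\<And>x. norm x > R \<Longrightarrow> v x = 0" and e: "e > 0"
  obtains d where "d > 0"
    "\<And>h. norm h \<le> d \<Longrightarrow> (\<integral>\<^sup>+x. ennreal \<bar>v (x - h) - v x\<bar> \<partial>lborel) \<le> ennreal e"
proof -
  \<comment> \<open>For |h| \<le> 1 the ball \<open>B\<close> contains all points where v or its
    translate can be nonzero, and \<open>B'\<close> contains B together with its translates.\<close>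
  define B where "B = (cball 0 (\<bar>R\<bar> + 1) :: (real^'d) set)"
  define B' where "B' = (cball 0 (\<bar>R\<bar> + 2) :: (real^'d) set)"
  define b where "b = measure lborel B"
  have b: "b \<ge> 0" "emeasure lborel B = ennreal b"
    using emeasure_lborel_cball_finite[of "0 :: real^'d" "\<bar>R\<bar> + 1"] by (auto simp: b_def B_def intro!: emeasure_eq_ennreal_measure)
  have [measurable]: "B \<in> sets borel" "B' \<in> sets borel" by (auto simp: B_def B'_def)
  obtain g where g: "continuous_on UNIV g"
    and gi: "(\<integral>\<^sup>+x. ennreal (indicator B' x * \<bar>v x - g x\<bar>) \<partial>lborel) \<le> ennreal (e / 3)"
    using continuous_L1_approximation[OF v M, of "e / 3" "\<bar>R\<bar> + 2"] e unfolding B'_def by auto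
  have [measurable]: "g \<in> borel_measurable borel" by (rule borel_measurable_continuous_onI[OF g])
  let ?D = "\<lambda>x. indicator B' x * \<bar>v x - g x\<bar>"
  \<comment> \<open>The oscillation c of g is integrated over B, whose measure is b; dividing by 1 +
    b instead of b gives c * b \<le> e / 3 without asking whether b vanishes.\<close>
  define c where "c = e / (3 * (1 + b))"
  have c: "c > 0" "c * b \<le> e / 3" using e b(1) by (auto simp: c_def field_simps)
  have "uniformly_continuous_on B' g"
    unfolding B'_def by (intro compact_uniformly_continuous continuous_on_subset[OF g]) auto
  from this[unfolded uniformly_continuous_on_def, rule_format, OF c(1)]
  obtain d where d: "d > 0" "\<And>x y. x \<in> B' \<Longrightarrow> y \<in> B' \<Longrightarrow> dist y x < d \<Longrightarrow> dist (g y) (g x) < c" by blast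
  show ?thesis
  proof (rule that[of "min 1 (d / 2)"])
    show "min 1 (d / 2) > 0" using d by simp
    fix h :: "real^'d" assume h: "norm h \<le> min 1 (d / 2)"
    have pt: "\<bar>v (x - h) - v x\<bar> \<le> ?D (x - h) + (c * indicator B x + ?D x)" for x
    proof (cases "x \<in> B")
      case True
      have "norm (x - h) \<le> \<bar>R\<bar> + 2" using True h norm_triangle_ineq4[of x h] by (simp add: B_def)
      then have x: "x \<in> B'" "x - h \<in> B'" using True by (auto simp: B_def B'_def)
      have "\<bar>g (x - h) - g x\<bar> < c"
        using d(2)[OF x] h d(1) by (simp add: dist_norm)
      then show ?thesis using x True by simp
    next
      case False
      then have "norm x > R" "norm (x - h) > R"
        using h norm_triangle_ineq2[of x h] by (auto simp: B_def)
      then show ?thesis using False R c(1) by simp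
    qed
    have "(\<integral>\<^sup>+x. ennreal \<bar>v (x - h) - v x\<bar> \<partial>lborel)
        \<le> (\<integral>\<^sup>+x. ennreal (?D (x - h)) + (ennreal c * indicator B x + ennreal (?D x)) \<partial>lborel)"
    proof (rule nn_integral_mono)
      fix x
      have "ennreal \<bar>v (x - h) - v x\<bar> \<le> ennreal (?D (x - h) + (c * indicator B x + ?D x))"
        by (rule ennreal_leI[OF pt])
      also have "\<dots> = ennreal (?D (x - h)) + (ennreal c * indicator B x + ennreal (?D x))"
        using c(1) by (subst ennreal_plus, simp, simp add: indicator_def, subst ennreal_plus) (auto simp: indicator_def)
      finally show "ennreal \<bar>v (x - h) - v x\<bar> \<le> ennreal (?D (x - h)) + (ennreal c * indicator B x + ennreal (?D x))" .
    qed
    also have "\<dots> = (\<integral>\<^sup>+x. ennreal (?D (x - h)) \<partial>lborel) + (ennreal c * emeasure lborel B + (\<integral>\<^sup>+x. ennreal (?D x) \<partial>lborel))"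
      by (subst nn_integral_add, measurable, subst nn_integral_add, measurable) (simp add: nn_integral_cmult_indicator)
    also have "(\<integral>\<^sup>+x. ennreal (?D (x - h)) \<partial>lborel) = (\<integral>\<^sup>+x. ennreal (?D x) \<partial>lborel)"
      by (rule lborel_nn_integral_shift[of "\<lambda>x. ennreal (?D x)"]) measurable
    also have "(\<integral>\<^sup>+x. ennreal (?D x) \<partial>lborel) + (ennreal c * emeasure lborel B + (\<integral>\<^sup>+x. ennreal (?D x) \<partial>lborel))
        \<le> ennreal (e / 3) + (ennreal (e / 3) + ennreal (e / 3))"
      using gi c b by (intro add_mono) (auto simp: ennreal_mult[symmetric] intro: ennreal_leI)
    also have "\<dots> = ennreal e" using e by (simp flip: ennreal_plus)
    finally show "(\<integral>\<^sup>+x. ennreal \<bar>v (x - h) - v x\<bar> \<partial>lborel) \<le> ennreal e" .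
  qed
qed

lemma test_function_uniformly_continuous:
  assumes "\<phi> \<in> test_functions \<Omega>" "e > 0"
  obtains d where "d > 0" "\<And>x y. norm (x - y) \<le> d \<Longrightarrow> \<bar>\<phi> x - \<phi> y\<bar> \<le> e"
proof -
  obtain R where R: "\<And>x. norm x > R \<Longrightarrow> \<phi> x = 0" using test_function_support_bounded[OF assms(1)] by blast
  have "uniformly_continuous_on (cball 0 (R + 1)) \<phi>"
    by (intro compact_uniformly_continuous continuous_on_subset[OF test_function_bounds(1)[OF assms(1)]]) auto
  from this[unfolded uniformly_continuous_on_def, rule_format, OF assms(2)]
  obtain d where d: "d > 0" "\<And>x y. x \<in> cball 0 (R + 1) \<Longrightarrow> y \<in> cball 0 (R + 1) \<Longrightarrow> dist y x < d \<Longrightarrow> dist (\<phi> y) (\<phi> x) < e"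
    by blast
  show ?thesis
  proof (rule that[of "min 1 (d / 2)"])
    show "min 1 (d / 2) > 0" using d by simp
    fix x y :: "real^'a" assume h: "norm (x - y) \<le> min 1 (d / 2)"
    show "\<bar>\<phi> x - \<phi> y\<bar> \<le> e"
    proof (cases "norm x \<le> R + 1 \<and> norm y \<le> R + 1")
      case True
      then show ?thesis using d(2)[of y x] h d(1) by (simp add: dist_norm)
    next
      case False
      then have "norm x > R" "norm y > R"
        using h norm_triangle_ineq2[of x y] norm_triangle_ineq3[of x y] by auto
      then show ?thesis using R assms(2) by simp
    qed
  qed
qed

text \<open>The compact support has positive distance from the closed complement of \<Omega>, so for
  a fixed \<phi> all sufficiently small mollification radii are admissible.\<close>

lemma test_function_support_margin:
  assumes "\<phi> \<in> test_functions \<Omega>" "open \<Omega>"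
  obtains d where "d > 0" "\<And>x r. \<phi> x \<noteq> 0 \<Longrightarrow> r < d \<Longrightarrow> cball x r \<subseteq> \<Omega>"
proof -
  let ?K = "closure {x. \<phi> x \<noteq> 0}"
  have "compact ?K" "closed (- \<Omega>)" "?K \<inter> - \<Omega> = {}" using assms by (auto simp: test_functions_def)
  then obtain d where d: "d > 0" "\<And>x y. x \<in> ?K \<Longrightarrow> y \<in> - \<Omega> \<Longrightarrow> d \<le> dist x y"
    using separate_compact_closed by metis
  have "cball x r \<subseteq> \<Omega>" if "\<phi> x \<noteq> 0" "r < d" for x r
  proof
    fix y assume y: "y \<in> cball x r"
    have "x \<in> ?K" using that(1) closure_subset[of "{x. \<phi> x \<noteq> 0}"] by auto
    then show "y \<in> \<Omega>" using d(2)[of x y] y that(2) by force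
  qed
  then show ?thesis using that d(1) by blast
qed

text \<open>The range of \<theta>: nonnegative shares of one derivative. Being convex and compact,
  the set is stable under weak limits.\<close>

definition subprob :: "(real^'l::finite) set" where
  "subprob = {w. (\<forall>i. 0 \<le> w $ i) \<and> (\<Sum>i\<in>UNIV. w $ i) \<le> 1}"

lemma subprob_convex: "convex subprob"
proof (rule convexI)
  fix x y :: "real^'l" and a b :: real
  assume *: "x \<in> subprob" "y \<in> subprob" "0 \<le> a" "0 \<le> b" "a + b = 1"
  have "(\<Sum>i\<in>UNIV. (a *\<^sub>R x + b *\<^sub>R y) $ i) = a * (\<Sum>i\<in>UNIV. x $ i) + b * (\<Sum>i\<in>UNIV. y $ i)"
    by (simp add: sum.distrib sum_distrib_left)
  also have "\<dots> \<le> a * 1 + b * 1" using * by (intro add_mono mult_left_mono) (auto simp: subprob_def)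
  finally show "a *\<^sub>R x + b *\<^sub>R y \<in> subprob" using * by (auto simp: subprob_def)
qed

lemma subprob_compact: "compact (subprob :: (real^'l::finite) set)"
proof -
  have "closed (subprob :: (real^'l) set)"
    unfolding subprob_def Collect_conj_eq Collect_all_eq
    by (intro closed_Int closed_INT ballI closed_Collect_le continuous_intros)
  moreover have "norm x \<le> 1" if "x \<in> subprob" for x :: "real^'l"
    using norm_le_l1_cart[of x] that by (auto simp: subprob_def abs_of_nonneg)
  then have "bounded (subprob :: (real^'l) set)" by (auto simp: bounded_iff)
  ultimately show ?thesis by (simp add: compact_eq_bounded_closed)
qed

text \<open>The functions \<psi> i divide an increment of the argument into nonnegative shares whose
  total does not exceed it. Antiderivatives are part of the data so that moving averages of \<psi>
  are difference quotients of \<Psi> and need no integrals.\<close>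

locale split_chain =
  fixes \<psi> \<Psi> :: "'l::finite \<Rightarrow> real \<Rightarrow> real"
  assumes antiderivative: "\<And>i t. (\<Psi> i has_real_derivative \<psi> i t) (at t)"
    and mono: "\<And>i a b. a \<le> b \<Longrightarrow> \<psi> i a \<le> \<psi> i b"
    and total: "\<And>a b. a \<le> b \<Longrightarrow> (\<Sum>i\<in>UNIV. \<psi> i b - \<psi> i a) \<le> b - a"
begin

lemma lip: "a \<le> b \<Longrightarrow> \<psi> i b - \<psi> i a \<le> b - a"
proof -
  assume "a \<le> b"
  have "\<psi> i b - \<psi> i a \<le> (\<Sum>i\<in>UNIV. \<psi> i b - \<psi> i a)"
    by (rule member_le_sum) (use mono[OF \<open>a \<le> b\<close>] in auto)
  then show ?thesis using total[OF \<open>a \<le> b\<close>] by linarith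
qed

lemma lip_abs: "\<bar>\<psi> i b - \<psi> i a\<bar> \<le> \<bar>b - a\<bar>"
  using lip[of a b i] lip[of b a i] mono[of a b i] mono[of b a i] by (cases "a \<le> b") auto

lemma psi_continuous: "continuous_on UNIV (\<psi> i)"
proof (rule continuous_onI)
  fix x e :: real assume "e > 0"
  then show "\<exists>d>0. \<forall>x'\<in>UNIV. dist x' x < d \<longrightarrow> dist (\<psi> i x') (\<psi> i x) \<le> e"
    by (intro exI[of _ e]) (auto simp: dist_real_def intro!: order_trans[OF lip_abs])
qed

lemma psi_borel[measurable]: "\<psi> i \<in> borel_measurable borel"
  by (rule borel_measurable_continuous_onI[OF psi_continuous])

text \<open>Averaging over a short interval makes \<open>\<psi>\<close> differentiable, and the derivative is a difference
  quotient of \<open>\<psi>\<close>, so the bounds on increments of \<open>\<psi>\<close> turn into bounds on derivatives.\<close>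

definition avg :: "real \<Rightarrow> 'l \<Rightarrow> real \<Rightarrow> real" where "avg d i t = (\<Psi> i (t + d) - \<Psi> i t) / d"
definition quot :: "real \<Rightarrow> 'l \<Rightarrow> real \<Rightarrow> real" where "quot d i t = (\<psi> i (t + d) - \<psi> i t) / d"

lemma avg_derivative: "(avg d i has_real_derivative quot d i t) (at t)"
proof -
  have "((\<lambda>t. \<Psi> i (t + d)) has_real_derivative \<psi> i (t + d)) (at t)"
    using antiderivative[of i "t + d"] by (simp add: DERIV_shift)
  then show ?thesis
    unfolding avg_def[abs_def] quot_def by (intro DERIV_cdivide DERIV_diff antiderivative)
qed

lemma quot_borel[measurable]: "quot d i \<in> borel_measurable borel"
  unfolding quot_def[abs_def] by measurable

lemma avg_borel[measurable]: "avg d i \<in> borel_measurable borel"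
  using avg_derivative
  by (intro borel_measurable_continuous_onI continuous_at_imp_continuous_on ballI DERIV_isCont) auto

lemma quot_bounds: "d > 0 \<Longrightarrow> 0 \<le> quot d i t" "d > 0 \<Longrightarrow> (\<Sum>i\<in>UNIV. quot d i t) \<le> 1"
  "d > 0 \<Longrightarrow> \<bar>quot d i t\<bar> \<le> 1"
proof -
  assume d: "d > 0"
  show 0: "0 \<le> quot d i t" using mono[of t "t + d" i] d by (simp add: quot_def)
  show "(\<Sum>i\<in>UNIV. quot d i t) \<le> 1"
    using total[of t "t + d"] d by (simp add: quot_def flip: sum_divide_distrib)
  have "quot d i t \<le> 1" using lip[of t "t + d" i] d by (simp add: quot_def)
  then show "\<bar>quot d i t\<bar> \<le> 1" using 0 by linarith
qed

lemma avg_close: assumes "d > 0" shows "\<bar>avg d i t - \<psi> i t\<bar> \<le> d"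
proof -
  obtain z where z: "t < z" "z < t + d" "\<Psi> i (t + d) - \<Psi> i t = (t + d - t) * \<psi> i z"
    using MVT2[of t "t + d" "\<Psi> i" "\<psi> i"] antiderivative assms by auto
  then have "avg d i t = \<psi> i z" using assms by (simp add: avg_def)
  then show ?thesis using lip_abs[of i z t] z by linarith
qed

end

text \<open>A chain rule for Lipschitz \<psi> and a v whose derivative is only a measure. With v
  mollified and \<psi> averaged the classical rule holds with weights in \<open>subprob\<close>, and
  a weak limit of these weights is the required density; jumps of v need no separate
  treatment.\<close>

lemma chain_rule_density:
  fixes \<psi> \<Psi> :: "'l::finite \<Rightarrow> real \<Rightarrow> real" and v :: "real^'d::finite \<Rightarrow> real"
  assumes "split_chain \<psi> \<Psi>"
    and v[measurable]: "v \<in> borel_measurable borel" and M: "\<And>x. \<bar>v x\<bar> \<le> M"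
    and R: "\<And>x. norm x > R \<Longrightarrow> v x = 0"
    and \<Omega>: "open \<Omega>" "finite_measure \<mu>" and sets: "sets \<mu> = sets (restrict_space borel \<Omega>)"
    and s: "integrable \<mu> s"
    and w: "\<And>\<phi> j. \<phi> \<in> test_functions \<Omega> \<Longrightarrow> (\<integral>x. v x * pd j \<phi> x \<partial>lborel) = - (\<integral>x. \<phi> x * (s x $ j) \<partial>\<mu>)"
  obtains \<theta> :: "real^'d \<Rightarrow> real^'l" where "\<theta> \<in> borel_measurable \<mu>" "\<And>x. \<theta> x \<in> subprob"
    "\<And>\<phi> i j. \<phi> \<in> test_functions \<Omega> \<Longrightarrow>
      (\<integral>x. \<psi> i (v x) * pd j \<phi> x \<partial>lborel) = - (\<integral>x. \<phi> x * (\<theta> x $ i * s x $ j) \<partial>\<mu>)"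
proof -
  interpret split_chain \<psi> \<Psi> by fact
  interpret M: finite_measure \<mu> by fact
  define \<delta> where "\<delta> n = 1 / real (Suc n)" for n
  have \<delta>: "\<delta> n > 0" for n by (simp add: \<delta>_def)
  have \<delta>0: "\<delta> \<longlonglongrightarrow> 0" unfolding \<delta>_def[abs_def] using LIMSEQ_inverse_real_of_nat by (simp add: inverse_eq_divide)
  have vi: "integrable lborel v" by (rule integrable_bounded_support[OF v M R])
  have "\<exists>d>0. \<forall>h. norm h \<le> d \<longrightarrow> (\<integral>\<^sup>+x. ennreal \<bar>v (x - h) - v x\<bar> \<partial>lborel) \<le> ennreal (\<delta> n)" for n
    using L1_translation_continuous[OF v M R \<delta>[of n]] by metis
  then obtain d where d: "\<And>n. d n > 0"
    "\<And>n h. norm h \<le> d n \<Longrightarrow> (\<integral>\<^sup>+x. ennreal \<bar>v (x - h) - v x\<bar> \<partial>lborel) \<le> ennreal (\<delta> n)" by metis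
  \<comment> \<open>r n \<le> d n puts the mollified v within \<delta> n of v in L1, and r n \<le>
    \<delta> n makes the kernels shrink to a point.\<close>
  define r where "r n = min (d n) (\<delta> n)" for n
  have r: "r n > 0" "r n \<le> d n" "r n \<le> \<delta> n" for n using d(1)[of n] \<delta>[of n] by (auto simp: r_def)
  have "\<exists>\<eta> :: real^'d \<Rightarrow> real. \<eta> \<in> flat_algebra \<and> (\<forall>x. 0 \<le> \<eta> x) \<and> (\<forall>x. norm x > r n \<longrightarrow> \<eta> x = 0) \<and> (\<integral>x. \<eta> x \<partial>lborel) = 1" for n
    using mollifier_exists[OF r(1)[of n]] by metis
  then obtain \<eta> :: "nat \<Rightarrow> real^'d \<Rightarrow> real" where \<eta>: "\<And>n. \<eta> n \<in> flat_algebra" "\<And>n x. 0 \<le> \<eta> n x"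
    "\<And>n x. norm x > r n \<Longrightarrow> \<eta> n x = 0" "\<And>n. (\<integral>x. \<eta> n x \<partial>lborel) = 1" by metis
  interpret m: mollification "\<eta> n" "r n" v for n
    by unfold_locales (use \<eta> vi in auto)
  define mv where "mv n = m.mv n" for n
  have [measurable]: "mv n \<in> borel_measurable borel" for n unfolding mv_def by (rule m.mv_borel)
  have \<eta>i: "integrable lborel (\<lambda>x. \<eta> n (x - y))" for n y
    by (rule lborel_integrable_shift[OF m.eta_integrable])
  have qi: "integrable lborel (\<lambda>x. quot (\<delta> n) i (mv n x) * \<eta> n (x - y))" for n i y
    by (rule integrable_mult_bounded[OF \<eta>i, of _ 1]) (use quot_bounds(3)[OF \<delta>] in auto)
  have mvi: "integrable lborel (\<lambda>x. \<bar>mv n x - v x\<bar>)" and mvl: "(\<integral>x. \<bar>mv n x - v x\<bar> \<partial>lborel) \<le> \<delta> n" for n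
  proof -
    have *: "(\<integral>\<^sup>+x. ennreal \<bar>mv n x - v x\<bar> \<partial>lborel) \<le> ennreal (\<delta> n)"
      unfolding mv_def by (rule m.mv_minus_v_le) (use d(2) r(2) order_trans in blast)
    show i: "integrable lborel (\<lambda>x. \<bar>mv n x - v x\<bar>)"
      by (rule integrableI_bounded) (use le_less_trans[OF *] in auto)
    have "ennreal (\<integral>x. \<bar>mv n x - v x\<bar> \<partial>lborel) \<le> ennreal (\<delta> n)"
      using * nn_integral_eq_integral[OF i] by simp
    then show "(\<integral>x. \<bar>mv n x - v x\<bar> \<partial>lborel) \<le> \<delta> n" using \<delta>[of n] by (simp add: ennreal_le_iff less_imp_le)
  qed
  \<comment> \<open>The quotients at scale \<delta> n, averaged with the kernel centred at y. They
    are shares with total at most 1 before averaging and remain so because the kernel has mass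
    1.\<close>
  define \<theta> :: "nat \<Rightarrow> real^'d \<Rightarrow> real^'l" where
    "\<theta> n y = (\<chi> i. \<integral>x. quot (\<delta> n) i (mv n x) * \<eta> n (x - y) \<partial>lborel)" for n y
  have [measurable]: "(\<lambda>y. y) \<in> measurable \<mu> borel"
    using measurable_restrict_space1[of "\<lambda>y. y" borel borel \<Omega>] by (simp add: measurable_cong_sets[OF sets refl])
  have \<theta>m: "\<theta> n \<in> borel_measurable \<mu>" for n
    unfolding \<theta>_def[abs_def]
    by (subst borel_measurable_euclidean_space) (auto simp: Basis_vec_real inner_axis)
  have \<theta>S: "\<theta> n y \<in> subprob" for n y
  proof -
    have "(\<Sum>i\<in>UNIV. \<integral>x. quot (\<delta> n) i (mv n x) * \<eta> n (x - y) \<partial>lborel)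
        = (\<integral>x. (\<Sum>i\<in>UNIV. quot (\<delta> n) i (mv n x) * \<eta> n (x - y)) \<partial>lborel)"
      by (rule Bochner_Integration.integral_sum[symmetric]) (rule qi)
    also have "\<dots> \<le> (\<integral>x. \<eta> n (x - y) \<partial>lborel)"
    proof (rule integral_mono[OF _ \<eta>i])
      show "integrable lborel (\<lambda>x. \<Sum>i\<in>UNIV. quot (\<delta> n) i (mv n x) * \<eta> n (x - y))"
        by (intro Bochner_Integration.integrable_sum qi)
      show "(\<Sum>i\<in>UNIV. quot (\<delta> n) i (mv n x) * \<eta> n (x - y)) \<le> \<eta> n (x - y)" for x
        unfolding sum_distrib_right[symmetric]
        by (rule mult_left_le_one_le) (use \<eta> quot_bounds[OF \<delta>] in \<open>auto intro: sum_nonneg\<close>)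
    qed
    also have "\<dots> = 1" by (rule m.eta_shift_integral)
    finally have "(\<Sum>i\<in>UNIV. \<integral>x. quot (\<delta> n) i (mv n x) * \<eta> n (x - y) \<partial>lborel) \<le> 1" .
    moreover have "0 \<le> (\<integral>x. quot (\<delta> n) i (mv n x) * \<eta> n (x - y) \<partial>lborel)" for i
      by (intro Bochner_Integration.integral_nonneg mult_nonneg_nonneg quot_bounds(1)[OF \<delta>] \<eta>(2))
    ultimately show ?thesis by (simp add: \<theta>_def subprob_def)
  qed
  obtain g where g: "g \<in> borel_measurable \<mu>" "\<And>x. g x \<in> subprob"
    "\<And>h b L. integrable \<mu> h \<Longrightarrow> (\<lambda>n. \<integral>x. h x * (\<theta> n x \<bullet> b) \<partial>\<mu>) \<longlonglongrightarrow> L \<Longrightarrow> (\<integral>x. h x * (g x \<bullet> b) \<partial>\<mu>) = L"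
    by (rule weak_limit_bounded_sequence[where \<theta> = \<theta>, OF \<Omega>(2) \<theta>m \<theta>S subprob_convex subprob_compact]) (rule that)
  have sj: "integrable \<mu> (\<lambda>y. s y $ j)" for j
    using integrable_inner_left[of "axis j 1", OF s] by (simp add: inner_axis)
  have main: "(\<integral>x. \<psi> i (v x) * pd j \<phi> x \<partial>lborel) = - (\<integral>x. \<phi> x * (g x $ i * s x $ j) \<partial>\<mu>)"
    if \<phi>: "\<phi> \<in> test_functions \<Omega>" for \<phi> i j
  proof -
    note [measurable] = test_function_borel[OF \<phi>] test_function_borel[OF pd_test_function[OF \<phi>]]
    note pdi = test_function_integrable[OF pd_test_function[OF \<phi>], of j]
    obtain A where A: "\<And>x. \<bar>pd j \<phi> x\<bar> \<le> A" "A \<ge> 0"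
      using test_function_bounds(2)[OF pd_test_function[OF \<phi>]] by blast
    obtain C where C: "\<And>x. \<bar>\<phi> x\<bar> \<le> C" "C \<ge> 0"
      using test_function_bounds(2)[OF \<phi>] by blast
    \<comment> \<open>The chain rule delivers \<phi> under the mollification, as in
      \<open>T\<close>, whereas the weak limit needs \<phi> y in front of \<theta> n y. The two
      differ by at most the oscillation of \<phi> at scale r n.\<close>
    define T where "T n y = (\<integral>x. \<phi> x * quot (\<delta> n) i (mv n x) * \<eta> n (x - y) \<partial>lborel)" for n y
    define I where "I n = (\<integral>x. avg (\<delta> n) i (mv n x) * pd j \<phi> x \<partial>lborel)" for n
    have Ti: "integrable lborel (\<lambda>x. \<phi> x * quot (\<delta> n) i (mv n x) * \<eta> n (x - y))" for n y
      using integrable_mult_bounded[OF qi[of n i y] _ C(1)] by (simp add: mult.assoc)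
    have [measurable]: "T n \<in> borel_measurable \<mu>" for n unfolding T_def[abs_def] by measurable
    have [measurable]: "(\<lambda>y. s y $ j) \<in> borel_measurable \<mu>" using sj[of j] by simp
    have \<phi>\<mu>: "\<phi> \<in> borel_measurable \<mu>" by (rule test_function_measurable[OF \<phi> sets])
    obtain dd where dd: "dd > 0" "\<And>x r. \<phi> x \<noteq> 0 \<Longrightarrow> r < dd \<Longrightarrow> cball x r \<subseteq> \<Omega>"
      using test_function_support_margin[OF \<phi> \<Omega>(1)] by blast
    have "\<forall>\<^sub>F n in sequentially. \<delta> n < dd" by (rule order_tendstoD(2)[OF \<delta>0 dd(1)])
    then have IT: "\<forall>\<^sub>F n in sequentially. - I n = (\<integral>y. T n y * (s y $ j) \<partial>\<mu>)"
    proof eventually_elim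
      case (elim n)
      have "\<And>x. \<phi> x \<noteq> 0 \<Longrightarrow> cball x (r n) \<subseteq> \<Omega>" using dd(2) r(3)[of n] elim by (meson le_less_trans)
      from m.mollified_chain_rule[OF \<Omega> sets s w avg_derivative quot_borel quot_bounds(3)[OF \<delta>] \<phi> this]
      show ?case unfolding I_def T_def mv_def by simp
    qed
    \<comment> \<open>The error has two parts: averaging \<psi> costs at most \<delta> n pointwise,
      and mollifying v costs at most \<delta> n in L1, which the Lipschitz bound passes on to
      \<psi>.\<close>
    have "I \<longlonglongrightarrow> (\<integral>x. \<psi> i (v x) * pd j \<phi> x \<partial>lborel)"
    proof (rule Lim_null_comparison[THEN LIM_zero_cancel])
      define P where "P = (\<integral>x. \<bar>pd j \<phi> x\<bar> \<partial>lborel)"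
      have "\<bar>I n - (\<integral>x. \<psi> i (v x) * pd j \<phi> x \<partial>lborel)\<bar> \<le> \<delta> n * P + A * \<delta> n" for n
      proof -
        have 1: "integrable lborel (\<lambda>x. (avg (\<delta> n) i (mv n x) - \<psi> i (mv n x)) * pd j \<phi> x)"
          by (rule integrable_mult_bounded[OF pdi]) (use avg_close[OF \<delta>[of n]] in auto)
        have 2: "integrable lborel (\<lambda>x. pd j \<phi> x * (\<psi> i (mv n x) - \<psi> i (v x)))"
        proof (rule integrable_mult_bounded[OF _ _ A(1)])
          show "integrable lborel (\<lambda>x. \<psi> i (mv n x) - \<psi> i (v x))"
            by (rule Bochner_Integration.integrable_bound[OF mvi[of n]]) (use lip_abs in auto)
        qed simp
        have 3: "integrable lborel (\<lambda>x. \<psi> i (v x) * pd j \<phi> x)"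
        proof (rule integrable_mult_bounded[OF pdi])
          show "\<bar>\<psi> i (v x)\<bar> \<le> \<bar>\<psi> i 0\<bar> + M" for x using lip_abs[of i "v x" 0] M[of x] by linarith
        qed simp
        have "I n = (\<integral>x. (avg (\<delta> n) i (mv n x) - \<psi> i (mv n x)) * pd j \<phi> x
            + pd j \<phi> x * (\<psi> i (mv n x) - \<psi> i (v x)) + \<psi> i (v x) * pd j \<phi> x \<partial>lborel)"
          unfolding I_def by (rule Bochner_Integration.integral_cong) (simp_all add: algebra_simps)
        also have "\<dots> = (\<integral>x. (avg (\<delta> n) i (mv n x) - \<psi> i (mv n x)) * pd j \<phi> x \<partial>lborel)
            + (\<integral>x. pd j \<phi> x * (\<psi> i (mv n x) - \<psi> i (v x)) \<partial>lborel) + (\<integral>x. \<psi> i (v x) * pd j \<phi> x \<partial>lborel)"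
          using 1 2 3 by simp
        finally have "I n - (\<integral>x. \<psi> i (v x) * pd j \<phi> x \<partial>lborel)
            = (\<integral>x. (avg (\<delta> n) i (mv n x) - \<psi> i (mv n x)) * pd j \<phi> x \<partial>lborel)
            + (\<integral>x. pd j \<phi> x * (\<psi> i (mv n x) - \<psi> i (v x)) \<partial>lborel)" by simp
        moreover have "\<bar>\<integral>x. (avg (\<delta> n) i (mv n x) - \<psi> i (mv n x)) * pd j \<phi> x \<partial>lborel\<bar> \<le> \<delta> n * P"
          unfolding P_def by (rule abs_integral_mult_bounded[OF pdi]) (use avg_close[OF \<delta>[of n]] in auto)
        moreover have "\<bar>\<integral>x. pd j \<phi> x * (\<psi> i (mv n x) - \<psi> i (v x)) \<partial>lborel\<bar> \<le> A * \<delta> n"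
        proof -
          have i: "integrable lborel (\<lambda>x. \<psi> i (mv n x) - \<psi> i (v x))"
            by (rule Bochner_Integration.integrable_bound[OF mvi[of n]]) (use lip_abs in auto)
          have "\<bar>\<integral>x. pd j \<phi> x * (\<psi> i (mv n x) - \<psi> i (v x)) \<partial>lborel\<bar>
              \<le> A * (\<integral>x. \<bar>\<psi> i (mv n x) - \<psi> i (v x)\<bar> \<partial>lborel)"
            by (rule abs_integral_mult_bounded[OF i _ A(1)]) simp
          also have "\<dots> \<le> A * (\<integral>x. \<bar>mv n x - v x\<bar> \<partial>lborel)"
            by (intro mult_left_mono integral_mono integrable_abs i mvi A(2) lip_abs)
          also have "\<dots> \<le> A * \<delta> n" by (rule mult_left_mono[OF mvl A(2)])
          finally show ?thesis .
        qed
        ultimately show ?thesis by linarith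
      qed
      then show "\<forall>\<^sub>F n in sequentially. norm (I n - (\<integral>x. \<psi> i (v x) * pd j \<phi> x \<partial>lborel)) \<le> \<delta> n * P + A * \<delta> n"
        by simp
      have "(\<lambda>n. \<delta> n * P + A * \<delta> n) \<longlonglongrightarrow> 0 * P + A * 0" by (intro tendsto_intros \<delta>0)
      then show "(\<lambda>n. \<delta> n * P + A * \<delta> n) \<longlonglongrightarrow> 0" by simp
    qed
    then have "(\<lambda>n. - I n) \<longlonglongrightarrow> - (\<integral>x. \<psi> i (v x) * pd j \<phi> x \<partial>lborel)" by (rule tendsto_minus)
    then have limT: "(\<lambda>n. \<integral>y. T n y * (s y $ j) \<partial>\<mu>) \<longlonglongrightarrow> - (\<integral>x. \<psi> i (v x) * pd j \<phi> x \<partial>lborel)"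
      using IT by (rule Lim_transform_eventually)
    define S where "S = (\<integral>y. \<bar>s y $ j\<bar> \<partial>\<mu>)"
    have S: "S \<ge> 0" by (simp add: S_def)
    have \<theta>b: "\<bar>\<theta> n y $ i\<bar> \<le> 1" for n y
    proof -
      have "0 \<le> \<theta> n y $ i" "\<theta> n y $ i \<le> (\<Sum>i\<in>UNIV. \<theta> n y $ i)" "(\<Sum>i\<in>UNIV. \<theta> n y $ i) \<le> 1"
        using \<theta>S[of n y] by (auto simp: subprob_def intro!: member_le_sum)
      then show ?thesis by linarith
    qed
    have \<theta>im[measurable]: "(\<lambda>y. \<theta> n y $ i) \<in> borel_measurable \<mu>" for n
      by (rule measurable_compose[OF \<theta>m]) simp
    have diff: "\<bar>T n y - \<phi> y * (\<theta> n y $ i)\<bar> \<le> e"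
      if e: "\<And>x y. norm (x - y) \<le> r n \<Longrightarrow> \<bar>\<phi> x - \<phi> y\<bar> \<le> e" and e0: "e \<ge> 0" for n y e
    proof -
      have "T n y - \<phi> y * (\<theta> n y $ i) = (\<integral>x. \<phi> x * quot (\<delta> n) i (mv n x) * \<eta> n (x - y)
          - \<phi> y * (quot (\<delta> n) i (mv n x) * \<eta> n (x - y)) \<partial>lborel)"
        unfolding T_def \<theta>_def using Ti[of n y] qi[of n i y] by simp
      \<comment> \<open>The cutoff may be inserted because the kernel vanishes beyond radius r n;
        with it the first factor is bounded by e at every x.\<close>
      also have "\<dots> = (\<integral>x. ((\<phi> x - \<phi> y) * quot (\<delta> n) i (mv n x) * (if norm (x - y) \<le> r n then 1 else 0)) * \<eta> n (x - y) \<partial>lborel)"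
        using \<eta>(3) by (intro Bochner_Integration.integral_cong) (auto simp: algebra_simps)
      also have "\<bar>\<dots>\<bar> \<le> e * (\<integral>x. \<bar>\<eta> n (x - y)\<bar> \<partial>lborel)"
      proof (rule abs_integral_mult_bounded[OF \<eta>i])
        show "\<bar>(\<phi> x - \<phi> y) * quot (\<delta> n) i (mv n x) * (if norm (x - y) \<le> r n then 1 else 0)\<bar> \<le> e" for x
        proof (cases "norm (x - y) \<le> r n")
          case True
          have "\<bar>\<phi> x - \<phi> y\<bar> * \<bar>quot (\<delta> n) i (mv n x)\<bar> \<le> e * 1"
            by (intro mult_mono e[OF True] quot_bounds(3)[OF \<delta>] e0) auto
          then show ?thesis using True by (simp add: abs_mult)
        qed (use e0 in simp)
        have 1: "(\<lambda>x. quot (\<delta> n) i (mv n x)) \<in> borel_measurable lborel" by simp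
        have 2: "(\<lambda>x. if norm (x - y) \<le> r n then 1 else 0 :: real) \<in> borel_measurable lborel" by simp
        have 3: "\<phi> \<in> borel_measurable lborel" using test_function_borel[OF \<phi>] by simp
        show "(\<lambda>x. (\<phi> x - \<phi> y) * quot (\<delta> n) i (mv n x) * (if norm (x - y) \<le> r n then 1 else 0)) \<in> borel_measurable lborel"
          by (intro borel_measurable_times borel_measurable_diff borel_measurable_const 1 2 3)
      qed
      also have "\<dots> = e" using m.eta_shift_integral[of n y] \<eta>(2) by simp
      finally show ?thesis .
    qed
    have "(\<lambda>n. \<integral>y. \<phi> y * (s y $ j) * (\<theta> n y \<bullet> axis i 1) \<partial>\<mu>) \<longlonglongrightarrow> - (\<integral>x. \<psi> i (v x) * pd j \<phi> x \<partial>lborel)"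
    proof (rule Lim_transform2[OF limT], rule LIMSEQ_I)
      fix e :: real assume e: "e > 0"
      define e' where "e' = e / (1 + S)"
      have e': "e' > 0" "e' * S < e" using e S by (auto simp: e'_def field_simps)
      obtain \<kappa> where \<kappa>: "\<kappa> > 0" "\<And>x y. norm (x - y) \<le> \<kappa> \<Longrightarrow> \<bar>\<phi> x - \<phi> y\<bar> \<le> e'"
        using test_function_uniformly_continuous[OF \<phi> e'(1)] by blast
      obtain N where N: "\<And>n. n \<ge> N \<Longrightarrow> \<delta> n < \<kappa>"
        using order_tendstoD(2)[OF \<delta>0 \<kappa>(1)] by (auto simp: eventually_sequentially)
      have "norm ((\<integral>y. T n y * (s y $ j) \<partial>\<mu>) - (\<integral>y. \<phi> y * (s y $ j) * (\<theta> n y \<bullet> axis i 1) \<partial>\<mu>) - 0) < e"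
        if n: "n \<ge> N" for n
      proof -
        have cl: "\<bar>\<phi> x - \<phi> y\<bar> \<le> e'" if "norm (x - y) \<le> r n" for x y
          by (rule \<kappa>(2)) (use that r(3)[of n] N[OF n] in linarith)
        have D: "\<bar>T n y - \<phi> y * (\<theta> n y $ i)\<bar> \<le> e'" for y
          by (rule diff[OF cl less_imp_le[OF e'(1)]])
        have f: "\<bar>\<phi> y * (\<theta> n y $ i)\<bar> \<le> C * 1" for y unfolding abs_mult by (intro mult_mono C \<theta>b) auto
        have "\<bar>T n y\<bar> \<le> C + e'" for y using D[of y] f[of y] by linarith
        then have i1: "integrable \<mu> (\<lambda>y. T n y * (s y $ j))"
          by (intro integrable_mult_bounded[OF sj]) auto
        have i2: "integrable \<mu> (\<lambda>y. \<phi> y * (\<theta> n y $ i) * (s y $ j))"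
          by (rule integrable_mult_bounded[OF sj _ f]) (intro borel_measurable_times \<phi>\<mu> \<theta>im)
        have "(\<integral>y. T n y * (s y $ j) \<partial>\<mu>) - (\<integral>y. \<phi> y * (s y $ j) * (\<theta> n y \<bullet> axis i 1) \<partial>\<mu>)
            = (\<integral>y. T n y * (s y $ j) - \<phi> y * (\<theta> n y $ i) * (s y $ j) \<partial>\<mu>)"
          using i1 i2 by (simp add: inner_axis mult.commute mult.left_commute)
        also have "\<dots> = (\<integral>y. (T n y - \<phi> y * (\<theta> n y $ i)) * (s y $ j) \<partial>\<mu>)"
          by (simp add: left_diff_distrib)
        finally have "\<bar>(\<integral>y. T n y * (s y $ j) \<partial>\<mu>) - (\<integral>y. \<phi> y * (s y $ j) * (\<theta> n y \<bullet> axis i 1) \<partial>\<mu>)\<bar> \<le> e' * S"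
          using abs_integral_mult_bounded[OF sj _ D] unfolding S_def by simp
        then show ?thesis using e'(2) by simp
      qed
      then show "\<exists>N. \<forall>n\<ge>N. norm ((\<integral>y. T n y * (s y $ j) \<partial>\<mu>) - (\<integral>y. \<phi> y * (s y $ j) * (\<theta> n y \<bullet> axis i 1) \<partial>\<mu>) - 0) < e"
        by blast
    qed
    \<comment> \<open>The weak limit is applied with h equal to \<phi> times a component of s, for
      which convergence has just been established.\<close>
    from g(3)[OF test_function_mult_integrable[OF \<phi> sets sj] this]
    show ?thesis by (simp add: inner_axis mult.commute mult.left_commute)
  qed
  show ?thesis by (rule that[OF g(1,2) main])
qed

section \<open>Lifted labels and the biconjugate\<close>

lemma pos_bij: "bij_betw (pos :: 'l::{finite,linorder} \<Rightarrow> nat) UNIV {1..CARD('l)}"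
proof -
  have less: "pos i < pos j" if "i < j" for i j :: 'l
    unfolding pos_def using that by (intro psubset_card_mono) auto
  have inj: "inj (pos :: 'l \<Rightarrow> nat)"
    by (rule injI) (metis less less_irrefl linorder_less_linear)
  have "pos i \<in> {1..CARD('l)}" for i :: 'l
    unfolding pos_def by (auto intro!: card_mono simp: Suc_le_eq card_gt_0_iff)
  then have "range (pos :: 'l \<Rightarrow> nat) \<subseteq> {1..CARD('l)}" by blast
  moreover have "card (range (pos :: 'l \<Rightarrow> nat)) = card {1..CARD('l)}"
    using inj by (simp add: card_image)
  ultimately have "range (pos :: 'l \<Rightarrow> nat) = {1..CARD('l)}" by (intro card_subset_eq) auto
  then show ?thesis using inj by (simp add: bij_betw_def)
qed

lemma pos_bounds: "1 \<le> pos (i :: 'l::{finite,linorder})" "pos i \<le> CARD('l)"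
  using bij_betw_apply[OF pos_bij, of i] by auto

lemma sum_pos: "(\<Sum>j\<in>UNIV. f (pos (j :: 'l::{finite,linorder}))) = sum f {1..CARD('l)}"
  by (rule sum.reindex_bij_betw[OF pos_bij])

definition unlift :: "(nat \<Rightarrow> real) \<Rightarrow> real^'l::{finite,linorder} \<Rightarrow> real" where
  "unlift \<gamma> w = \<gamma> 1 + (\<Sum>i\<in>UNIV. w $ i * label_gap \<gamma> i)"

text \<open>Component i is the part of t above its label, cut off at the gap and divided by it: a
  clamped ramp from 0 to 1. Written with positive parts it is defined for all real t, and on lifted
  labels it inverts \<open>unlift\<close>.\<close>

definition lift :: "(nat \<Rightarrow> real) \<Rightarrow> real \<Rightarrow> real^'l::{finite,linorder}" where
  "lift \<gamma> t = (\<chi> i. (max 0 (t - \<gamma> (pos i)) - max 0 (t - \<gamma> (pos i + 1))) / label_gap \<gamma> i)"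

lemma unlift_inner: "unlift \<gamma> w = \<gamma> 1 + label_gaps \<gamma> \<bullet> w"
  by (simp add: unlift_def label_gaps_def inner_vec_def mult.commute)

lemma unlift_affine:
  "a + b = 1 \<Longrightarrow> unlift \<gamma> (a *\<^sub>R v + b *\<^sub>R w) = a * unlift \<gamma> v + b * unlift \<gamma> w"
  by (simp add: unlift_inner inner_add_right algebra_simps flip: distrib_right)

lemma unlift_ones:
  assumes "n \<le> CARD('l)"
  shows "unlift \<gamma> (ones n :: real^'l::{finite,linorder}) = \<gamma> (n + 1)"
proof -
  have "(\<Sum>i\<in>UNIV. (ones n :: real^'l::{finite,linorder}) $ i * label_gap \<gamma> i)
      = (\<Sum>i\<in>(UNIV :: 'l set). if pos i \<le> n then \<gamma> (pos i + 1) - \<gamma> (pos i) else 0)"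
    by (intro sum.cong) (auto simp: ones_def label_gap_def)
  also have "\<dots> = (\<Sum>k\<in>{1..CARD('l)}. if k \<le> n then \<gamma> (k + 1) - \<gamma> k else 0)"
    by (rule sum_pos)
  also have "\<dots> = (\<Sum>k\<in>{1..n}. \<gamma> (k + 1) - \<gamma> k)"
    by (rule sum.mono_neutral_cong_right) (use assms in auto)
  also have "\<dots> = \<gamma> (n + 1) - \<gamma> 1"
    using sum_Suc_diff'[of 1 "n + 1" \<gamma>] by (simp add: atLeastLessThanSuc_atLeastAtMost)
  finally show ?thesis by (simp add: unlift_def)
qed

lemma unlift_lifted_sublabel:
  assumes "i \<in> {1..CARD('l)}"
  shows "unlift \<gamma> (lifted_sublabel i \<alpha> :: real^'l::{finite,linorder}) = sublabel \<gamma> i \<alpha>"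
proof -
  have "unlift \<gamma> (lifted_sublabel i \<alpha> :: real^'l::{finite,linorder}) = \<alpha> * \<gamma> (i + 1) + (1 - \<alpha>) * \<gamma> i"
    unfolding lifted_sublabel_def using assms
    by (subst unlift_affine) (auto simp: unlift_ones)
  then show ?thesis by (simp add: sublabel_def algebra_simps)
qed

text \<open>\<open>lt\<close> makes the index type part of the parameters, since the types of
  \<open>\<gamma>\<close> and \<open>l\<close> do not mention it.\<close>

locale labels =
  fixes \<gamma> :: "nat \<Rightarrow> real" and l :: nat and lt :: "'l::{finite,linorder} itself"
  assumes l: "l = CARD('l)" and mono: "strict_mono_on {1..l + 1} \<gamma>"
begin

lemma gamma_less: "1 \<le> i \<Longrightarrow> i < j \<Longrightarrow> j \<le> l + 1 \<Longrightarrow> \<gamma> i < \<gamma> j"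
  using strict_mono_onD[OF mono] by auto

lemma gamma_le: "1 \<le> i \<Longrightarrow> i \<le> j \<Longrightarrow> j \<le> l + 1 \<Longrightarrow> \<gamma> i \<le> \<gamma> j"
  using gamma_less[of i j] by (cases "i = j") auto

lemma gap_pos: "label_gap \<gamma> (i :: 'l) > 0"
  using gamma_less[of "pos i" "pos i + 1"] pos_bounds[of i] l by (simp add: label_gap_def)

lemma sublabel_range:
  assumes "i \<in> {1..l}" "\<alpha> \<in> {0..1}"
  shows "\<gamma> i \<le> sublabel \<gamma> i \<alpha>" "sublabel \<gamma> i \<alpha> \<le> \<gamma> (i + 1)" "sublabel \<gamma> i \<alpha> \<in> {\<gamma> 1..\<gamma> (l + 1)}"
proof -
  have g: "\<gamma> i < \<gamma> (i + 1)" using gamma_less[of i "i + 1"] assms by auto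
  show 1: "\<gamma> i \<le> sublabel \<gamma> i \<alpha>" using g assms by (simp add: sublabel_def)
  have "\<alpha> * (\<gamma> (i + 1) - \<gamma> i) \<le> 1 * (\<gamma> (i + 1) - \<gamma> i)"
    using g assms by (intro mult_right_mono) auto
  then show 2: "sublabel \<gamma> i \<alpha> \<le> \<gamma> (i + 1)" by (simp add: sublabel_def)
  show "sublabel \<gamma> i \<alpha> \<in> {\<gamma> 1..\<gamma> (l + 1)}"
    using 1 2 gamma_le[of 1 i] gamma_le[of "i + 1" "l + 1"] assms by auto
qed

lemma lift_sublabel:
  assumes i: "i \<in> {1..l}" and \<alpha>: "\<alpha> \<in> {0..1}"
  shows "lift \<gamma> (sublabel \<gamma> i \<alpha>) = (lifted_sublabel i \<alpha> :: real^'l::{finite,linorder})"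
proof (rule vec_eq_iff[THEN iffD2, rule_format])
  fix j :: 'l
  let ?t = "sublabel \<gamma> i \<alpha>"
  note r = sublabel_range[OF assms] and p = pos_bounds[of j]
  consider "pos j < i" | "pos j = i" | "pos j > i" by linarith
  then show "lift \<gamma> ?t $ j = (lifted_sublabel i \<alpha> :: real^'l::{finite,linorder}) $ j"
  proof cases
    case 1
    have "\<gamma> (pos j + 1) \<le> \<gamma> i" "\<gamma> (pos j) \<le> \<gamma> i" using gamma_le[of _ i] 1 i p by auto
    then have "max 0 (?t - \<gamma> (pos j)) - max 0 (?t - \<gamma> (pos j + 1)) = label_gap \<gamma> j"
      using r by (simp add: label_gap_def)
    then have "lift \<gamma> ?t $ j = label_gap \<gamma> j / label_gap \<gamma> j"
      by (simp only: lift_def vec_lambda_beta)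
    then show ?thesis using 1 i gap_pos[of j] by (simp add: lifted_sublabel_def ones_def)
  next
    case 2
    have "max 0 (?t - \<gamma> (pos j)) - max 0 (?t - \<gamma> (pos j + 1)) = \<alpha> * label_gap \<gamma> j"
      using r 2 by (simp add: label_gap_def sublabel_def)
    then have "lift \<gamma> ?t $ j = \<alpha> * label_gap \<gamma> j / label_gap \<gamma> j"
      by (simp only: lift_def vec_lambda_beta)
    \<comment> \<open>This is where i \<ge> 1 enters: for i = 0 the truncated difference i - 1 would
      equal i.\<close>
    moreover have "\<not> i \<le> i - 1" using i by auto
    ultimately show ?thesis using 2 i gap_pos[of j] by (simp add: lifted_sublabel_def ones_def)
  next
    case 3
    have "\<gamma> (i + 1) \<le> \<gamma> (pos j)" "\<gamma> (i + 1) \<le> \<gamma> (pos j + 1)"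
      using gamma_le[of "i + 1" "pos j"] gamma_le[of "i + 1" "pos j + 1"] 3 i p l by auto
    then show ?thesis using 3 i r by (simp add: lift_def lifted_sublabel_def ones_def)
  qed
qed

lemma sublabel_exists:
  assumes "t \<in> {\<gamma> 1..\<gamma> (l + 1)}"
  obtains i \<alpha> where "i \<in> {1..l}" "\<alpha> \<in> {0..1}" "t = sublabel \<gamma> i \<alpha>"
proof -
  have l0: "l \<ge> 1" using l by (simp add: Suc_le_eq card_gt_0_iff)
  \<comment> \<open>The maximum is taken over 1..l only, so the right end \<gamma> (l + 1) is
    reached as i = l with coefficient 1.\<close>
  define i where "i = Max {i \<in> {1..l}. \<gamma> i \<le> t}"
  have "1 \<in> {i \<in> {1..l}. \<gamma> i \<le> t}" using assms l0 by auto
  then have "i \<in> {i \<in> {1..l}. \<gamma> i \<le> t}" unfolding i_def by (intro Max_in) auto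
  then have i: "i \<in> {1..l}" "\<gamma> i \<le> t" by auto
  have t: "t \<le> \<gamma> (i + 1)"
  proof (cases "i = l")
    case False
    show ?thesis
    proof (rule ccontr)
      assume "\<not> t \<le> \<gamma> (i + 1)"
      then have "i + 1 \<in> {i \<in> {1..l}. \<gamma> i \<le> t}" using i False by auto
      then have "i + 1 \<le> i" unfolding i_def by (intro Max_ge) auto
      then show False by simp
    qed
  qed (use assms in simp)
  have g: "\<gamma> i < \<gamma> (i + 1)" using gamma_less[of i "i + 1"] i by auto
  show ?thesis
    by (rule that[of i "(t - \<gamma> i) / (\<gamma> (i + 1) - \<gamma> i)"]) (use i t g in \<open>auto simp: sublabel_def field_simps\<close>)
qed

lemma unlift_lift: "t \<in> {\<gamma> 1..\<gamma> (l + 1)} \<Longrightarrow> unlift \<gamma> (lift \<gamma> t :: real^'l::{finite,linorder}) = t"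
  by (erule sublabel_exists) (simp add: lift_sublabel unlift_lifted_sublabel l)

lemma lift_in_labels: "t \<in> {\<gamma> 1..\<gamma> (l + 1)} \<Longrightarrow> (lift \<gamma> t :: real^'l::{finite,linorder}) \<in> lifted_labels"
  by (erule sublabel_exists) (auto simp: lift_sublabel lifted_labels_def l)

lemma lift_unlift: "w \<in> lifted_labels \<Longrightarrow> lift \<gamma> (unlift \<gamma> w) = (w :: real^'l::{finite,linorder})"
  by (auto simp: lifted_labels_def unlift_lifted_sublabel lift_sublabel l)

text \<open>The projection is affine, so the preimage of the label interval is a convex set
  containing the lifted labels.\<close>

lemma unlift_range:
  assumes "w \<in> convex hull (lifted_labels :: (real^'l::{finite,linorder}) set)"
  shows "unlift \<gamma> w \<in> {\<gamma> 1..\<gamma> (l + 1)}"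
proof -
  have "convex {w :: real^'l::{finite,linorder}. unlift \<gamma> w \<in> {\<gamma> 1..\<gamma> (l + 1)}}"
  proof (rule convexI)
    fix v w :: "real^'l::{finite,linorder}" and a b :: real
    assume "v \<in> {w. unlift \<gamma> w \<in> {\<gamma> 1..\<gamma> (l + 1)}}" "w \<in> {w. unlift \<gamma> w \<in> {\<gamma> 1..\<gamma> (l + 1)}}"
      "0 \<le> a" "0 \<le> b" and ab: "a + b = 1"
    then have "a *\<^sub>R unlift \<gamma> v + b *\<^sub>R unlift \<gamma> w \<in> {\<gamma> 1..\<gamma> (l + 1)}"
      by (intro convexD[OF convex_real_interval(5)]) auto
    then show "a *\<^sub>R v + b *\<^sub>R w \<in> {w. unlift \<gamma> w \<in> {\<gamma> 1..\<gamma> (l + 1)}}"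
      by (simp add: unlift_affine[OF ab])
  qed
  moreover have "lifted_labels \<subseteq> {w :: real^'l::{finite,linorder}. unlift \<gamma> w \<in> {\<gamma> 1..\<gamma> (l + 1)}}"
    using sublabel_range(3) l by (auto simp: lifted_labels_def unlift_lifted_sublabel)
  ultimately have "convex hull (lifted_labels :: (real^'l::{finite,linorder}) set) \<subseteq> {w. unlift \<gamma> w \<in> {\<gamma> 1..\<gamma> (l + 1)}}"
    by (rule hull_minimal[rotated])
  then show ?thesis using assms by auto
qed

section \<open>Bounds for the biconjugate of the lifted integrand\<close>

abbreviation biconj :: "(real^'d::finite \<Rightarrow> real \<Rightarrow> ereal) \<Rightarrow> real^'d \<Rightarrow> real^'l::{finite,linorder} \<Rightarrow> ereal" where
  "biconj \<rho> x \<equiv> conjugate (conjugate (lifted_integrand \<gamma> \<rho> x))"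

lemma biconj_le: "t \<in> {\<gamma> 1..\<gamma> (l + 1)} \<Longrightarrow> biconj \<rho> x (lift \<gamma> t) \<le> \<rho> x t"
proof -
  assume t: "t \<in> {\<gamma> 1..\<gamma> (l + 1)}"
  let ?F = "lifted_integrand \<gamma> \<rho> x :: real^'l::{finite,linorder} \<Rightarrow> ereal"
  obtain i \<alpha> where i: "i \<in> {1..l}" "\<alpha> \<in> {0..1}" "t = sublabel \<gamma> i \<alpha>" by (rule sublabel_exists[OF t])
  have "?F (lift \<gamma> t) \<le> \<rho> x (sublabel \<gamma> i \<alpha>) + 0"
    unfolding lifted_integrand_def using i l by (intro INF_lower2[of "(i, \<alpha>)"]) (auto simp: lift_sublabel)
  then have 1: "?F (lift \<gamma> t) \<le> \<rho> x t" using i by simp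
  have "biconj \<rho> x w \<le> ?F w" for w
    unfolding conjugate_def[of "conjugate ?F"]
  proof (rule SUP_least)
    fix v
    have "ereal (v \<bullet> w) - ?F w \<le> conjugate ?F v" unfolding conjugate_def by (rule SUP_upper) simp
    then show "ereal (w \<bullet> v) - conjugate ?F v \<le> ?F w"
      by (cases "?F w"; cases "conjugate ?F v") (auto simp: inner_commute)
  qed
  from this[of "lift \<gamma> t"] 1 show ?thesis by (rule order_trans)
qed

text \<open>Composed with \<open>unlift\<close>, an affine minorant of the integrand becomes an
  affine minorant of the lifted integrand, with gradient s times the vector of gaps; the biconjugate
  dominates it. The instance c = s = 0 later gives nonnegativity.\<close>

lemma biconj_ge:
  assumes "\<And>t. t \<in> {\<gamma> 1..\<gamma> (l + 1)} \<Longrightarrow> ereal (c + s * t) \<le> \<rho> x t"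
  shows "ereal (c + s * unlift \<gamma> w) \<le> biconj \<rho> x w"
proof -
  let ?F = "lifted_integrand \<gamma> \<rho> x :: real^'l::{finite,linorder} \<Rightarrow> ereal"
  define v where "v = s *\<^sub>R (label_gaps \<gamma> :: real^'l::{finite,linorder})"
  have v: "v \<bullet> w = s * unlift \<gamma> w - s * \<gamma> 1" for w by (simp add: v_def unlift_inner algebra_simps)
  have "ereal (c + s * unlift \<gamma> w) \<le> ?F w" for w
    unfolding lifted_integrand_def
  proof (rule INF_greatest, clarify)
    fix i \<alpha> assume *: "i \<in> {1..CARD('l)}" "\<alpha> \<in> {0..1::real}"
    show "ereal (c + s * unlift \<gamma> w) \<le> \<rho> x (sublabel \<gamma> i \<alpha>) + (if w = lifted_sublabel i \<alpha> then 0 else \<infinity>)"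
      using assms[OF sublabel_range(3)] * l by (auto simp: unlift_lifted_sublabel)
  qed
  then have "ereal (v \<bullet> w) - ?F w \<le> ereal (- c - s * \<gamma> 1)" for w
    using \<open>\<And>w. ereal (c + s * unlift \<gamma> w) \<le> ?F w\<close>[of w] v[of w] by (cases "?F w") auto
  then have "conjugate ?F v \<le> ereal (- c - s * \<gamma> 1)"
    unfolding conjugate_def by (intro SUP_least)
  then have "ereal (c + s * unlift \<gamma> w) \<le> ereal (w \<bullet> v) - conjugate ?F v"
    using v[of w] by (cases "conjugate ?F v") (auto simp: inner_commute)
  also have "\<dots> \<le> biconj \<rho> x w" unfolding conjugate_def[of "conjugate ?F"] by (rule SUP_upper) simp
  finally show ?thesis .
qed

end

text \<open>At a proper convex combination a convex function is bounded by its lower semicontinuous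
  envelope at the endpoints, because the combination is either interior to the domain or separated
  from it by an endpoint. Here \<open>Fa\<close> and \<open>Fb\<close> dominate all affine minorants.\<close>

lemma convex_midpoint_le_envelope:
  fixes f :: "real \<Rightarrow> ereal"
  assumes cv: "ereal_convex_on {A..B} f" and nn: "\<And>t. t \<in> {A..B} \<Longrightarrow> 0 \<le> f t"
    and ab: "a \<in> {A..B}" "b \<in> {A..B}" "a < b"
    and Fa: "\<And>c s. (\<And>t. t \<in> {A..B} \<Longrightarrow> ereal (c + s * t) \<le> f t) \<Longrightarrow> ereal (c + s * a) \<le> Fa"
    and Fb: "\<And>c s. (\<And>t. t \<in> {A..B} \<Longrightarrow> ereal (c + s * t) \<le> f t) \<Longrightarrow> ereal (c + s * b) \<le> Fb"
  shows "f ((a + b) / 2) \<le> ereal (1/2) * Fa + ereal (1/2) * Fb"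
proof -
  define m where "m = (a + b) / 2"
  have m: "a < m" "m < b" "m \<in> {A..B}" using ab by (auto simp: m_def)
  have Fa0: "0 \<le> Fa" using Fa[of 0 0] nn by (simp add: zero_ereal_def)
  have Fb0: "0 \<le> Fb" using Fb[of 0 0] nn by (simp add: zero_ereal_def)
  define D where "D = {t \<in> {A..B}. f t < \<infinity>}"
  have slope: "ereal (real n * (\<sigma> * (t - m))) \<le> f t" if "t \<in> {A..B}" "\<And>t. t \<in> D \<Longrightarrow> \<sigma> * (t - m) \<le> 0" for n t \<sigma>
  proof (cases "t \<in> D")
    case True
    then have "real n * (\<sigma> * (t - m)) \<le> 0" using that(2)[of t] by (simp add: mult_nonneg_nonpos)
    then have "ereal (real n * (\<sigma> * (t - m))) \<le> 0" by simp
    then show ?thesis using nn[OF that(1)] by (rule order_trans)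
  next
    case False
    then show ?thesis using that(1) by (auto simp: D_def)
  qed
  have inf: "F = \<infinity>" if "d > 0" "\<And>n. ereal (real n * d) \<le> F" for F :: ereal and d :: real
  proof (rule ereal_top)
    fix B :: real
    obtain n where "B / d < real n" using reals_Archimedean2 by blast
    then have "ereal B \<le> ereal (real n * d)" using that(1) by (simp add: field_simps)
    then show "ereal B \<le> F" using that(2) by (rule order_trans)
  qed
  \<comment> \<open>If D lies on one side of m, which includes the empty D, these lines force the
    envelope at the opposite endpoint to be infinite. Otherwise m is interior to D and has a
    subgradient.\<close>
  consider "\<And>t. t \<in> D \<Longrightarrow> t \<le> m" | "\<And>t. t \<in> D \<Longrightarrow> m \<le> t"
    | p q where "p \<in> D" "p < m" "q \<in> D" "m < q" by (meson not_le)
  then show ?thesis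
  proof cases
    case 1
    have "Fb = \<infinity>"
    proof (rule inf)
      show "ereal (real n * (b - m)) \<le> Fb" for n
        using Fb[of "- real n * m" "real n"] slope[of _ 1 n] 1 by (simp add: algebra_simps)
    qed (use m in simp)
    then show ?thesis using Fa0 by (cases Fa) auto
  next
    case 2
    have "Fa = \<infinity>"
    proof (rule inf)
      show "ereal (real n * (m - a)) \<le> Fa" for n
        using Fa[of "real n * m" "- real n"] slope[of _ "- 1" n] 2 by (simp add: algebra_simps)
    qed (use m in simp)
    then show ?thesis using Fb0 by (cases Fb) auto
  next
    case (3 p q)
    have cvD: "f ((1 - t) * x + t * y) \<le> ereal (1 - t) * f x + ereal t * f y"
      if "x \<in> {A..B}" "y \<in> {A..B}" "t \<in> {0..1}" for x y t
      using cv that unfolding ereal_convex_on_def by blast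
    define g where "g t = real_of_ereal (f t)" for t
    have fg: "f t = ereal (g t)" if "t \<in> D" for t
      using that nn[of t] by (cases "f t") (auto simp: D_def g_def)
    have comb: "(1 - t) * x + t * y \<in> D \<and> g ((1 - t) * x + t * y) \<le> (1 - t) * g x + t * g y"
      if "x \<in> D" "y \<in> D" "t \<in> {0..1}" for x y t
    proof -
      have r: "x \<in> {A..B}" "y \<in> {A..B}" using that by (auto simp: D_def)
      have le: "f ((1 - t) * x + t * y) \<le> ereal ((1 - t) * g x + t * g y)"
        using cvD[OF r that(3)] by (simp add: fg that(1,2))
      have "(1 - t) *\<^sub>R x + t *\<^sub>R y \<in> {A..B}"
        using r that(3) by (intro convexD[OF convex_real_interval(5)]) auto
      then have "(1 - t) * x + t * y \<in> D" using le by (auto simp: D_def)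
      with le show ?thesis by (simp add: fg)
    qed
    have cD: "convex D"
      unfolding convex_alt using comb by auto
    have cg: "convex_on D g"
      by (rule convex_onI) (use comb cD in auto)
    have "{p..q} \<subseteq> D"
      using cD 3 by (metis closed_segment_subset closed_segment_eq_real_ivl order_less_imp_le less_trans)
    then have "{p<..<q} \<subseteq> D" by (meson greaterThanLessThan_subseteq_atLeastAtMost_iff order_refl subset_trans)
    then have mi: "m \<in> interior D" using 3 by (intro interiorI[of "{p<..<q}"]) auto
    then have mD: "m \<in> D" using interior_subset by blast
    \<comment> \<open>A subgradient of g at m, obtained as the infimum of the slopes to the
      right.\<close>
    define s where "s = Inf ((\<lambda>t. (g m - g t) / (m - t)) ` ({m<..} \<inter> D))"
    have sub: "g t \<ge> g m + s * (t - m)" if "t \<in> D" for t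
      unfolding s_def by (rule convex_le_Inf_differential[OF cg mi that])
    have aff: "ereal ((g m - s * m) + s * t) \<le> f t" if "t \<in> {A..B}" for t
    proof (cases "t \<in> D")
      case True
      then show ?thesis using sub[OF True] by (simp add: fg algebra_simps)
    qed (use that in \<open>auto simp: D_def\<close>)
    \<comment> \<open>An affine function takes at the midpoint the mean of its endpoint values, and
      \<open>Fa\<close> and \<open>Fb\<close> dominate those values.\<close>
    have "f m = ereal ((1/2) * ((g m - s * m) + s * a) + (1/2) * ((g m - s * m) + s * b))"
      using fg[OF mD] by (simp add: m_def algebra_simps)
    also have "\<dots> = ereal (1/2) * ereal ((g m - s * m) + s * a) + ereal (1/2) * ereal ((g m - s * m) + s * b)"
      by simp
    also have "\<dots> \<le> ereal (1/2) * Fa + ereal (1/2) * Fb"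
      by (intro add_mono ereal_mult_left_mono Fa Fb aff) auto
    finally show ?thesis by (simp add: m_def)
  qed
qed

text \<open>For distinct points the envelope bound is combined with \<open>biconj_le\<close> at a.
  If the points coincide, then w is the lift of a and both sides are equal; this uses that w is a
  lifted label. The term at \<open>lift \<gamma> a\<close> is added on the left, not subtracted on
  the right, because values may be infinite.\<close>

lemma (in labels) midpoint_biconj:
  assumes cv: "ereal_convex_on {\<gamma> 1..\<gamma> (l + 1)} (\<rho> x)" and nn: "\<And>t. t \<in> {\<gamma> 1..\<gamma> (l + 1)} \<Longrightarrow> 0 \<le> \<rho> x t"
    and a: "a \<in> {\<gamma> 1..\<gamma> (l + 1)}" and w: "w \<in> lifted_labels"
  shows "\<rho> x ((a + unlift \<gamma> w) / 2) + ereal (1/2) * biconj \<rho> x (lift \<gamma> a)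
    \<le> \<rho> x a + ereal (1/2) * biconj \<rho> x w"
proof -
  let ?b = "unlift \<gamma> w"
  have b: "?b \<in> {\<gamma> 1..\<gamma> (l + 1)}" using w by (intro unlift_range) (auto simp: hull_inc)
  have Fa: "ereal (c + s * a) \<le> biconj \<rho> x (lift \<gamma> a)" if "\<And>t. t \<in> {\<gamma> 1..\<gamma> (l + 1)} \<Longrightarrow> ereal (c + s * t) \<le> \<rho> x t" for c s
    using biconj_ge[where \<rho> = \<rho> and x = x and c = c and s = s and w = "lift \<gamma> a", OF that] by (simp add: unlift_lift[OF a])
  have Fb: "ereal (c + s * ?b) \<le> biconj \<rho> x w" if "\<And>t. t \<in> {\<gamma> 1..\<gamma> (l + 1)} \<Longrightarrow> ereal (c + s * t) \<le> \<rho> x t" for c s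
    by (rule biconj_ge[where \<rho> = \<rho> and x = x, OF that])
  show ?thesis
  proof (cases "a = ?b")
    case True
    then have "lift \<gamma> a = w" using lift_unlift[OF w] by simp
    then show ?thesis using True by simp
  next
    case False
    have "\<rho> x ((a + ?b) / 2) \<le> ereal (1/2) * biconj \<rho> x (lift \<gamma> a) + ereal (1/2) * biconj \<rho> x w"
    proof (cases "a < ?b")
      case True
      show ?thesis by (rule convex_midpoint_le_envelope[OF cv nn a b True Fa Fb])
    next
      case F: False
      then have "?b < a" using False by simp
      from convex_midpoint_le_envelope[OF cv nn b a this Fb Fa] show ?thesis by (simp add: add.commute)
    qed
    then have "\<rho> x ((a + ?b) / 2) + ereal (1/2) * biconj \<rho> x (lift \<gamma> a)
        \<le> (ereal (1/2) * biconj \<rho> x (lift \<gamma> a) + ereal (1/2) * biconj \<rho> x w) + ereal (1/2) * biconj \<rho> x (lift \<gamma> a)"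
      by (intro add_right_mono)
    also have "\<dots> = biconj \<rho> x (lift \<gamma> a) + ereal (1/2) * biconj \<rho> x w"
      by (cases "biconj \<rho> x (lift \<gamma> a)"; cases "biconj \<rho> x w") auto
    also have "\<dots> \<le> \<rho> x a + ereal (1/2) * biconj \<rho> x w" by (intro add_right_mono biconj_le a)
    finally show ?thesis .
  qed
qed

section \<open>Total variation of projected and lifted functions\<close>

lemma dual_tv_norm_scale: "c \<ge> 0 \<Longrightarrow> dual_tv_norm \<tau> (c *\<^sub>R q) = c * dual_tv_norm \<tau> q"
  by (cases \<tau>) (simp_all add: infnorm_mul)

lemma dual_tv_norm_inner_le:
  assumes "dual_tv_norm \<tau> q \<le> c"
  shows "q \<bullet> h \<le> c * tv_norm \<tau> h"
proof (cases \<tau>)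
  case Isotropic
  have "q \<bullet> h \<le> norm q * norm h" by (rule norm_cauchy_schwarz)
  also have "\<dots> \<le> c * norm h" using assms Isotropic by (intro mult_right_mono) auto
  finally show ?thesis using Isotropic by simp
next
  case Anisotropic
  have "q $ j * h $ j \<le> c * \<bar>h $ j\<bar>" for j
  proof -
    have "\<bar>q $ j\<bar> \<le> c" using component_le_infnorm_cart[of q j] assms Anisotropic by simp
    from mult_right_mono[OF this abs_ge_zero[of "h $ j"]] show ?thesis
      using abs_ge_self[of "q $ j * h $ j"] by (simp add: abs_mult)
  qed
  then show ?thesis using Anisotropic by (simp add: inner_vec_def sum_distrib_left sum_mono)
qed

lemma dual_tv_norm_attained: "\<exists>q. dual_tv_norm \<tau> q \<le> 1 \<and> q \<bullet> h = tv_norm \<tau> h"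
proof (cases \<tau>)
  case Isotropic
  have "norm (sgn h) \<le> 1 \<and> sgn h \<bullet> h = norm h"
    by (cases "h = 0") (auto simp: sgn_div_norm dot_square_norm power2_eq_square)
  then show ?thesis using Isotropic by auto
next
  case Anisotropic
  let ?q = "\<chi> j. sgn (h $ j)"
  have "infnorm ?q \<le> 1"
    unfolding infnorm_Max by (subst Max_le_iff) (auto simp: Basis_vec_real inner_axis abs_sgn_eq)
  moreover have "?q \<bullet> h = (\<Sum>j\<in>UNIV. \<bar>h $ j\<bar>)"
    by (simp add: inner_vec_def abs_sgn mult.commute)
  ultimately show ?thesis using Anisotropic by auto
qed

lemma tv_norm_nonneg: "0 \<le> tv_norm \<tau> h"
  by (cases \<tau>) (auto intro: sum_nonneg)

text \<open>A dual vector that attains the norm of the sum reduces the triangle inequality to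
  termwise duality bounds, for both kinds of norm at once.\<close>

lemma tv_norm_sum_le:
  assumes "\<And>i. i \<in> I \<Longrightarrow> 0 \<le> a i"
  shows "tv_norm \<tau> (\<Sum>i\<in>I. a i *\<^sub>R h i) \<le> (\<Sum>i\<in>I. a i * tv_norm \<tau> (h i))"
proof -
  obtain q where q: "dual_tv_norm \<tau> q \<le> 1" "q \<bullet> (\<Sum>i\<in>I. a i *\<^sub>R h i) = tv_norm \<tau> (\<Sum>i\<in>I. a i *\<^sub>R h i)"
    using dual_tv_norm_attained by blast
  have "tv_norm \<tau> (\<Sum>i\<in>I. a i *\<^sub>R h i) = (\<Sum>i\<in>I. a i * (q \<bullet> h i))"
    by (simp add: q(2)[symmetric] inner_sum_right)
  also have "\<dots> \<le> (\<Sum>i\<in>I. a i * tv_norm \<tau> (h i))"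
    using dual_tv_norm_inner_le[OF q(1)] assms by (intro sum_mono mult_left_mono) auto
  finally show ?thesis .
qed

lemma tv_norm_average_le: "tv_norm \<tau> ((1/2) *\<^sub>R (g + h)) \<le> (1/2) * (tv_norm \<tau> g + tv_norm \<tau> h)"
  using tv_norm_sum_le[of "UNIV :: bool set" "\<lambda>_. 1/2" \<tau> "\<lambda>b. if b then g else h"]
  by (simp add: UNIV_bool scaleR_add_right algebra_simps)

lemma tv_norm_scale: "c \<ge> 0 \<Longrightarrow> tv_norm \<tau> (c *\<^sub>R h) = c * tv_norm \<tau> h"
  by (cases \<tau>) (simp_all add: abs_mult sum_distrib_left)

lemma tv_norm_borel[measurable]: "(tv_norm \<tau> :: real^'d::finite \<Rightarrow> real) \<in> borel_measurable borel"
proof (cases \<tau>)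
  case Isotropic
  then have "tv_norm \<tau> = (norm :: real^'d \<Rightarrow> real)" by auto
  then show ?thesis
    by (simp only:) (intro borel_measurable_continuous_onI continuous_on_norm_id)
next
  case Anisotropic
  then have "tv_norm \<tau> = (\<lambda>h :: real^'d. \<Sum>j\<in>UNIV. \<bar>h $ j\<bar>)" by auto
  then show ?thesis by simp
qed

lemma tv_norm_pos_homogeneous: "pos_homogeneous (tv_norm \<tau>)"
  by (simp add: pos_homogeneous_def tv_norm_scale)

lemma tv_norm_le_norm: "tv_norm \<tau> (h :: real^'d::finite) \<le> real CARD('d) * norm h"
proof (cases \<tau>)
  case Isotropic
  have "1 * norm h \<le> real CARD('d) * norm h" by (intro mult_right_mono) (auto simp: Suc_le_eq card_gt_0_iff)
  then show ?thesis using Isotropic by simp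
next
  case Anisotropic
  have "(\<Sum>j\<in>UNIV. \<bar>h $ j\<bar>) \<le> real CARD('d) * norm h"
    by (rule sum_bounded_above) (rule component_le_norm_cart)
  then show ?thesis using Anisotropic by simp
qed

lemma tv_norm_integrable:
  fixes s :: "'a \<Rightarrow> real^'d::finite"
  assumes "integrable \<mu> s"
  shows "integrable \<mu> (\<lambda>x. tv_norm \<tau> (s x))"
proof (rule Bochner_Integration.integrable_bound)
  show "integrable \<mu> (\<lambda>x. real CARD('d) * norm (s x))" using assms by simp
  show "(\<lambda>x. tv_norm \<tau> (s x)) \<in> borel_measurable \<mu>"
    using assms by (intro measurable_compose[OF _ tv_norm_borel]) simp
  show "AE x in \<mu>. norm (tv_norm \<tau> (s x)) \<le> norm (real CARD('d) * norm (s x))"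
    by (simp add: tv_norm_nonneg tv_norm_le_norm)
qed

text \<open>The constraints of \<open>dual_set\<close> decouple over the rows, and the supremum is
  attained by scaling a norming dual vector of each row by its gap.\<close>

lemma lifted_tv_integrand_eq:
  fixes g :: "real^'d::finite^'l::{finite,linorder}"
  assumes "\<And>i :: 'l. label_gap \<gamma> i > 0"
  shows "lifted_tv_integrand \<tau> \<gamma> g = (\<Sum>i\<in>UNIV. label_gap \<gamma> i * tv_norm \<tau> (g $ i))"
  unfolding lifted_tv_integrand_def
proof (rule cSup_eq_maximum)
  have "\<forall>i. \<exists>q. dual_tv_norm \<tau> q \<le> 1 \<and> q \<bullet> (g $ i) = tv_norm \<tau> (g $ i)"
    using dual_tv_norm_attained by blast
  then obtain q where q: "\<And>i. dual_tv_norm \<tau> (q i) \<le> 1" "\<And>i. q i \<bullet> (g $ i) = tv_norm \<tau> (g $ i)" by metis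
  let ?q = "(\<chi> i. label_gap \<gamma> i *\<^sub>R q i) :: real^'d^'l::{finite,linorder}"
  have "label_gap \<gamma> i * dual_tv_norm \<tau> (q i) \<le> label_gap \<gamma> i" for i
    using mult_left_mono[OF q(1)[of i], of "label_gap \<gamma> i"] assms[of i] by simp
  then have "?q \<in> dual_set \<tau> \<gamma>" using assms by (simp add: dual_set_def dual_tv_norm_scale less_imp_le)
  moreover have "?q \<bullet> g = (\<Sum>i\<in>UNIV. label_gap \<gamma> i * tv_norm \<tau> (g $ i))"
    by (simp add: inner_vec_def[of ?q] q)
  ultimately show "(\<Sum>i\<in>UNIV. label_gap \<gamma> i * tv_norm \<tau> (g $ i)) \<in> (\<lambda>q. q \<bullet> g) ` dual_set \<tau> \<gamma>"
    by (metis imageI)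
next
  fix y assume "y \<in> (\<lambda>q. q \<bullet> g) ` dual_set \<tau> \<gamma>"
  then obtain q where q: "q \<in> dual_set \<tau> \<gamma>" "y = q \<bullet> g" by blast
  have "q \<bullet> g = (\<Sum>i\<in>UNIV. q $ i \<bullet> g $ i)" by (simp add: inner_vec_def[of q])
  also have "\<dots> \<le> (\<Sum>i\<in>UNIV. label_gap \<gamma> i * tv_norm \<tau> (g $ i))"
    by (intro sum_mono dual_tv_norm_inner_le) (use q in \<open>auto simp: dual_set_def\<close>)
  finally show "y \<le> (\<Sum>i\<in>UNIV. label_gap \<gamma> i * tv_norm \<tau> (g $ i))" using q by simp
qed

lemma lifted_tv_pos_homogeneous:
  assumes "\<And>i :: 'l. label_gap \<gamma> i > 0"
  shows "pos_homogeneous (lifted_tv_integrand \<tau> \<gamma> :: real^'d::finite^'l::{finite,linorder} \<Rightarrow> real)"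
proof -
  have "(\<lambda>g :: real^'d^'l::{finite,linorder}. g $ i) \<in> borel_measurable borel" for i
    by (intro borel_measurable_continuous_onI continuous_intros)
  then have "(\<lambda>g :: real^'d^'l::{finite,linorder}. \<Sum>i\<in>UNIV. label_gap \<gamma> i * tv_norm \<tau> (g $ i)) \<in> borel_measurable borel"
    by (intro borel_measurable_sum borel_measurable_times borel_measurable_const measurable_compose[OF _ tv_norm_borel])
  then show ?thesis
    by (auto simp: pos_homogeneous_def lifted_tv_integrand_eq[OF assms] tv_norm_scale sum_distrib_left
        algebra_simps fun_eq_iff cong: measurable_cong)
qed

lemma TV_eq:
  assumes "open \<Omega>" "weak_density \<Omega> (grad_functional \<Omega> u) \<mu> s"
  shows "TV \<tau> \<Omega> u = (\<integral>x. tv_norm \<tau> (s x) \<partial>\<mu>)"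
  unfolding TV_def
  by (rule measure_integral_eq[OF assms(1) tv_norm_pos_homogeneous assms(2)]) (rule distr_gradient_iff)

lemma lifted_TV_eq:
  fixes u :: "real^'d::finite \<Rightarrow> real^'l::{finite,linorder}"
  assumes "open \<Omega>" "weak_density \<Omega> (jac_functional \<Omega> u) \<mu> s" "\<And>i :: 'l. label_gap \<gamma> i > 0"
  shows "lifted_TV \<tau> \<Omega> \<gamma> u = (\<integral>x. (\<Sum>i\<in>UNIV. label_gap \<gamma> i * tv_norm \<tau> (s x $ i)) \<partial>\<mu>)"
  unfolding lifted_TV_def
  by (subst measure_integral_eq[OF assms(1) lifted_tv_pos_homogeneous assms(2) distr_jacobian_iff])
     (use assms(3) in \<open>simp_all add: lifted_tv_integrand_eq\<close>)

section \<open>Integration against derivatives of test functions, and averages of functions of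
  bounded variation\<close>

lemma integral_lebesgue_on_pd:
  fixes f :: "real^'d::finite \<Rightarrow> real"
  assumes \<phi>: "\<phi> \<in> test_functions \<Omega>" and \<Omega>: "open \<Omega>" and f: "f \<in> borel_measurable borel"
  shows "(\<integral>x. f x * pd j \<phi> x \<partial>lebesgue_on \<Omega>) = (\<integral>x. f x * pd j \<phi> x \<partial>lborel)"
proof -
  have 0: "pd j \<phi> x = 0" if "x \<notin> \<Omega>" for x
  proof (rule pd_eq_0)
    show "x \<notin> closure {x. \<phi> x \<noteq> 0}" using \<phi> that by (auto simp: test_functions_def)
  qed
  have "(\<integral>x. f x * pd j \<phi> x \<partial>lebesgue_on \<Omega>) = (\<integral>x. indicator \<Omega> x *\<^sub>R (f x * pd j \<phi> x) \<partial>lebesgue)"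
    using \<Omega> by (intro integral_restrict_space) auto
  also have "\<dots> = (\<integral>x. f x * pd j \<phi> x \<partial>lebesgue)"
    by (rule Bochner_Integration.integral_cong) (auto simp: indicator_def 0)
  also have "\<dots> = (\<integral>x. f x * pd j \<phi> x \<partial>lborel)"
    using f test_function_borel[OF pd_test_function[OF \<phi>]] by (intro integral_completion) simp
  finally show ?thesis .
qed

lemma pd_lebesgue_on:
  assumes "\<phi> \<in> test_functions \<Omega>"
  shows "pd j \<phi> \<in> borel_measurable (lebesgue_on \<Omega>)"
proof -
  have "pd j \<phi> \<in> borel_measurable lebesgue"
    using test_function_borel[OF pd_test_function[OF assms], of j] by (intro measurable_completion) simp
  then show ?thesis by (rule measurable_restrict_space1)
qed

lemma integrable_mult_pd:
  assumes "\<phi> \<in> test_functions \<Omega>" "integrable (lebesgue_on \<Omega>) u"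
  shows "integrable (lebesgue_on \<Omega>) (\<lambda>x. u x * pd j \<phi> x)"
proof -
  obtain C where "\<And>x. \<bar>pd j \<phi> x\<bar> \<le> C" using test_function_bounds(2)[OF pd_test_function[OF assms(1)]] by blast
  from integrable_mult_bounded[OF assms(2) pd_lebesgue_on[OF assms(1)] this] show ?thesis
    by (simp add: mult.commute)
qed

text \<open>Constants have zero weak derivative; this is what removes the offset
  \<open>\<gamma> 1\<close> when the projection is differentiated.\<close>

lemma integral_pd_eq_0:
  assumes \<phi>: "\<phi> \<in> test_functions \<Omega>" and \<Omega>: "open \<Omega>"
  shows "(\<integral>x. pd j \<phi> x \<partial>lebesgue_on \<Omega>) = 0"
proof -
  obtain C where C: "\<And>x. \<bar>pd j \<phi> x\<bar> \<le> C" using test_function_bounds(2)[OF pd_test_function[OF \<phi>]] by blast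
  obtain R where R: "\<And>x. norm x > R \<Longrightarrow> \<phi> x = 0" using test_function_support_bounded[OF \<phi>] by blast
  have "(\<integral>x. pd j \<phi> x \<partial>lborel) = 0"
    by (rule integral_line_derivative_eq_0[OF test_function_borel[OF \<phi>]
          test_function_line_derivative[OF test_function_differentiable[OF \<phi>]] C R])
  then show ?thesis using integral_lebesgue_on_pd[OF \<phi> \<Omega>, of "\<lambda>_. 1" j] by simp
qed

lemma weak_density_integrable_mult:
  assumes "weak_density \<Omega> F \<mu> s" "\<phi> \<in> test_functions \<Omega>"
  shows "integrable \<mu> (\<lambda>x. \<phi> x * (s x \<bullet> b))"
  using assms by (intro test_function_mult_integrable) (auto simp: weak_density_def)

lemma weak_density_average:
  assumes \<Omega>: "open \<Omega>" and u: "integrable (lebesgue_on \<Omega>) u" "weak_density \<Omega> (grad_functional \<Omega> u) \<mu> s"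
    and v: "integrable (lebesgue_on \<Omega>) v" "weak_density \<Omega> (grad_functional \<Omega> v) \<mu> t"
  shows "weak_density \<Omega> (grad_functional \<Omega> (\<lambda>x. (u x + v x) / 2)) \<mu> (\<lambda>x. (1/2) *\<^sub>R (s x + t x))"
  unfolding weak_density_def
proof (intro conjI ballI)
  show "finite_measure \<mu>" "sets \<mu> = sets (restrict_space borel \<Omega>)" "integrable \<mu> (\<lambda>x. (1/2) *\<^sub>R (s x + t x))"
    using u v by (auto simp: weak_density_def)
  fix \<phi> b assume \<phi>: "\<phi> \<in> test_functions \<Omega>" and b: "b \<in> (Basis :: (real^'a) set)"
  obtain j where j: "b = axis j 1" using b by (auto simp: Basis_vec_real)
  have "(\<integral>x. (u x + v x) / 2 * pd j \<phi> x \<partial>lebesgue_on \<Omega>)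
      = (\<integral>x. (1/2) * (u x * pd j \<phi> x) + (1/2) * (v x * pd j \<phi> x) \<partial>lebesgue_on \<Omega>)"
    by (rule Bochner_Integration.integral_cong) (simp_all add: field_simps)
  also have "\<dots> = (1/2) * (\<integral>x. u x * pd j \<phi> x \<partial>lebesgue_on \<Omega>) + (1/2) * (\<integral>x. v x * pd j \<phi> x \<partial>lebesgue_on \<Omega>)"
    using integrable_mult_pd[OF \<phi> u(1)] integrable_mult_pd[OF \<phi> v(1)] by (subst Bochner_Integration.integral_add) auto
  also have "(\<integral>x. u x * pd j \<phi> x \<partial>lebesgue_on \<Omega>) = - (\<integral>x. \<phi> x * (s x \<bullet> b) \<partial>\<mu>)"
    using u(2) \<phi> b unfolding weak_density_def grad_functional_def j by blast
  also have "(\<integral>x. v x * pd j \<phi> x \<partial>lebesgue_on \<Omega>) = - (\<integral>x. \<phi> x * (t x \<bullet> b) \<partial>\<mu>)"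
    using v(2) \<phi> b unfolding weak_density_def grad_functional_def j by blast
  also have "(1/2) * - (\<integral>x. \<phi> x * (s x \<bullet> b) \<partial>\<mu>) + (1/2) * - (\<integral>x. \<phi> x * (t x \<bullet> b) \<partial>\<mu>)
      = - (\<integral>x. (1/2) * (\<phi> x * (s x \<bullet> b)) + (1/2) * (\<phi> x * (t x \<bullet> b)) \<partial>\<mu>)"
    using weak_density_integrable_mult[OF u(2) \<phi>] weak_density_integrable_mult[OF v(2) \<phi>] by simp
  also have "\<dots> = - (\<integral>x. \<phi> x * ((1/2) *\<^sub>R (s x + t x) \<bullet> b) \<partial>\<mu>)"
    by (simp add: inner_add_left field_simps)
  finally show "grad_functional \<Omega> (\<lambda>x. (u x + v x) / 2) b \<phi> = - (\<integral>x. \<phi> x * ((1/2) *\<^sub>R (s x + t x) \<bullet> b) \<partial>\<mu>)"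
    by (simp add: grad_functional_def j)
qed

lemma BV_average:
  assumes \<Omega>: "open \<Omega>" and u: "u \<in> BV \<Omega> {a..b}" and v: "v \<in> BV \<Omega> {a..b}"
  shows "(\<lambda>x. (u x + v x) / 2) \<in> BV \<Omega> {a..b}"
    and "TV \<tau> \<Omega> (\<lambda>x. (u x + v x) / 2) \<le> (TV \<tau> \<Omega> u + TV \<tau> \<Omega> v) / 2"
proof -
  obtain \<mu> s where us: "weak_density \<Omega> (grad_functional \<Omega> u) \<mu> s" by (rule BV_weak_density[OF u])
  obtain \<nu> t where vt: "weak_density \<Omega> (grad_functional \<Omega> v) \<nu> t" by (rule BV_weak_density[OF v])
  obtain \<kappa> s' t' where w: "weak_density \<Omega> (grad_functional \<Omega> u) \<kappa> s'" "weak_density \<Omega> (grad_functional \<Omega> v) \<kappa> t'"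
    using weak_density_common[OF us vt] by metis
  have ui: "integrable (lebesgue_on \<Omega>) u" and vi: "integrable (lebesgue_on \<Omega>) v"
    and ur: "AE x in lebesgue_on \<Omega>. u x \<in> {a..b}" and vr: "AE x in lebesgue_on \<Omega>. v x \<in> {a..b}"
    using u v by (auto simp: BV_def)
  note avg = weak_density_average[OF \<Omega> ui w(1) vi w(2)]
  show "(\<lambda>x. (u x + v x) / 2) \<in> BV \<Omega> {a..b}"
  proof (rule BV_I[OF _ _ avg])
    show "integrable (lebesgue_on \<Omega>) (\<lambda>x. (u x + v x) / 2)" using ui vi by simp
    show "AE x in lebesgue_on \<Omega>. (u x + v x) / 2 \<in> {a..b}" using ur vr by eventually_elim auto
  qed
  have i: "integrable \<kappa> s'" "integrable \<kappa> t'" using w by (auto simp: weak_density_def)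
  have "TV \<tau> \<Omega> (\<lambda>x. (u x + v x) / 2) = (\<integral>x. tv_norm \<tau> ((1/2) *\<^sub>R (s' x + t' x)) \<partial>\<kappa>)"
    by (rule TV_eq[OF \<Omega> avg])
  also have "\<dots> \<le> (\<integral>x. (1/2) * (tv_norm \<tau> (s' x) + tv_norm \<tau> (t' x)) \<partial>\<kappa>)"
    by (intro integral_mono tv_norm_average_le tv_norm_integrable integrable_mult_right Bochner_Integration.integrable_add
        integrable_scaleR_right i)
  also have "\<dots> = (1/2) * (TV \<tau> \<Omega> u + TV \<tau> \<Omega> v)"
    using tv_norm_integrable[OF i(1)] tv_norm_integrable[OF i(2)] by (simp add: TV_eq[OF \<Omega> w(1)] TV_eq[OF \<Omega> w(2)])
  finally show "TV \<tau> \<Omega> (\<lambda>x. (u x + v x) / 2) \<le> (TV \<tau> \<Omega> u + TV \<tau> \<Omega> v) / 2" by simp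
qed

lemma integrable_vec_nth:
  fixes s :: "'a \<Rightarrow> ('b::euclidean_space)^'n::finite"
  assumes "integrable M s"
  shows "integrable M (\<lambda>x. s x $ i)"
  by (rule integrable_bounded_linear[OF bounded_linear_vec_nth assms])

section \<open>Projecting a lifted function of bounded variation\<close>

context labels
begin

text \<open>The projection has the sum of the gaps times the rows of s as derivative density, and
  the triangle inequality bounds its norm by exactly the lifted integrand.\<close>

lemma BV_unlift:
  fixes U :: "real^'d::finite \<Rightarrow> real^'l::{finite,linorder}"
  assumes \<Omega>: "open \<Omega>" "bounded \<Omega>" and U: "U \<in> BV_vec \<Omega> (convex hull lifted_labels)"
  shows "(\<lambda>x. unlift \<gamma> (U x)) \<in> BV \<Omega> {\<gamma> 1..\<gamma> (l + 1)}"
    and "TV \<tau> \<Omega> (\<lambda>x. unlift \<gamma> (U x)) \<le> lifted_TV \<tau> \<Omega> \<gamma> U"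
proof -
  obtain \<mu> s where w: "weak_density \<Omega> (jac_functional \<Omega> U) \<mu> s" by (rule BV_vec_weak_density[OF U])
  have Ui: "integrable (lebesgue_on \<Omega>) U" and Ur: "AE x in lebesgue_on \<Omega>. U x \<in> convex hull lifted_labels"
    using U by (auto simp: BV_vec_def)
  have si: "integrable \<mu> s" using w by (simp add: weak_density_def)
  interpret F: finite_measure "lebesgue_on \<Omega>"
    using \<Omega> by (intro finite_measure_lebesgue_on) (auto intro: lmeasurable_open)
  define t where "t x = (\<Sum>i\<in>UNIV. label_gap \<gamma> i *\<^sub>R s x $ i)" for x
  have ti: "integrable \<mu> t" unfolding t_def[abs_def]
    by (intro Bochner_Integration.integrable_sum integrable_scaleR_right integrable_vec_nth si)
  have ui: "integrable (lebesgue_on \<Omega>) (\<lambda>x. unlift \<gamma> (U x))" unfolding unlift_def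
    by (intro Bochner_Integration.integrable_add Bochner_Integration.integrable_sum integrable_mult_left integrable_vec_nth Ui) simp
  have wt: "weak_density \<Omega> (grad_functional \<Omega> (\<lambda>x. unlift \<gamma> (U x))) \<mu> t"
    unfolding weak_density_def
  proof (intro conjI ballI)
    show "finite_measure \<mu>" "sets \<mu> = sets (restrict_space borel \<Omega>)" "integrable \<mu> t"
      using w ti by (auto simp: weak_density_def)
    fix \<phi> b assume \<phi>: "\<phi> \<in> test_functions \<Omega>" and b: "b \<in> (Basis :: (real^'d) set)"
    obtain j where j: "b = axis j 1" using b by (auto simp: Basis_vec_real)
    have i0: "integrable (lebesgue_on \<Omega>) (\<lambda>x. U x $ i * pd j \<phi> x)" for i
      by (rule integrable_mult_pd[OF \<phi> integrable_vec_nth[OF Ui]])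
    have i1: "integrable (lebesgue_on \<Omega>) (\<lambda>x. pd j \<phi> x)"
      using integrable_mult_pd[OF \<phi>, of "\<lambda>_. 1" j] by simp
    have e: "(\<integral>x. U x $ i * pd j \<phi> x \<partial>lebesgue_on \<Omega>) = - (\<integral>x. \<phi> x * (s x $ i $ j) \<partial>\<mu>)" for i
    proof -
      have "(axis i (axis j 1) :: real^'d^'l::{finite,linorder}) \<in> Basis" by (auto simp: Basis_vec_vec)
      then have "jac_functional \<Omega> U (axis i (axis j 1)) \<phi> = - (\<integral>x. \<phi> x * (s x \<bullet> axis i (axis j 1)) \<partial>\<mu>)"
        using w \<phi> by (simp add: weak_density_def)
      then show ?thesis by (simp add: jac_functional_axis[OF \<phi>] grad_functional_def inner_axis)
    qed
    have s1: "integrable \<mu> (\<lambda>x. \<phi> x * (s x $ i $ j))" for i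
      by (rule test_function_mult_integrable[OF \<phi>])
         (use w in \<open>auto simp: weak_density_def intro!: integrable_vec_nth\<close>)
    have "(\<integral>x. unlift \<gamma> (U x) * pd j \<phi> x \<partial>lebesgue_on \<Omega>)
        = (\<integral>x. \<gamma> 1 * pd j \<phi> x + (\<Sum>i\<in>UNIV. label_gap \<gamma> i * (U x $ i * pd j \<phi> x)) \<partial>lebesgue_on \<Omega>)"
      by (rule Bochner_Integration.integral_cong) (simp_all add: unlift_def algebra_simps sum_distrib_left)
    also have "\<dots> = \<gamma> 1 * (\<integral>x. pd j \<phi> x \<partial>lebesgue_on \<Omega>)
        + (\<Sum>i\<in>UNIV. label_gap \<gamma> i * (\<integral>x. U x $ i * pd j \<phi> x \<partial>lebesgue_on \<Omega>))"
      using i0 i1 by simp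
    also have "\<dots> = - (\<Sum>i\<in>UNIV. label_gap \<gamma> i * (\<integral>x. \<phi> x * (s x $ i $ j) \<partial>\<mu>))"
      by (simp add: e integral_pd_eq_0[OF \<phi> \<Omega>(1)] sum_negf)
    also have "\<dots> = - (\<integral>x. (\<Sum>i\<in>UNIV. label_gap \<gamma> i * (\<phi> x * (s x $ i $ j))) \<partial>\<mu>)"
      using s1 by simp
    also have "\<dots> = - (\<integral>x. \<phi> x * (t x \<bullet> b) \<partial>\<mu>)"
      by (simp add: t_def j inner_axis sum_distrib_left mult_ac)
    finally show "grad_functional \<Omega> (\<lambda>x. unlift \<gamma> (U x)) b \<phi> = - (\<integral>x. \<phi> x * (t x \<bullet> b) \<partial>\<mu>)"
      by (simp add: grad_functional_def j)
  qed
  show "(\<lambda>x. unlift \<gamma> (U x)) \<in> BV \<Omega> {\<gamma> 1..\<gamma> (l + 1)}"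
  proof (rule BV_I[OF ui _ wt])
    show "AE x in lebesgue_on \<Omega>. unlift \<gamma> (U x) \<in> {\<gamma> 1..\<gamma> (l + 1)}"
      using Ur by eventually_elim (rule unlift_range)
  qed
  have "TV \<tau> \<Omega> (\<lambda>x. unlift \<gamma> (U x)) = (\<integral>x. tv_norm \<tau> (t x) \<partial>\<mu>)" by (rule TV_eq[OF \<Omega>(1) wt])
  also have "\<dots> \<le> (\<integral>x. (\<Sum>i\<in>UNIV. label_gap \<gamma> i * tv_norm \<tau> (s x $ i)) \<partial>\<mu>)"
  proof (intro integral_mono tv_norm_integrable ti)
    show "integrable \<mu> (\<lambda>x. \<Sum>i\<in>UNIV. label_gap \<gamma> i * tv_norm \<tau> (s x $ i))"
      by (intro Bochner_Integration.integrable_sum integrable_mult_right tv_norm_integrable integrable_vec_nth si)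
    show "tv_norm \<tau> (t x) \<le> (\<Sum>i\<in>UNIV. label_gap \<gamma> i * tv_norm \<tau> (s x $ i))" for x
      unfolding t_def by (rule tv_norm_sum_le) (use gap_pos less_imp_le in blast)
  qed
  also have "\<dots> = lifted_TV \<tau> \<Omega> \<gamma> U" by (rule lifted_TV_eq[OF \<Omega>(1) w gap_pos, symmetric])
  finally show "TV \<tau> \<Omega> (\<lambda>x. unlift \<gamma> (U x)) \<le> lifted_TV \<tau> \<Omega> \<gamma> U" .
qed

end

lemma half_square_positive_part_derivative:
  "((\<lambda>t. (max 0 t)\<^sup>2 / 2) has_real_derivative max 0 t) (at (t :: real))"
proof -
  consider "t > 0" | "t < 0" | "t = 0" by linarith
  then show ?thesis
  proof cases
    case 1
    have "((\<lambda>t. t\<^sup>2 / 2) has_real_derivative max 0 t) (at t)"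
      using 1 by (auto intro!: derivative_eq_intros)
    then show ?thesis
      by (rule DERIV_cong_ev[THEN iffD1, rotated 3])
         (use 1 in \<open>auto simp: eventually_nhds intro!: exI[of _ "{0<..}"]\<close>)
  next
    case 2
    have "((\<lambda>t. 0) has_real_derivative max 0 t) (at t)" using 2 by simp
    then show ?thesis
      by (rule DERIV_cong_ev[THEN iffD1, rotated 3])
         (use 2 in \<open>auto simp: eventually_nhds intro!: exI[of _ "{..<0}"]\<close>)
  next
    case 3
    have "((\<lambda>h :: real. (max 0 h)\<^sup>2 / 2 / h) \<longlongrightarrow> 0) (at 0)"
    proof (rule Lim_null_comparison)
      show "\<forall>\<^sub>F h in at 0. norm ((max 0 h)\<^sup>2 / 2 / h) \<le> \<bar>h :: real\<bar>"
        by (rule always_eventually) (auto simp: max_def power2_eq_square)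
      show "((\<lambda>h :: real. \<bar>h\<bar>) \<longlongrightarrow> 0) (at 0)"
        using tendsto_rabs[OF tendsto_ident_at[of "0 :: real" UNIV]] by simp
    qed
    then show ?thesis using 3 by (simp add: DERIV_def)
  qed
qed

section \<open>Lifting a scalar function of bounded variation\<close>

context labels
begin

text \<open>The slope is kept at 1 and the division by the gap postponed, so that the increments of
  all ramps together never exceed the increment of t, as \<open>split_chain\<close> demands.\<close>

definition ramp :: "'l \<Rightarrow> real \<Rightarrow> real" where
  "ramp i t = max 0 (t - \<gamma> (pos i)) - max 0 (t - \<gamma> (pos i + 1))"

definition ramp_int :: "'l \<Rightarrow> real \<Rightarrow> real" where
  "ramp_int i t = (max 0 (t - \<gamma> (pos i)))\<^sup>2 / 2 - (max 0 (t - \<gamma> (pos i + 1)))\<^sup>2 / 2"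

lemma lift_component: "lift \<gamma> t $ i = ramp i t / label_gap \<gamma> i"
  by (simp add: lift_def ramp_def)

lemma ramp_split_chain: "split_chain ramp ramp_int"
proof
  have d: "((\<lambda>t. (max 0 (t - c))\<^sup>2 / 2) has_real_derivative max 0 (t - c)) (at t)" for c t :: real
    using DERIV_chain2[OF half_square_positive_part_derivative, of "\<lambda>t. t - c" 1 t UNIV]
    by (simp add: DERIV_diff[OF DERIV_ident DERIV_const, simplified])
  show "(ramp_int i has_real_derivative ramp i t) (at t)" for i t
    unfolding ramp_int_def[abs_def] ramp_def by (intro DERIV_diff d)
  show "ramp i a \<le> ramp i b" if "a \<le> b" for i a b
    using that gap_pos[of i] by (auto simp: ramp_def label_gap_def max_def)
  show "(\<Sum>i\<in>UNIV. ramp i b - ramp i a) \<le> b - a" if "a \<le> b" for a b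
  proof -
    define q where "q k = max 0 (b - \<gamma> k) - max 0 (a - \<gamma> k)" for k
    have "(\<Sum>i\<in>UNIV. ramp i b - ramp i a) = (\<Sum>i\<in>(UNIV :: 'l set). q (pos i) - q (pos i + 1))"
      by (intro sum.cong) (auto simp: ramp_def q_def)
    also have "\<dots> = (\<Sum>k\<in>{1..l}. q k - q (k + 1))"
      unfolding l by (rule sum_pos[where f = "\<lambda>k. q k - q (k + 1)"])
    also have "\<dots> = - (\<Sum>k = 1..<l + 1. q (Suc k) - q k)"
      by (simp add: atLeastLessThanSuc_atLeastAtMost flip: sum_negf)
    also have "\<dots> = q 1 - q (l + 1)"
      by (subst sum_Suc_diff') auto
    \<comment> \<open>Each q k lies between 0 and b - a, which bounds the two boundary terms left by
      telescoping.\<close>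
    also have "\<dots> \<le> b - a" using that by (auto simp: q_def max_def)
    finally show ?thesis .
  qed
qed

text \<open>By the chain rule, row i of the lifted derivative is the density of u times \<theta> i
  over the gap. The gap in the lifted integrand cancels the denominator, and the factors \<theta> i
  sum to at most 1.\<close>

lemma BV_lift:
  fixes u :: "real^'d::finite \<Rightarrow> real"
  assumes \<Omega>: "open \<Omega>" "bounded \<Omega>" and u: "u \<in> BV \<Omega> {\<gamma> 1..\<gamma> (l + 1)}"
  shows "(\<lambda>x. lift \<gamma> (u x) :: real^'l::{finite,linorder}) \<in> BV_vec \<Omega> (convex hull lifted_labels)"
    and "lifted_TV \<tau> \<Omega> \<gamma> (\<lambda>x. lift \<gamma> (u x) :: real^'l::{finite,linorder}) \<le> TV \<tau> \<Omega> u"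
proof -
  interpret split_chain ramp ramp_int by (rule ramp_split_chain)
  interpret F: finite_measure "lebesgue_on \<Omega>"
    using \<Omega> by (intro finite_measure_lebesgue_on) (auto intro: lmeasurable_open)
  obtain \<mu> s where w: "weak_density \<Omega> (grad_functional \<Omega> u) \<mu> s" by (rule BV_weak_density[OF u])
  have fm: "finite_measure \<mu>" and sets: "sets \<mu> = sets (restrict_space borel \<Omega>)" and si: "integrable \<mu> s"
    using w by (auto simp: weak_density_def)
  have ui: "integrable (lebesgue_on \<Omega>) u" and ur: "AE x in lebesgue_on \<Omega>. u x \<in> {\<gamma> 1..\<gamma> (l + 1)}"
    using u by (auto simp: BV_def)
  have um[measurable]: "u \<in> borel_measurable (lebesgue_on \<Omega>)" using ui by simp
  have \<Omega>l: "\<Omega> \<in> sets lebesgue" using \<Omega>(1) by simp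
  \<comment> \<open>u is determined only almost everywhere on \<Omega>, whereas the chain rule needs
    a bounded Borel function of bounded support on the whole space. So a Borel version is clamped to
    the label range and set to 0 outside \<Omega>.\<close>
  let ?I = "\<lambda>t. max (\<gamma> 1) (min (\<gamma> (l + 1)) t)"
  have "(\<lambda>x. if x \<in> \<Omega> then u x else 0) \<in> borel_measurable lebesgue"
    using um \<Omega>l by (simp add: borel_measurable_if)
  then obtain v0 where v0: "v0 \<in> borel_measurable lborel" "AE x in lborel. (if x \<in> \<Omega> then u x else 0) = v0 x"
    using completion_ex_borel_measurable_real by blast
  define v where "v x = indicator \<Omega> x * ?I (v0 x)" for x
  have vm: "v \<in> borel_measurable borel"
    unfolding v_def[abs_def] using v0(1) \<Omega>(1) by (intro borel_measurable_times borel_measurable_indicator) auto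
  have "AE x in lebesgue. (if x \<in> \<Omega> then u x else 0) = v0 x" using v0(2) by (simp add: AE_completion_iff)
  then have "AE x in lebesgue_on \<Omega>. (if x \<in> \<Omega> then u x else 0) = v0 x"
    using \<Omega>l by (subst AE_restrict_space_iff) (auto elim: eventually_mono)
  then have uv: "AE x in lebesgue_on \<Omega>. u x = v x"
    using ur AE_space
  proof eventually_elim
    case (elim x)
    then show ?case by (auto simp: v_def space_restrict_space)
  qed
  define M where "M = \<bar>\<gamma> 1\<bar> + \<bar>\<gamma> (l + 1)\<bar>"
  have vM: "\<bar>v x\<bar> \<le> M" for x by (auto simp: v_def M_def indicator_def max_def min_def)
  obtain R where R: "\<And>x. x \<in> \<Omega> \<Longrightarrow> norm x \<le> R" using \<Omega>(2) by (auto simp: bounded_iff)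
  have vR: "v x = 0" if "norm x > R" for x using R[of x] that by (cases "x \<in> \<Omega>") (auto simp: v_def)
  \<comment> \<open>Passing from u on \<Omega> to v on the whole space does not change these
    integrals, because derivatives of test functions vanish outside \<Omega>.\<close>
  have conv: "(\<integral>x. f (u x) * pd j \<phi> x \<partial>lebesgue_on \<Omega>) = (\<integral>x. f (v x) * pd j \<phi> x \<partial>lborel)"
    if \<phi>: "\<phi> \<in> test_functions \<Omega>" and f[measurable]: "f \<in> borel_measurable borel" for f \<phi> j
  proof -
    have [measurable]: "pd j \<phi> \<in> borel_measurable (lebesgue_on \<Omega>)" by (rule pd_lebesgue_on[OF \<phi>])
    have "v \<in> borel_measurable (lebesgue_on \<Omega>)"
      using vm by (intro measurable_restrict_space1 measurable_completion) simp
    note [measurable] = this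
    have "(\<integral>x. f (u x) * pd j \<phi> x \<partial>lebesgue_on \<Omega>) = (\<integral>x. f (v x) * pd j \<phi> x \<partial>lebesgue_on \<Omega>)"
    proof (rule integral_cong_AE)
      show "AE x in lebesgue_on \<Omega>. f (u x) * pd j \<phi> x = f (v x) * pd j \<phi> x"
        using uv by eventually_elim simp
    qed measurable
    also have "\<dots> = (\<integral>x. f (v x) * pd j \<phi> x \<partial>lborel)"
      by (rule integral_lebesgue_on_pd[OF \<phi> \<Omega>(1)]) (rule measurable_compose[OF vm f])
    finally show ?thesis .
  qed
  have wv: "(\<integral>x. v x * pd j \<phi> x \<partial>lborel) = - (\<integral>x. \<phi> x * (s x $ j) \<partial>\<mu>)" if \<phi>: "\<phi> \<in> test_functions \<Omega>" for \<phi> j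
  proof -
    have "(axis j 1 :: real^'d) \<in> Basis" by (auto simp: Basis_vec_real)
    then have "grad_functional \<Omega> u (axis j 1) \<phi> = - (\<integral>x. \<phi> x * (s x \<bullet> axis j 1) \<partial>\<mu>)"
      using w \<phi> by (simp add: weak_density_def)
    then show ?thesis using conv[OF \<phi>, of "\<lambda>t. t" j] by (simp add: grad_functional_def inner_axis)
  qed
  obtain \<theta> :: "real^'d \<Rightarrow> real^'l::{finite,linorder}" where \<theta>: "\<theta> \<in> borel_measurable \<mu>" "\<And>x. \<theta> x \<in> subprob"
    "\<And>\<phi> i j. \<phi> \<in> test_functions \<Omega> \<Longrightarrow>
      (\<integral>x. ramp i (v x) * pd j \<phi> x \<partial>lborel) = - (\<integral>x. \<phi> x * (\<theta> x $ i * s x $ j) \<partial>\<mu>)"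
    using chain_rule_density[OF ramp_split_chain vm vM vR \<Omega>(1) fm sets si wv] by blast
  have \<theta>b: "0 \<le> \<theta> x $ i" "\<theta> x $ i \<le> 1" "(\<Sum>i\<in>UNIV. \<theta> x $ i) \<le> 1" for x i
  proof -
    show 0: "0 \<le> \<theta> x $ i" for i using \<theta>(2)[of x] by (simp add: subprob_def)
    show 1: "(\<Sum>i\<in>UNIV. \<theta> x $ i) \<le> 1" using \<theta>(2)[of x] by (simp add: subprob_def)
    have "\<theta> x $ i \<le> (\<Sum>i\<in>UNIV. \<theta> x $ i)" by (rule member_le_sum) (use 0 in auto)
    then show "\<theta> x $ i \<le> 1" using 1 by linarith
  qed
  define t :: "real^'d \<Rightarrow> real^'d^'l::{finite,linorder}" where "t x = (\<chi> i. (\<theta> x $ i / label_gap \<gamma> i) *\<^sub>R s x)" for x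
  have \<theta>m[measurable]: "(\<lambda>x. \<theta> x $ i) \<in> borel_measurable \<mu>" for i
    by (rule measurable_compose[OF \<theta>(1)]) simp
  have sj: "(\<lambda>x. s x $ j) \<in> borel_measurable \<mu>" for j
    using integrable_vec_nth[OF si, of j] by simp
  have ti: "integrable \<mu> t"
  proof (rule Bochner_Integration.integrable_bound)
    define G where "G = (\<Sum>i\<in>(UNIV :: 'l set). 1 / label_gap \<gamma> i)"
    show "integrable \<mu> (\<lambda>x. G * norm (s x))" using si by simp
    show "t \<in> borel_measurable \<mu>"
      unfolding t_def[abs_def]
      by (subst borel_measurable_euclidean_space)
         (auto simp: Basis_vec_vec inner_axis intro!: borel_measurable_times borel_measurable_divide \<theta>m sj)
    have G: "G \<ge> 0" unfolding G_def by (intro sum_nonneg) (simp add: gap_pos less_imp_le)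
    have "norm (t x) \<le> G * norm (s x)" for x
    proof -
      have "norm (t x) \<le> (\<Sum>i\<in>UNIV. norm (t x $ i))"
        unfolding norm_vec_def by (rule L2_set_le_sum) simp
      also have "\<dots> \<le> (\<Sum>i\<in>(UNIV :: 'l set). 1 / label_gap \<gamma> i * norm (s x))"
      proof (rule sum_mono)
        fix i :: 'l
        have "\<theta> x $ i / label_gap \<gamma> i \<le> 1 / label_gap \<gamma> i"
          using \<theta>b(2) gap_pos[of i] by (intro divide_right_mono) auto
        then show "norm (t x $ i) \<le> 1 / label_gap \<gamma> i * norm (s x)"
          using \<theta>b(1)[of x i] gap_pos[of i]
          by (simp only: t_def vec_lambda_beta norm_scaleR) (intro mult_right_mono, auto)
      qed
      also have "\<dots> = G * norm (s x)" by (simp only: G_def sum_distrib_right)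
      finally show ?thesis .
    qed
    then show "AE x in \<mu>. norm (t x) \<le> norm (G * norm (s x))" using G by (simp add: abs_mult)
  qed
  let ?W = "\<lambda>x. lift \<gamma> (u x) :: real^'l::{finite,linorder}"
  have wt: "weak_density \<Omega> (jac_functional \<Omega> ?W) \<mu> t"
    unfolding weak_density_def
  proof (intro conjI ballI fm sets ti)
    fix \<phi> b assume \<phi>: "\<phi> \<in> test_functions \<Omega>" and b: "b \<in> (Basis :: (real^'d^'l::{finite,linorder}) set)"
    obtain i j where ij: "b = axis i (axis j 1)" using b by (auto simp: Basis_vec_vec)
    have "jac_functional \<Omega> ?W b \<phi> = (\<integral>x. ramp i (u x) / label_gap \<gamma> i * pd j \<phi> x \<partial>lebesgue_on \<Omega>)"
      unfolding ij jac_functional_axis[OF \<phi>] grad_functional_def lift_component ..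
    also have "\<dots> = (\<integral>x. ramp i (v x) / label_gap \<gamma> i * pd j \<phi> x \<partial>lborel)"
      by (rule conv[OF \<phi>, of "\<lambda>t. ramp i t / label_gap \<gamma> i" j]) measurable
    also have "\<dots> = (1 / label_gap \<gamma> i) * (\<integral>x. ramp i (v x) * pd j \<phi> x \<partial>lborel)"
      by (simp flip: Bochner_Integration.integral_mult_right_zero)
    also have "\<dots> = - ((1 / label_gap \<gamma> i) * (\<integral>x. \<phi> x * (\<theta> x $ i * s x $ j) \<partial>\<mu>))"
      by (simp add: \<theta>(3)[OF \<phi>])
    also have "\<dots> = - (\<integral>x. (1 / label_gap \<gamma> i) * (\<phi> x * (\<theta> x $ i * s x $ j)) \<partial>\<mu>)"
      by (subst Bochner_Integration.integral_mult_right_zero) simp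
    also have "\<dots> = - (\<integral>x. \<phi> x * (t x \<bullet> b) \<partial>\<mu>)"
      by (simp add: ij inner_axis t_def)
    finally show "jac_functional \<Omega> ?W b \<phi> = - (\<integral>x. \<phi> x * (t x \<bullet> b) \<partial>\<mu>)" .
  qed
  have Wr: "AE x in lebesgue_on \<Omega>. ?W x \<in> convex hull lifted_labels"
    using ur by eventually_elim (intro hull_inc lift_in_labels)
  have "bounded (lifted_labels :: (real^'l::{finite,linorder}) set)"
  proof -
    have "norm (w $ i) \<le> 1" if "w \<in> lifted_labels" for w :: "real^'l::{finite,linorder}" and i
      using that by (auto simp: lifted_labels_def lifted_sublabel_def ones_def)
    then have "norm w \<le> real CARD('l)" if "w \<in> lifted_labels" for w :: "real^'l::{finite,linorder}"
      using order_trans[OF norm_le_l1_cart sum_bounded_above[of UNIV "\<lambda>i. \<bar>w $ i\<bar>" 1]] that by auto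
    then show ?thesis by (auto simp: bounded_iff)
  qed
  then have "bounded (convex hull (lifted_labels :: (real^'l::{finite,linorder}) set))" by (rule bounded_convex_hull)
  then obtain C where C: "\<And>w :: real^'l::{finite,linorder}. w \<in> convex hull lifted_labels \<Longrightarrow> norm w \<le> C"
    by (auto simp: bounded_iff)
  have Wi: "integrable (lebesgue_on \<Omega>) ?W"
  proof (rule F.integrable_const_bound)
    show "AE x in lebesgue_on \<Omega>. norm (?W x) \<le> C" using Wr by eventually_elim (rule C)
    show "?W \<in> borel_measurable (lebesgue_on \<Omega>)"
      unfolding lift_def[abs_def]
      by (subst borel_measurable_euclidean_space) (auto simp: Basis_vec_real inner_axis)
  qed
  show "?W \<in> BV_vec \<Omega> (convex hull lifted_labels)" by (rule BV_vec_I[OF Wi Wr wt])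
  have "lifted_TV \<tau> \<Omega> \<gamma> ?W = (\<integral>x. (\<Sum>i\<in>UNIV. label_gap \<gamma> i * tv_norm \<tau> (t x $ i)) \<partial>\<mu>)"
    by (rule lifted_TV_eq[OF \<Omega>(1) wt gap_pos])
  also have "\<dots> \<le> (\<integral>x. tv_norm \<tau> (s x) \<partial>\<mu>)"
  proof (intro integral_mono tv_norm_integrable si)
    show "integrable \<mu> (\<lambda>x. \<Sum>i\<in>UNIV. label_gap \<gamma> i * tv_norm \<tau> (t x $ i))"
      by (intro Bochner_Integration.integrable_sum integrable_mult_right tv_norm_integrable integrable_vec_nth ti)
    fix x
    have "label_gap \<gamma> i * tv_norm \<tau> (t x $ i) = \<theta> x $ i * tv_norm \<tau> (s x)" for i
      using gap_pos[of i] \<theta>b(1)[of x i] by (simp add: t_def tv_norm_scale)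
    then have "(\<Sum>i\<in>UNIV. label_gap \<gamma> i * tv_norm \<tau> (t x $ i)) = (\<Sum>i\<in>UNIV. \<theta> x $ i) * tv_norm \<tau> (s x)"
      by (simp add: sum_distrib_right)
    also have "\<dots> \<le> 1 * tv_norm \<tau> (s x)" by (rule mult_right_mono[OF \<theta>b(3) tv_norm_nonneg])
    finally show "(\<Sum>i\<in>UNIV. label_gap \<gamma> i * tv_norm \<tau> (t x $ i)) \<le> tv_norm \<tau> (s x)" by simp
  qed
  also have "\<dots> = TV \<tau> \<Omega> u" by (rule TV_eq[OF \<Omega>(1) w, symmetric])
  finally show "lifted_TV \<tau> \<Omega> \<gamma> ?W \<le> TV \<tau> \<Omega> u" .
qed

end

section \<open>Comparison of the energies\<close>

text \<open>The integral is a supremum over simple functions below f. A countable family of them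
  already reaches it, and their pointwise supremum is measurable.\<close>

lemma nn_integral_measurable_minorant:
  obtains g where "g \<in> borel_measurable M" "\<And>x. g x \<le> f x" "(\<integral>\<^sup>+x. g x \<partial>M) = (\<integral>\<^sup>+x. f x \<partial>M)"
proof -
  let ?S = "{g. simple_function M g \<and> g \<le> f}"
  have "(\<lambda>_. 0) \<in> ?S" by (simp add: le_fun_def)
  then have "integral\<^sup>S M ` ?S \<noteq> {}" by blast
  from ennreal_Sup_countable_SUP[OF this]
  obtain h :: "nat \<Rightarrow> ennreal" where h: "range h \<subseteq> integral\<^sup>S M ` ?S" "Sup (integral\<^sup>S M ` ?S) = (SUP n. h n)"
    by blast
  have "\<exists>g. simple_function M g \<and> g \<le> f \<and> h n = integral\<^sup>S M g" for n
  proof -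
    have "h n \<in> integral\<^sup>S M ` ?S" using h(1) by (rule subsetD) (rule rangeI)
    then show ?thesis by (elim imageE) auto
  qed
  from choice[OF allI[OF this]]
  obtain g where "\<forall>n. simple_function M (g n) \<and> g n \<le> f \<and> h n = integral\<^sup>S M (g n)" ..
  then have g: "\<And>n. simple_function M (g n)" "\<And>n. g n \<le> f" "\<And>n. h n = integral\<^sup>S M (g n)" by simp_all
  have le: "(SUP n. g n x) \<le> f x" for x 
    by (rule SUP_least) (rule le_funD[OF g(2)])
  show ?thesis
  proof (rule that[of "\<lambda>x. SUP n. g n x"])
    show "(\<lambda>x. SUP n. g n x) \<in> borel_measurable M"
      by (intro borel_measurable_SUP borel_measurable_simple_function g) auto
    show "(SUP n. g n x) \<le> f x" for x by (rule le)
    have "h n \<le> (\<integral>\<^sup>+x. (SUP n. g n x) \<partial>M)" for n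
      unfolding g(3) nn_integral_eq_simple_integral[OF g(1), symmetric]
      by (intro nn_integral_mono SUP_upper) auto
    then have "(\<integral>\<^sup>+x. f x \<partial>M) \<le> (\<integral>\<^sup>+x. (SUP n. g n x) \<partial>M)"
      unfolding nn_integral_def[of M f] h(2) by (intro SUP_least)
    moreover have "(\<integral>\<^sup>+x. (SUP n. g n x) \<partial>M) \<le> (\<integral>\<^sup>+x. f x \<partial>M)" by (intro nn_integral_mono le)
    ultimately show "(\<integral>\<^sup>+x. (SUP n. g n x) \<partial>M) = (\<integral>\<^sup>+x. f x \<partial>M)" by (rule antisym[rotated])
  qed
qed

text \<open>The relaxed data integrand need not be measurable in \<open>x\<close>, in which case \<open>nn_integral\<close> is a
  lower integral; the comparison still holds since only one summand on each side is affected.\<close>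

lemma nn_integral_add_le_add:
  assumes f: "f1 \<in> borel_measurable M" "f2 \<in> borel_measurable M" and fin: "(\<integral>\<^sup>+x. f2 x \<partial>M) \<noteq> \<infinity>"
    and le: "AE x in M. f1 x + g1 x \<le> f2 x + g2 x"
  shows "(\<integral>\<^sup>+x. f1 x \<partial>M) + (\<integral>\<^sup>+x. g1 x \<partial>M) \<le> (\<integral>\<^sup>+x. f2 x \<partial>M) + (\<integral>\<^sup>+x. g2 x \<partial>M)"
proof -
  \<comment> \<open>\<open>k\<close> stands in for g1, so additivity is available on the left. On
    the right g2 dominates the measurable difference f1 + k - f2 almost everywhere, so monotonicity
    suffices for it.\<close>
  obtain k where k: "k \<in> borel_measurable M" "\<And>x. k x \<le> g1 x" "(\<integral>\<^sup>+x. k x \<partial>M) = (\<integral>\<^sup>+x. g1 x \<partial>M)"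
    by (rule nn_integral_measurable_minorant[where M = M and f = g1]) (rule that)
  have ae: "AE x in M. f2 x \<noteq> \<infinity>" by (rule nn_integral_PInf_AE[OF f(2) fin])
  have d: "AE x in M. (f1 x + k x) - f2 x \<le> g2 x"
    using le ae
  proof eventually_elim
    case (elim x)
    have "f1 x + k x \<le> f2 x + g2 x"
      using k(2)[of x] elim(1) by (meson add_left_mono order_trans)
    then show ?case using elim(2) by (simp add: ennreal_minus_le_iff add.commute)
  qed
  have "(\<integral>\<^sup>+x. f1 x \<partial>M) + (\<integral>\<^sup>+x. g1 x \<partial>M) = (\<integral>\<^sup>+x. f1 x + k x \<partial>M)"
    using f(1) k by (simp add: nn_integral_add)
  also have "\<dots> \<le> (\<integral>\<^sup>+x. f2 x + ((f1 x + k x) - f2 x) \<partial>M)"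
  proof (rule nn_integral_mono)
    show "f1 x + k x \<le> f2 x + ((f1 x + k x) - f2 x)" for x
    proof (cases "f2 x \<le> f1 x + k x")
      case True
      then show ?thesis by (simp add: diff_add_cancel_ennreal add.commute[of "f2 x"])
    next
      case False
      then have "f1 x + k x \<le> f2 x" by simp
      then show ?thesis by (rule add_increasing2[rotated]) simp
    qed
  qed
  also have "\<dots> = (\<integral>\<^sup>+x. f2 x \<partial>M) + (\<integral>\<^sup>+x. (f1 x + k x) - f2 x \<partial>M)"
    using f k(1) by (intro nn_integral_add) auto
  also have "\<dots> \<le> (\<integral>\<^sup>+x. f2 x \<partial>M) + (\<integral>\<^sup>+x. g2 x \<partial>M)"
    by (intro add_left_mono nn_integral_mono_AE d)
  finally show ?thesis .
qed

text \<open>Clears the factor 1/2 of the pointwise midpoint inequality, so that the comparison of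
  integrals is free of fractions.\<close>

lemma e2ennreal_double:
  assumes "0 \<le> r" "0 \<le> s"
  shows "ennreal 2 * e2ennreal r + e2ennreal s = e2ennreal (ereal 2 * (r + ereal (1/2) * s))"
proof (cases "r = \<infinity> \<or> s = \<infinity>")
  case True
  then have A: "ereal 2 * (r + ereal (1/2) * s) = \<infinity>" using assms by (cases r; cases s) auto
  have B: "ennreal 2 * e2ennreal r + e2ennreal s = top"
    using True by (auto simp: ennreal_mult_top)
  show ?thesis unfolding A B by simp
next
  case False
  then obtain a b where ab: "r = ereal a" "s = ereal b" "0 \<le> a" "0 \<le> b"
    using assms by (cases r; cases s) auto
  have A: "ereal 2 * (r + ereal (1/2) * s) = ereal (2 * a + b)" by (simp add: ab)
  have B: "ennreal 2 * ennreal a + ennreal b = ennreal (2 * a + b)"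
    using ab by (subst ennreal_plus) (auto simp: ennreal_mult)
  show ?thesis unfolding A unfolding ab e2ennreal_ereal by (rule B)
qed

text \<open>The integrand is jointly measurable over the label range only, while u takes values
  there only almost everywhere; clamping makes the composition measurable.\<close>

lemma integrand_measurable:
  fixes \<rho> :: "real^'d::finite \<Rightarrow> real \<Rightarrow> ereal" and a b :: real
  assumes \<rho>: "(\<lambda>(x, t). \<rho> x t) \<in> borel_measurable (lebesgue_on \<Omega> \<Otimes>\<^sub>M restrict_space borel {a..b})"
    and "a \<le> b" and u: "u \<in> borel_measurable (lebesgue_on \<Omega>)"
  shows "(\<lambda>x. e2ennreal (\<rho> x (max a (min b (u x))))) \<in> borel_measurable (lebesgue_on \<Omega>)"
proof -
  have "(\<lambda>x. max a (min b (u x))) \<in> measurable (lebesgue_on \<Omega>) (restrict_space borel {a..b})"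
    using assms(2) u by (intro measurable_restrict_space2) auto
  then have "(\<lambda>x. (x, max a (min b (u x)))) \<in> measurable (lebesgue_on \<Omega>) (lebesgue_on \<Omega> \<Otimes>\<^sub>M restrict_space borel {a..b})"
    by (intro measurable_Pair) auto
  from measurable_compose[OF this \<rho>]
  have "(\<lambda>x. \<rho> x (max a (min b (u x)))) \<in> borel_measurable (lebesgue_on \<Omega>)" by simp
  then show ?thesis by measurable
qed

lemma bounded_mult_integrable:
  fixes p :: "'a \<Rightarrow> real"
  assumes "integrable M p" "f \<in> borel_measurable M" "AE x in M. f x \<in> {a..b}"
  shows "integrable M (\<lambda>x. p x * f x)"
proof -
  have i: "integrable M (\<lambda>x. max a (min b (f x)) * p x)"
  proof (rule integrable_mult_bounded[OF assms(1)])
    show "\<bar>max a (min b (f x))\<bar> \<le> \<bar>a\<bar> + \<bar>b\<bar>" for x by (auto simp: max_def min_def)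
  qed (use assms(2) in measurable)
  show ?thesis
  proof (rule integrable_cong_AE_imp[OF i])
    show "(\<lambda>x. p x * f x) \<in> borel_measurable M" using assms by simp
    show "AE x in M. max a (min b (f x)) * p x = p x * f x" using assms(3) by eventually_elim auto
  qed
qed

lemma square_integrable_imp_integrable:
  fixes p :: "'a \<Rightarrow> real"
  assumes "finite_measure M" "p \<in> borel_measurable M" "integrable M (\<lambda>x. (norm (p x))\<^sup>2)"
  shows "integrable M p"
proof -
  interpret finite_measure M by fact
  show ?thesis
  proof (rule Bochner_Integration.integrable_bound)
    show "integrable M (\<lambda>x. 1 + (norm (p x))\<^sup>2)" using assms(3) by simp
    have "\<bar>p x\<bar> \<le> 1 + (p x)\<^sup>2" for x
      using zero_le_power2[of "\<bar>p x\<bar> - 1"] by (simp add: power2_eq_square algebra_simps)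
    then show "AE x in M. norm (p x) \<le> norm (1 + (norm (p x))\<^sup>2)" by simp
  qed (use assms in auto)
qed

section \<open>Comparison of the linear terms and transfer of minimisers\<close>

context labels
begin

text \<open>Pointwise the coupled pairing is p times (unlift U - \<gamma> 1). The constant so
  produced is the same for every U and cancels when two competitors are compared.\<close>

lemma pairing_unlift:
  fixes U P :: "real^'d::finite \<Rightarrow> real^'l::{finite,linorder}"
  assumes "integrable (lebesgue_on \<Omega>) p" "P \<in> borel_measurable (lebesgue_on \<Omega>)"
    and P: "AE x in lebesgue_on \<Omega>. P x = p x *\<^sub>R label_gaps \<gamma>"
    and U: "U \<in> borel_measurable (lebesgue_on \<Omega>)" "AE x in lebesgue_on \<Omega>. U x \<in> convex hull lifted_labels"
  shows "pairing \<Omega> P U = pairing \<Omega> p (\<lambda>x. unlift \<gamma> (U x)) - \<gamma> 1 * (\<integral>x. p x \<partial>lebesgue_on \<Omega>)"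
proof -
  have m: "(\<lambda>x. unlift \<gamma> (U x)) \<in> borel_measurable (lebesgue_on \<Omega>)"
    unfolding unlift_inner using U(1) by measurable
  have r: "AE x in lebesgue_on \<Omega>. unlift \<gamma> (U x) \<in> {\<gamma> 1..\<gamma> (l + 1)}"
    using U(2) by eventually_elim (rule unlift_range)
  have i: "integrable (lebesgue_on \<Omega>) (\<lambda>x. p x * unlift \<gamma> (U x))"
    by (rule bounded_mult_integrable[OF assms(1) m r])
  have "pairing \<Omega> P U = (\<integral>x. p x * unlift \<gamma> (U x) - \<gamma> 1 * p x \<partial>lebesgue_on \<Omega>)"
    unfolding pairing_def
  proof (rule integral_cong_AE)
    show "(\<lambda>x. P x \<bullet> U x) \<in> borel_measurable (lebesgue_on \<Omega>)" using assms(2) U(1) by measurable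
    show "(\<lambda>x. p x * unlift \<gamma> (U x) - \<gamma> 1 * p x) \<in> borel_measurable (lebesgue_on \<Omega>)"
      using i assms(1) by simp
    show "AE x in lebesgue_on \<Omega>. P x \<bullet> U x = p x * unlift \<gamma> (U x) - \<gamma> 1 * p x"
      using P by eventually_elim (simp add: unlift_inner algebra_simps)
  qed
  then show ?thesis using i assms(1) by (simp add: pairing_def)
qed

lemma bregman_solution_unlift:
  fixes \<rho> :: "real^'d::finite \<Rightarrow> real \<Rightarrow> ereal" and U P :: "real^'d \<Rightarrow> real^'l::{finite,linorder}"
  assumes \<Omega>: "open \<Omega>" "bounded \<Omega>"
    and \<rho>: "(\<lambda>(x, t). \<rho> x t) \<in> borel_measurable (lebesgue_on \<Omega> \<Otimes>\<^sub>M restrict_space borel {\<gamma> 1..\<gamma> (l + 1)})"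
      "\<forall>x\<in>\<Omega>. \<forall>t\<in>{\<gamma> 1..\<gamma> (l + 1)}. 0 \<le> \<rho> x t"
      "AE x in lebesgue_on \<Omega>. ereal_convex_on {\<gamma> 1..\<gamma> (l + 1)} (\<rho> x)"
    and u: "bregman_solution \<Omega> (BV \<Omega> {\<gamma> 1..\<gamma> (l + 1)}) (data_term \<Omega> \<rho>) (TV \<tau> \<Omega>) p u"
    and U: "bregman_solution \<Omega> (BV_vec \<Omega> (convex hull lifted_labels)) (lifted_data_term \<Omega> \<gamma> \<rho>) (lifted_TV \<tau> \<Omega> \<gamma>) P U"
    and Ul: "AE x in lebesgue_on \<Omega>. U x \<in> lifted_labels"
    and p: "integrable (lebesgue_on \<Omega>) p"
    and P: "P \<in> borel_measurable (lebesgue_on \<Omega>)" "AE x in lebesgue_on \<Omega>. P x = p x *\<^sub>R label_gaps \<gamma>"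
  shows "bregman_solution \<Omega> (BV \<Omega> {\<gamma> 1..\<gamma> (l + 1)}) (data_term \<Omega> \<rho>) (TV \<tau> \<Omega>) p
    (\<lambda>x. (u x + unlift \<gamma> (U x)) / 2)"
proof -
  let ?X = "BV \<Omega> {\<gamma> 1..\<gamma> (l + 1)}" and ?M = "lebesgue_on \<Omega>"
  let ?E = "\<lambda>v. data_term \<Omega> \<rho> v + ereal (TV \<tau> \<Omega> v) - ereal (pairing \<Omega> p v)"
  define z where "z x = unlift \<gamma> (U x)" for x
  define w where "w x = (u x + z x) / 2" for x
  define W where "W x = (lift \<gamma> (u x) :: real^'l::{finite,linorder})" for x
  have uX: "u \<in> ?X" and umin: "\<And>v. v \<in> ?X \<Longrightarrow> \<not> ?E v < ?E u"
    using u by (auto simp: bregman_solution_def is_arg_min_def)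
  have UX: "U \<in> BV_vec \<Omega> (convex hull lifted_labels)" using U by (auto simp: bregman_solution_def is_arg_min_def)
  have zX: "z \<in> ?X" and zJ: "TV \<tau> \<Omega> z \<le> lifted_TV \<tau> \<Omega> \<gamma> U"
    unfolding z_def[abs_def] using BV_unlift[OF \<Omega> UX] by auto
  have WX: "W \<in> BV_vec \<Omega> (convex hull lifted_labels)" and WJ: "lifted_TV \<tau> \<Omega> \<gamma> W \<le> TV \<tau> \<Omega> u"
    unfolding W_def[abs_def] using BV_lift[OF \<Omega> uX] by auto
  have wX: "w \<in> ?X" and wJ: "TV \<tau> \<Omega> w \<le> (TV \<tau> \<Omega> u + TV \<tau> \<Omega> z) / 2"
    unfolding w_def[abs_def] using BV_average[OF \<Omega>(1) uX zX] by auto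
  have meas: "u \<in> borel_measurable ?M" "w \<in> borel_measurable ?M" "z \<in> borel_measurable ?M" "U \<in> borel_measurable ?M" "W \<in> borel_measurable ?M"
    using uX wX zX UX WX by (auto simp: BV_def BV_vec_def)
  have range: "AE x in ?M. u x \<in> {\<gamma> 1..\<gamma> (l + 1)}" "AE x in ?M. w x \<in> {\<gamma> 1..\<gamma> (l + 1)}" "AE x in ?M. z x \<in> {\<gamma> 1..\<gamma> (l + 1)}"
    using uX wX zX by (auto simp: BV_def)
  have hull: "AE x in ?M. U x \<in> convex hull lifted_labels" "AE x in ?M. W x \<in> convex hull lifted_labels"
    using UX WX by (auto simp: BV_vec_def)

  have pw: "pairing \<Omega> p w = (pairing \<Omega> p u + pairing \<Omega> p z) / 2"
  proof -
    have "pairing \<Omega> p w = (\<integral>x. (1/2) * (p x * u x) + (1/2) * (p x * z x) \<partial>?M)"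
      unfolding pairing_def w_def by (rule Bochner_Integration.integral_cong) (simp_all add: field_simps)
    also have "\<dots> = (1/2) * (\<integral>x. p x * u x \<partial>?M) + (1/2) * (\<integral>x. p x * z x \<partial>?M)"
      using bounded_mult_integrable[OF p meas(1) range(1)] bounded_mult_integrable[OF p meas(3) range(3)]
      by (subst Bochner_Integration.integral_add) auto
    finally show ?thesis by (simp add: pairing_def)
  qed
  define c where "c = \<gamma> 1 * (\<integral>x. p x \<partial>?M)"
  have PU: "pairing \<Omega> P U = pairing \<Omega> p z - c"
    unfolding c_def z_def[abs_def] by (rule pairing_unlift[OF p P meas(4) hull(1)])
  have "pairing \<Omega> P W = pairing \<Omega> p (\<lambda>x. unlift \<gamma> (W x)) - c"
    unfolding c_def by (rule pairing_unlift[OF p P meas(5) hull(2)])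
  also have "pairing \<Omega> p (\<lambda>x. unlift \<gamma> (W x)) = pairing \<Omega> p u"
    unfolding pairing_def
  proof (rule integral_cong_AE)
    show "AE x in ?M. p x \<bullet> unlift \<gamma> (W x) = p x \<bullet> u x"
      using range(1) by eventually_elim (simp only: W_def unlift_lift)
    have "(\<lambda>x. unlift \<gamma> (W x)) \<in> borel_measurable ?M"
      unfolding unlift_inner using meas(5) by measurable
    then show "(\<lambda>x. p x \<bullet> unlift \<gamma> (W x)) \<in> borel_measurable ?M" using p by (intro borel_measurable_inner) auto
    show "(\<lambda>x. p x \<bullet> u x) \<in> borel_measurable ?M" using p meas(1) by (intro borel_measurable_inner) auto
  qed
  finally have PW: "pairing \<Omega> P W = pairing \<Omega> p u - c" .

  define a where "a v = (\<integral>\<^sup>+x. e2ennreal (\<rho> x (v x)) \<partial>?M)" for v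
  define b where "b V = (\<integral>\<^sup>+x. e2ennreal (biconj \<rho> x (V x)) \<partial>?M)" for V
  have H: "data_term \<Omega> \<rho> v = enn2ereal (a v)" for v by (simp add: data_term_def a_def)
  have HL: "lifted_data_term \<Omega> \<gamma> \<rho> V = enn2ereal (b V)" for V
    by (simp add: lifted_data_term_def data_term_def b_def)
  have "?E w \<le> ?E u"
  proof (cases "a u = \<infinity>")
    \<comment> \<open>With an infinite data term the energy of u is infinite, so the comparison is
      trivial.\<close>
    case True
    then show ?thesis by (simp add: H)
  next
    case afin: False
    have bW: "b W \<le> a u"
      unfolding b_def a_def
    proof (rule nn_integral_mono_AE)
      show "AE x in ?M. e2ennreal (biconj \<rho> x (W x)) \<le> e2ennreal (\<rho> x (u x))"
        using range(1) by eventually_elim (simp only: W_def biconj_le e2ennreal_mono)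
    qed
    let ?I = "\<lambda>v x. max (\<gamma> 1) (min (\<gamma> (l + 1)) (v x))"
    have g1L: "\<gamma> 1 \<le> \<gamma> (l + 1)" by (rule gamma_le) auto
    have aI: "a v = (\<integral>\<^sup>+x. e2ennreal (\<rho> x (?I v x)) \<partial>?M)" if "AE x in ?M. v x \<in> {\<gamma> 1..\<gamma> (l + 1)}" for v
      unfolding a_def
    proof (rule nn_integral_cong_AE)
      show "AE x in ?M. e2ennreal (\<rho> x (v x)) = e2ennreal (\<rho> x (?I v x))"
        using that by eventually_elim auto
    qed
    \<comment> \<open>The doubled midpoint inequality, integrated. The measurable integrands of w
      and u and the lifted ones, which may fail to be measurable, take the places provided in
      \<open>nn_integral_add_le_add\<close>.\<close>
    have key: "2 * a w + b W \<le> 2 * a u + b U"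
    proof -
      let ?f = "\<lambda>v x. 2 * e2ennreal (\<rho> x (?I v x))"
      have m: "?f v \<in> borel_measurable ?M" if "v \<in> borel_measurable ?M" for v
        using integrand_measurable[OF \<rho>(1) g1L that] by measurable
      have 2: "(\<integral>\<^sup>+x. ?f v x \<partial>?M) = 2 * a v" if "v \<in> borel_measurable ?M" "AE x in ?M. v x \<in> {\<gamma> 1..\<gamma> (l + 1)}" for v
        using integrand_measurable[OF \<rho>(1) g1L that(1)] by (simp add: aI[OF that(2)] nn_integral_cmult)
      have ae: "AE x in ?M. ?f w x + e2ennreal (biconj \<rho> x (W x)) \<le> ?f u x + e2ennreal (biconj \<rho> x (U x))"
        using range(1,2) \<rho>(3) Ul AE_space
      proof eventually_elim
        case (elim x)
        have x: "x \<in> \<Omega>" using elim(5) by (simp add: space_restrict_space)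
        have nn: "0 \<le> \<rho> x t" if "t \<in> {\<gamma> 1..\<gamma> (l + 1)}" for t using \<rho>(2) x that by blast
        have le: "\<rho> x (w x) + ereal (1/2) * biconj \<rho> x (W x) \<le> \<rho> x (u x) + ereal (1/2) * biconj \<rho> x (U x)"
          unfolding w_def W_def z_def by (rule midpoint_biconj[where \<rho> = \<rho> and x = x, OF elim(3) nn elim(1,4)])
        have bn: "0 \<le> biconj \<rho> x V" for V
          using biconj_ge[where c = 0 and s = 0 and \<rho> = \<rho> and x = x and w = V] nn by (simp add: zero_ereal_def)
        have I: "?I w x = w x" "?I u x = u x" using elim(1,2) by auto
        have tw: "ennreal 2 * e2ennreal r + e2ennreal s = e2ennreal (ereal 2 * (r + ereal (1/2) * s))"
          if "0 \<le> r" "0 \<le> s" for r s :: ereal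
          using that by (rule e2ennreal_double)
        have "e2ennreal (ereal 2 * (\<rho> x (w x) + ereal (1/2) * biconj \<rho> x (W x)))
            \<le> e2ennreal (ereal 2 * (\<rho> x (u x) + ereal (1/2) * biconj \<rho> x (U x)))"
          by (intro e2ennreal_mono ereal_mult_left_mono le) simp
        then show ?case
          unfolding tw[OF nn[OF elim(2)] bn, symmetric] tw[OF nn[OF elim(1)] bn, symmetric] I by simp
      qed
      have fin: "(\<integral>\<^sup>+x. ?f u x \<partial>?M) \<noteq> \<infinity>"
        unfolding 2[OF meas(1) range(1)] using afin by (simp add: ennreal_mult_eq_top_iff)
      show ?thesis
        using nn_integral_add_le_add[OF m[OF meas(2)] m[OF meas(1)] fin ae]
        unfolding 2[OF meas(1) range(1)] 2[OF meas(2) range(2)] b_def .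
    qed
    have "\<not> lifted_data_term \<Omega> \<gamma> \<rho> W + ereal (lifted_TV \<tau> \<Omega> \<gamma> W) - ereal (pairing \<Omega> P W)
        < lifted_data_term \<Omega> \<gamma> \<rho> U + ereal (lifted_TV \<tau> \<Omega> \<gamma> U) - ereal (pairing \<Omega> P U)"
      using U WX unfolding bregman_solution_def is_arg_min_def by blast
    then have opt: "enn2ereal (b U) + ereal (lifted_TV \<tau> \<Omega> \<gamma> U) - ereal (pairing \<Omega> P U)
        \<le> enn2ereal (b W) + ereal (lifted_TV \<tau> \<Omega> \<gamma> W) - ereal (pairing \<Omega> P W)"
      by (simp add: HL)
    \<comment> \<open>Cancellation requires finite values: b W is bounded by a u, then b U by
      optimality against W, and finally a w by \<open>key\<close>.\<close>
    obtain au where au: "a u = ennreal au" "au \<ge> 0" using afin by (cases "a u") auto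
    obtain bw where bw: "b W = ennreal bw" "bw \<ge> 0" using bW au by (cases "b W") (auto simp: top_unique)
    obtain bu where bu: "b U = ennreal bu" "bu \<ge> 0" using opt bw by (cases "b U") auto
    have aw_fin: "a w \<noteq> \<infinity>"
      using key au bu by (auto simp: ennreal_mult_eq_top_iff top_unique add_top ennreal_add_eq_top)
    then obtain aw where aw: "a w = ennreal aw" "aw \<ge> 0" by (cases "a w") auto
    have "ennreal (2 * aw + bw) \<le> ennreal (2 * au + bu)"
      using key au bw bu aw by (simp add: ennreal_plus ennreal_mult)
    then have k: "2 * aw + bw \<le> 2 * au + bu"
      by (rule iffD1[OF ennreal_le_iff, rotated]) (use au bu in simp)
    have o: "bu + lifted_TV \<tau> \<Omega> \<gamma> U - pairing \<Omega> P U \<le> bw + lifted_TV \<tau> \<Omega> \<gamma> W - pairing \<Omega> P W"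
      using opt bw bu by (simp add: enn2ereal_ennreal)
    have "aw + TV \<tau> \<Omega> w - pairing \<Omega> p w \<le> au + TV \<tau> \<Omega> u - pairing \<Omega> p u"
    proof -
      \<comment> \<open>Adding the first two premises cancels the lifted data terms and the constant
        c. After replacing the lifted variations by those of u and z, the terms of z cancel against
        the midpoint bounds for w.\<close>
      have "2 * (aw + Jw - q) \<le> 2 * (au + Ju - qu)"
        if "2 * aw + bw \<le> 2 * au + bu" "bu + LU - QU \<le> bw + LW - QW" "Jz \<le> LU" "LW \<le> Ju"
          "Jw \<le> (Ju + Jz) / 2" "q = (qu + qz) / 2" "QU = qz - c" "QW = qu - c"
        for Jw Ju Jz LU LW q qu qz QU QW :: real
        using that by (simp add: field_simps)
      from this[OF k o zJ WJ wJ pw PU PW] show ?thesis by simp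
    qed
    then show ?thesis using au aw by (simp add: H enn2ereal_ennreal)
  qed
  then have "\<not> ?E v < ?E w" if "v \<in> ?X" for v using umin[OF that] by (meson less_le_trans)
  then show ?thesis
    using wX unfolding bregman_solution_def is_arg_min_def w_def[abs_def] z_def by blast
qed

end

text \<open>The initial subgradient is zero only almost everywhere and, not being drawn from a
  subdifferential, comes with no integrability statement; it is exchanged for the zero
  function.\<close>

lemma bregman_solution_AE_zero:
  assumes "AE x in lebesgue_on \<Omega>. p x = 0"
  shows "bregman_solution \<Omega> X H J p v \<longleftrightarrow> bregman_solution \<Omega> X H J (\<lambda>_. 0) v"
proof -
  have "AE x in lebesgue_on \<Omega>. p x \<bullet> v x = 0" for v using assms by eventually_elim simp
  then have "pairing \<Omega> p v = pairing \<Omega> (\<lambda>_. 0) v" for v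
    unfolding pairing_def by (simp add: integral_eq_zero_AE)
  then show ?thesis by (simp add: bregman_solution_def)
qed

theorem proposition3:
  fixes \<Omega> :: "(real^'d::finite) set"
    and L :: nat
    and \<gamma> :: "nat \<Rightarrow> real"
    and \<rho> :: "real^'d \<Rightarrow> real \<Rightarrow> ereal"
    and \<tau> :: tv_kind
    and u p :: "nat \<Rightarrow> real^'d \<Rightarrow> real"
    and U P :: "nat \<Rightarrow> real^'d \<Rightarrow> real^'l::{finite,linorder}"
    and k :: nat
  assumes "open \<Omega>" and "bounded \<Omega>"
    and "L = CARD('l) + 1"
    and "strict_mono_on {1..L} \<gamma>"
    and rho_measurable: "(\<lambda>(x, t). \<rho> x t) \<in>
          borel_measurable (lebesgue_on \<Omega> \<Otimes>\<^sub>M restrict_space borel {\<gamma> 1..\<gamma> L})"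
    and rho_nonneg: "\<forall>x\<in>\<Omega>. \<forall>t\<in>{\<gamma> 1..\<gamma> L}. 0 \<le> \<rho> x t"
    and rho_proper: "\<exists>x\<in>\<Omega>. \<exists>t\<in>{\<gamma> 1..\<gamma> L}. \<rho> x t < \<infinity>"
    and rho_convex: "AE x in lebesgue_on \<Omega>. ereal_convex_on {\<gamma> 1..\<gamma> L} (\<rho> x)"
    and original: "bregman_iteration \<Omega> (BV \<Omega> {\<gamma> 1..\<gamma> L}) (data_term \<Omega> \<rho>) (TV \<tau> \<Omega>) u p"
    and lifted: "bregman_iteration \<Omega> (BV_vec \<Omega> (convex hull lifted_labels))
          (lifted_data_term \<Omega> \<gamma> \<rho>) (lifted_TV \<tau> \<Omega> \<gamma>) U P"
    and unique: "\<forall>n\<ge>1. \<forall>v. bregman_solution \<Omega> (BV \<Omega> {\<gamma> 1..\<gamma> L}) (data_term \<Omega> \<rho>) (TV \<tau> \<Omega>) (p (n - 1)) v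
          \<longrightarrow> (AE x in lebesgue_on \<Omega>. v x = u n x)"
    and sublabel_integral: "\<forall>n\<ge>1. AE x in lebesgue_on \<Omega>. U n x \<in> lifted_labels"
    and "k \<ge> 1"
    and subgradients: "AE x in lebesgue_on \<Omega>. P (k - 1) x = p (k - 1) x *\<^sub>R label_gaps \<gamma>"
  shows "AE x in lebesgue_on \<Omega>. u k x = \<gamma> 1 + (\<Sum>i\<in>UNIV. U k x $ i * (\<gamma> (pos i + 1) - \<gamma> (pos i)))"
proof -
  interpret labels \<gamma> "CARD('l)" "TYPE('l)"
    by unfold_locales (use assms(3,4) in auto)
  let ?M = "lebesgue_on \<Omega>"
  have L: "L = CARD('l) + 1" by fact
  interpret F: finite_measure ?M
    using assms(1,2) by (intro finite_measure_lebesgue_on) (auto intro: lmeasurable_open)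
  have uk: "bregman_solution \<Omega> (BV \<Omega> {\<gamma> 1..\<gamma> L}) (data_term \<Omega> \<rho>) (TV \<tau> \<Omega>) (p (k - 1)) (u k)"
    using original \<open>k \<ge> 1\<close> by (simp add: bregman_iteration_def)
  have Uk: "bregman_solution \<Omega> (BV_vec \<Omega> (convex hull lifted_labels)) (lifted_data_term \<Omega> \<gamma> \<rho>)
      (lifted_TV \<tau> \<Omega> \<gamma>) (P (k - 1)) (U k)"
    using lifted \<open>k \<ge> 1\<close> by (simp add: bregman_iteration_def)
  have Ul: "AE x in ?M. U k x \<in> lifted_labels" using sublabel_integral \<open>k \<ge> 1\<close> by blast
  have "bregman_solution \<Omega> (BV \<Omega> {\<gamma> 1..\<gamma> L}) (data_term \<Omega> \<rho>) (TV \<tau> \<Omega>) (p (k - 1))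
      (\<lambda>x. (u k x + unlift \<gamma> (U k x)) / 2)"
  \<comment> \<open>At k = 1 both subgradients are replaced by zero functions, for which the
    coupling is trivial. Later ones lie in subdifferentials, hence are square-integrable and,
    \<Omega> being of finite measure, integrable.\<close>
  proof (cases "k = 1")
    case True
    have p0: "AE x in ?M. p (k - 1) x = 0" and P0: "AE x in ?M. P (k - 1) x = 0"
      using original lifted True by (auto simp: bregman_iteration_def)
    note u0 = uk[THEN bregman_solution_AE_zero[OF p0, THEN iffD1], unfolded L]
    note U0 = Uk[THEN bregman_solution_AE_zero[OF P0, THEN iffD1]]
    show ?thesis
      unfolding L
      by (rule bregman_solution_AE_zero[OF p0, THEN iffD2], rule bregman_solution_unlift[OF assms(1,2)
            rho_measurable[unfolded L] rho_nonneg[unfolded L] rho_convex[unfolded L] u0 U0 Ul]) simp_all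
  next
    case False
    then have k1: "k - 1 \<ge> 1" using \<open>k \<ge> 1\<close> by simp
    have ps: "p (k - 1) \<in> subdifferential \<Omega> (BV \<Omega> {\<gamma> 1..\<gamma> L}) (TV \<tau> \<Omega>) (u (k - 1))"
      by (rule original[unfolded bregman_iteration_def, THEN conjunct2, rule_format, OF k1, THEN conjunct2])
    have Ps: "P (k - 1) \<in> subdifferential \<Omega> (BV_vec \<Omega> (convex hull lifted_labels)) (lifted_TV \<tau> \<Omega> \<gamma>) (U (k - 1))"
      by (rule lifted[unfolded bregman_iteration_def, THEN conjunct2, rule_format, OF k1, THEN conjunct2])
    note ps = ps[unfolded subdifferential_def mem_Collect_eq] and Ps = Ps[unfolded subdifferential_def mem_Collect_eq]
    have pi: "integrable ?M (p (k - 1))"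
      by (rule square_integrable_imp_integrable[OF F.finite_measure_axioms ps[THEN conjunct1] ps[THEN conjunct2, THEN conjunct1]])
    note Pm = Ps[THEN conjunct1]
    show ?thesis
      unfolding L
      by (rule bregman_solution_unlift[OF assms(1,2) rho_measurable[unfolded L] rho_nonneg[unfolded L]
            rho_convex[unfolded L] uk[unfolded L] Uk Ul pi Pm subgradients])
  qed
  then have "AE x in ?M. (u k x + unlift \<gamma> (U k x)) / 2 = u k x"
    by (rule unique[rule_format, OF \<open>k \<ge> 1\<close>])
  then show ?thesis
    by eventually_elim (simp add: unlift_def label_gap_def)
qed

end
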